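(* Let $\alpha_1,\dots,\alpha_\ell\in(0,\frac19)$, let $(p_1,\dots,p_\ell)$ be a probability vector with all $p_i>0$, and let $\phi\in C^1([0,1])$ be such that for some $i$ there is no measurable $u$ and constant $c$ with $\phi=c+u\circ T_{\alpha_i}-u$ a.e. Then there is $C>0$ such that for $\nu$-almost every $\omega\in\Omega$: there is $N(\omega)$ with $\sigma_n^2(\omega)\ge Cn$ for $n\ge N(\omega)$, and $S_n(\omega)/\sigma_n(\omega)$ converges in distribution with respect to $m$ to the standard normal law, i.e. $m(\{x:S_n(\omega)(x)/\sigma_n(\omega)\le t\})\to\frac1{\sqrt{2\pi}}\int_{-\infty}^te^{-s^2/2}ds$ for all $t\in\mathbb R$.
   Context: For $0<\gamma<1$ let $T_\gamma(x)=x+2^\gamma x^{1+\gamma}$ on $[0,1/2]$ and $T_\gamma(x)=2x-1$ on $(1/2,1]$. $m$ is Lebesgue measure on $[0,1]$, $m(f)=\int f\,dm$. $\Omega=\{1,\dots,\ell\}^{\mathbb N}$ with elements $\omega=(\omega_0,\omega_1,\dots)$, and $\nu$ is the Bernoulli product measure with $\nu(\omega_j=i)=p_i$ independently for each $j$. For $\omega\in\Omega$ let $\mathcal T^j_\omega=T_{\alpha_{\omega_{j-1}}}\circ\cdots\circ T_{\alpha_{\omega_0}}$, $S_n(\omega)=\sum_{j=1}^n\big(\phi\circ\mathcal T^j_\omega-m(\phi\circ\mathcal T^j_\omega)\big)$ (a function on $[0,1]$), and $\sigma_n^2(\omega)=\int S_n(\omega)^2\,dm$. *)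

theory Defs
  imports "HOL-Probability.Probability"
begin

definition LSV :: "real \<Rightarrow> real \<Rightarrow> real" where
  "LSV \<gamma> x = (if x \<le> 1/2 then x + 2 powr \<gamma> * x powr (1 + \<gamma>) else 2 * x - 1)"

abbreviation m01 :: "real measure" where
  "m01 \<equiv> lebesgue_on {0..1}"

definition nu :: "nat \<Rightarrow> (nat \<Rightarrow> real) \<Rightarrow> (nat \<Rightarrow> nat) measure" where
  "nu l p = PiM UNIV (\<lambda>_::nat. point_measure {1..l} (\<lambda>i. ennreal (p i)))"

fun Tcomp :: "(nat \<Rightarrow> real) \<Rightarrow> (nat \<Rightarrow> nat) \<Rightarrow> nat \<Rightarrow> real \<Rightarrow> real" where
  "Tcomp \<alpha> \<omega> 0 = id"
| "Tcomp \<alpha> \<omega> (Suc j) = LSV (\<alpha> (\<omega> j)) \<circ> Tcomp \<alpha> \<omega> j"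

definition Sn :: "(nat \<Rightarrow> real) \<Rightarrow> (real \<Rightarrow> real) \<Rightarrow> nat \<Rightarrow> (nat \<Rightarrow> nat) \<Rightarrow> real \<Rightarrow> real" where
  "Sn \<alpha> \<phi> n \<omega> x = (\<Sum>j=1..n. \<phi> (Tcomp \<alpha> \<omega> j x) - integral\<^sup>L m01 (\<lambda>y. \<phi> (Tcomp \<alpha> \<omega> j y)))"

definition sigma2 :: "(nat \<Rightarrow> real) \<Rightarrow> (real \<Rightarrow> real) \<Rightarrow> nat \<Rightarrow> (nat \<Rightarrow> nat) \<Rightarrow> real" where
  "sigma2 \<alpha> \<phi> n \<omega> = integral\<^sup>L m01 (\<lambda>x. (Sn \<alpha> \<phi> n \<omega> x)\<^sup>2)"

definition C1_on_01 :: "(real \<Rightarrow> real) \<Rightarrow> bool" where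
  "C1_on_01 f \<longleftrightarrow> (\<exists>f'. continuous_on {0..1} f' \<and>
      (\<forall>x\<in>{0..1}. (f has_real_derivative f' x) (at x within {0..1})))"

definition std_normal_cdf :: "real \<Rightarrow> real" where
  "std_normal_cdf t = (LINT s:{..t}|lborel. exp (- (s\<^sup>2) / 2)) / sqrt (2 * pi)"

end

theory Submission
  imports Defs "HOL-Real_Asymp.Real_Asymp"
begin

text \<open>
  Two functions that are nonnegative and decreasing on (0,1] with equal mass lose memory of
  their difference under any composition of transfer operators: along the successive returns of
  the left branch every decreasing function of mass u, bounded by a multiple of 1/sqrt x, is pushed
  above a constant that is a fixed fraction of u minus a small tail, and the same constant
  can be subtracted from both functions. This gives decay of order n^(-2), uniformly in the sequence.

  For the central limit theorem the sum is cut into blocks of length n^0.45 separated by gaps of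
  length n^0.4. The densities obtained by multiplying with exp(i theta S) stay in the span of the
  decreasing functions with a bounded factor while theta times the block length is bounded, so
  decay over the gaps factorizes the characteristic function, and a Taylor expansion of each factor
  and Levy's continuity theorem give the normal limit as soon as the variance grows linearly.

  For the linear growth, sigma_n^2 dominates the sum of the squared norms of the reverse martingale
  differences of S_n. If these norms had no positive lower bound after long runs of the symbol i,
  the correctors would converge almost everywhere to a function u exhibiting the observable as a
  coboundary for the i-th map. Such runs have positive frequency for almost every omega, by
  Hoeffding's inequality and the Borel-Cantelli lemma.
\<close>

section \<open>Transfer operators of the LSV maps\<close>

text \<open>The obstacle is nonstationarity: there is no invariant density, and centring and
  variance depend on the time, the parameter sequence and the starting density. Every estimate is
  therefore uniform over all parameter sequences and starting densities. Cutting off the first n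
  steps then gives the same problem for the shifted sequence and the pushed density, which makes
  inductions over steps, rounds and blocks possible, and each block factor is compared with the
  Gaussian of its own actual variance.

  The rate comes from x^(1/8) \<le> (2 x)^\<gamma> on the left branch: points that stay there for n
  steps fill an interval of length at most of order n^(-8), on which a function bounded by a
  multiple of 1/sqrt x has mass at most of order n^(-4). A coupling round of length s leaves a tail
  of order s^(-4), and s rounds take about s^2 steps, hence n^(-2). With about n^0.55 blocks the
  gaps cost n^(0.55 - 0.8) in total.

  The lower bound of the variance comes from a limiting argument by contradiction, so C is not
  explicit.\<close>

lemma LSV_left: "0 \<le> x \<Longrightarrow> x \<le> 1/2 \<Longrightarrow> LSV \<gamma> x = x * (1 + (2*x) powr \<gamma>)"
  by (cases "x = 0") (auto simp: LSV_def powr_add powr_mult algebra_simps)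

lemma LSV_right: "x > 1/2 \<Longrightarrow> LSV \<gamma> x = 2 * x - 1"
  by (simp add: LSV_def)

lemma LSV_half: "0 < \<gamma> \<Longrightarrow> LSV \<gamma> (1/2) = 1"
  by (subst LSV_left) auto

lemma LSV_mono_left:
  assumes "0 < \<gamma>" "0 \<le> x" "x < y" "y \<le> 1/2"
  shows "LSV \<gamma> x < LSV \<gamma> y"
proof -
  have "(2*x) powr \<gamma> \<le> (2*y) powr \<gamma>"
    using assms by (intro powr_mono2) auto
  then have "x * (1 + (2*x) powr \<gamma>) < y * (1 + (2*y) powr \<gamma>)"
    using assms by (intro mult_less_le_imp_less) (auto intro: add_pos_nonneg)
  then show ?thesis
    using assms by (simp add: LSV_left)
qed

lemma LSV_inj_left: "0 < \<gamma> \<Longrightarrow> inj_on (LSV \<gamma>) {0..1/2}"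
proof (rule linorder_inj_onI)
  fix x y :: real
  assume "0 < \<gamma>" "x < y" "x \<in> {0..1/2}" "y \<in> {0..1/2}"
  then show "LSV \<gamma> x \<noteq> LSV \<gamma> y"
    using LSV_mono_left[of \<gamma> x y] by simp
qed auto

lemma LSV_surj_left:
  assumes "0 < \<gamma>" "0 \<le> y" "y \<le> 1"
  shows "\<exists>x\<in>{0..1/2}. LSV \<gamma> x = y"
proof -
  have "continuous_on {0..1/2} (\<lambda>x. x * (1 + (2*x) powr \<gamma>))"
    using assms by (intro continuous_intros continuous_on_powr') auto
  then obtain x where "0 \<le> x" "x \<le> 1/2" "x * (1 + (2*x) powr \<gamma>) = y"
    using IVT'[of "\<lambda>x. x * (1 + (2*x) powr \<gamma>)" 0 y "1/2"] assms by auto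
  then show ?thesis
    by (intro bexI[of _ x]) (auto simp: LSV_left)
qed

definition linv :: "real \<Rightarrow> real \<Rightarrow> real" where
  "linv \<gamma> = inv_into {0..1/2} (LSV \<gamma>)"

lemma linv_LSV: "0 < \<gamma> \<Longrightarrow> 0 \<le> x \<Longrightarrow> x \<le> 1/2 \<Longrightarrow> linv \<gamma> (LSV \<gamma> x) = x"
  unfolding linv_def by (rule inv_into_f_f[OF LSV_inj_left]) auto

lemma LSV_linv: "0 < \<gamma> \<Longrightarrow> 0 \<le> y \<Longrightarrow> y \<le> 1 \<Longrightarrow> LSV \<gamma> (linv \<gamma> y) = y"
  unfolding linv_def using LSV_surj_left[of \<gamma> y] by (intro f_inv_into_f) (auto simp: image_iff Bex_def)

lemma linv_nonneg: "0 < \<gamma> \<Longrightarrow> 0 \<le> y \<Longrightarrow> y \<le> 1 \<Longrightarrow> 0 \<le> linv \<gamma> y"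
  and linv_le: "0 < \<gamma> \<Longrightarrow> 0 \<le> y \<Longrightarrow> y \<le> 1 \<Longrightarrow> linv \<gamma> y \<le> 1/2"
  using LSV_surj_left[of \<gamma> y] linv_LSV[of \<gamma>] by auto

lemma linv_pos:
  assumes "0 < \<gamma>" "0 < y" "y \<le> 1"
  shows "0 < linv \<gamma> y"
proof -
  have "linv \<gamma> y \<noteq> 0"
    using LSV_linv[of \<gamma> y] LSV_left[of 0 \<gamma>] assms by auto
  then show ?thesis using linv_nonneg[of \<gamma> y] assms by simp
qed

lemma linv_one: "0 < \<gamma> \<Longrightarrow> linv \<gamma> 1 = 1/2"
  using linv_LSV[of \<gamma> "1/2"] by (simp add: LSV_half)

lemma linv_less:
  assumes "0 < \<gamma>" "0 \<le> x" "x < y" "y \<le> 1"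
  shows "linv \<gamma> x < linv \<gamma> y"
proof (rule ccontr)
  assume "\<not> linv \<gamma> x < linv \<gamma> y"
  then have "linv \<gamma> y = linv \<gamma> x \<or> LSV \<gamma> (linv \<gamma> y) < LSV \<gamma> (linv \<gamma> x)"
    using LSV_mono_left[of \<gamma> "linv \<gamma> y" "linv \<gamma> x"] linv_nonneg[of \<gamma> y] linv_le[of \<gamma> x] assms by linarith
  then show False
    using LSV_linv[of \<gamma> x] LSV_linv[of \<gamma> y] assms by auto
qed

lemma linv_mono: "0 < \<gamma> \<Longrightarrow> 0 \<le> x \<Longrightarrow> x \<le> y \<Longrightarrow> y \<le> 1 \<Longrightarrow> linv \<gamma> x \<le> linv \<gamma> y"
  using linv_less[of \<gamma> x y] by (cases "x = y") auto

lemma linv_eq: "0 < \<gamma> \<Longrightarrow> 0 \<le> y \<Longrightarrow> y \<le> 1 \<Longrightarrow> y = linv \<gamma> y * (1 + (2 * linv \<gamma> y) powr \<gamma>)"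
  using LSV_linv[of \<gamma> y] LSV_left[of "linv \<gamma> y" \<gamma>] linv_le[of \<gamma> y] linv_nonneg[of \<gamma> y] by simp

text \<open>The reciprocal of the derivative at the left preimage, as the left branch is x (1 + (2 x) powr gamma).\<close>
definition lweight :: "real \<Rightarrow> real \<Rightarrow> real" where
  "lweight \<gamma> y = 1 / (1 + (1 + \<gamma>) * (2 * linv \<gamma> y) powr \<gamma>)"

lemma lweight_pos: "0 < \<gamma> \<Longrightarrow> 0 < lweight \<gamma> y"
  unfolding lweight_def by (intro divide_pos_pos add_pos_nonneg mult_nonneg_nonneg) auto

text \<open>The left branch is convex, so the reciprocal of its derivative decreases. Together with
  monotonicity of \<open>linv\<close> this is why transfer operators preserve nonnegative decreasing
  functions.\<close>

lemma lweight_antimono: "0 < \<gamma> \<Longrightarrow> 0 \<le> x \<Longrightarrow> x \<le> y \<Longrightarrow> y \<le> 1 \<Longrightarrow> lweight \<gamma> y \<le> lweight \<gamma> x"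
  unfolding lweight_def using linv_mono[of \<gamma> x y] linv_nonneg[of \<gamma> x]
  by (intro divide_left_mono add_left_mono mult_left_mono powr_mono2 mult_pos_pos add_pos_nonneg mult_nonneg_nonneg) auto

text \<open>The derivative of the left branch is largest at 1/2, where it equals 2 + \<gamma> \<le>
  3. The factor 3 is the price per step whenever a function is followed along left
  preimages.\<close>

lemma lweight_ge: assumes "0 < \<gamma>" "\<gamma> \<le> 1" "0 \<le> y" "y \<le> 1" shows "1/3 \<le> lweight \<gamma> y"
proof -
  have "lweight \<gamma> 1 \<le> lweight \<gamma> y" using assms by (intro lweight_antimono) auto
  moreover have "1/3 \<le> lweight \<gamma> 1" using assms by (simp add: lweight_def linv_one field_simps)
  ultimately show ?thesis by simp
qed

text \<open>The point 0 is left out because 1 / sqrt 0 = 0 would break the bounds below; all maps preserve (0,1].\<close>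
definition mu :: "real measure" where
  "mu = restrict_space lborel {0<..1}"

lemma space_mu [simp]: "space mu = {0<..1}"
  by (simp add: mu_def space_restrict_space)

lemma sets_mu: "sets mu = sets (restrict_space borel {0<..1})"
  unfolding mu_def by (simp add: sets_restrict_space)

lemma prob_space_mu: "prob_space mu"
  by (rule prob_spaceI) (simp add: mu_def space_restrict_space emeasure_restrict_space)

interpretation mu: prob_space mu
  by (rule prob_space_mu)

lemma borel_measurable_mu_mono:
  assumes "\<And>x y. 0 < x \<Longrightarrow> x \<le> y \<Longrightarrow> y \<le> 1 \<Longrightarrow> (f x :: real) \<le> f y"
  shows "f \<in> borel_measurable mu"
  using borel_measurable_mono_on_fnc[of "{0<..1}" f] assms
  by (auto simp: mono_on_def measurable_cong_sets[OF sets_mu refl])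

lemma borel_measurable_mu_antimono:
  assumes "\<And>x y. 0 < x \<Longrightarrow> x \<le> y \<Longrightarrow> y \<le> 1 \<Longrightarrow> (f y :: real) \<le> f x"
  shows "f \<in> borel_measurable mu"
  using borel_measurable_mu_mono[of "\<lambda>x. - f x"] assms by simp

lemma measurable_muI:
  "f \<in> borel_measurable M \<Longrightarrow> (\<And>x. x \<in> space M \<Longrightarrow> 0 < f x \<and> f x \<le> 1) \<Longrightarrow> f \<in> measurable M mu"
  by (subst measurable_cong_sets[OF refl sets_mu]) (auto intro!: measurable_restrict_space2)

lemma borel_measurable_mu_ident: "f \<in> borel_measurable borel \<Longrightarrow> f \<in> borel_measurable mu"
  by (subst measurable_cong_sets[OF sets_mu refl]) (rule measurable_restrict_space1)

lemma id_mu_measurable [measurable]: "(\<lambda>x. x) \<in> borel_measurable mu"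
  by (rule borel_measurable_mu_ident) simp

lemma indicator_mu_borel [measurable]: "A \<in> sets borel \<Longrightarrow> indicator A \<in> borel_measurable mu"
  by (rule borel_measurable_mu_ident) simp

lemma linv_le_one: "0 < \<gamma> \<Longrightarrow> 0 \<le> y \<Longrightarrow> y \<le> 1 \<Longrightarrow> linv \<gamma> y \<le> 1"
  using linv_le[of \<gamma> y] by simp

lemma linv_measurable [measurable]: "0 < \<gamma> \<Longrightarrow> linv \<gamma> \<in> measurable mu mu"
  by (intro measurable_muI borel_measurable_mu_mono linv_mono) (auto simp: linv_pos linv_le_one)

lemma lweight_measurable [measurable]: "0 < \<gamma> \<Longrightarrow> lweight \<gamma> \<in> borel_measurable mu"
  by (intro borel_measurable_mu_antimono lweight_antimono) auto

lemma right_measurable [measurable]: "(\<lambda>y. (1 + y) / 2) \<in> measurable mu mu"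
  by (intro measurable_muI borel_measurable_mu_mono) auto

lemma LSV_range:
  assumes "0 < \<gamma>" "0 < x" "x \<le> 1"
  shows "0 < LSV \<gamma> x \<and> LSV \<gamma> x \<le> 1"
proof (cases "x \<le> 1/2")
  case True
  have "LSV \<gamma> x \<le> LSV \<gamma> (1/2)"
    using LSV_mono_left[of \<gamma> x "1/2"] assms True less_eq_real_def by blast
  moreover have "0 < LSV \<gamma> x"
    using assms True by (subst LSV_left) (auto intro!: mult_pos_pos add_pos_nonneg)
  ultimately show ?thesis using assms by (simp add: LSV_half)
qed (use assms in \<open>auto simp: LSV_right\<close>)

lemma LSV_measurable [measurable]: "0 < \<gamma> \<Longrightarrow> LSV \<gamma> \<in> measurable mu mu"
  by (intro measurable_muI borel_measurable_mu_ident) (auto simp: LSV_range, simp add: LSV_def[abs_def])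

section \<open>Pointwise transfer operators and preservation of mass\<close>

definition tr_left :: "real \<Rightarrow> (real \<Rightarrow> real) \<Rightarrow> real \<Rightarrow> real" where
  "tr_left \<gamma> f y = lweight \<gamma> y * f (linv \<gamma> y)"

text \<open>The transfer operator with respect to Lebesgue measure, as a pointwise formula so that monotonicity makes sense; the first summand comes from the left branch.\<close>
definition tr_op :: "real \<Rightarrow> (real \<Rightarrow> real) \<Rightarrow> real \<Rightarrow> real" where
  "tr_op \<gamma> f y = tr_left \<gamma> f y + f ((1 + y) / 2) / 2"

lemma tr_left_measurable [measurable]:
  assumes [simp]: "0 < \<gamma>" and [measurable]: "f \<in> borel_measurable mu"
  shows "tr_left \<gamma> f \<in> borel_measurable mu"
  unfolding tr_left_def[abs_def] by measurable

lemma tr_op_measurable [measurable]: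
  assumes [simp]: "0 < \<gamma>" and [measurable]: "f \<in> borel_measurable mu"
  shows "tr_op \<gamma> f \<in> borel_measurable mu"
  unfolding tr_op_def[abs_def] by measurable

text \<open>The absolute value extends the left branch to a function that is differentiable at 0
  from both sides: there the difference quotient is 1 + |2 h|^\<gamma>, which tends to 1. The
  substitution rule is applied on the closed interval [0,1/2].\<close>

lemma DERIV_left:
  assumes "0 < \<gamma>" "0 \<le> (x::real)"
  shows "((\<lambda>x. x * (1 + \<bar>2*x\<bar> powr \<gamma>)) has_real_derivative (1 + (1+\<gamma>) * (2*x) powr \<gamma>)) (at x)"
proof (cases "x = 0")
  case True
  have "((\<lambda>h::real. 1 + \<bar>2*h\<bar> powr \<gamma>) \<longlongrightarrow> 1 + \<bar>2*0::real\<bar> powr \<gamma>) (at 0)"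
    using assms by (intro tendsto_intros tendsto_powr' ) auto
  then have "((\<lambda>h::real. (h * (1 + \<bar>2*h\<bar> powr \<gamma>)) / h) \<longlongrightarrow> 1 + \<bar>2*0::real\<bar> powr \<gamma>) (at 0)"
    by (rule Lim_transform_eventually) (simp add: eventually_at_filter)
  then show ?thesis using True by (simp add: DERIV_def)
next
  case False
  then have x: "x > 0" using assms by simp
  have "((\<lambda>x. x * (1 + (2*x) powr \<gamma>)) has_real_derivative (1 + (1+\<gamma>) * (2*x) powr \<gamma>)) (at x)"
    using x by (auto intro!: derivative_eq_intros simp: field_simps powr_diff)
  then show ?thesis
    by (rule has_field_derivative_transform_within_open[of _ _ _ "{0<..}"]) (use x in auto)
qed

lemma nn_integral_mu: "f \<in> borel_measurable mu \<Longrightarrow> (\<integral>\<^sup>+x. f x \<partial>mu) = (\<integral>\<^sup>+x. f x * indicator {0<..1} x \<partial>lborel)"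
  unfolding mu_def by (subst nn_integral_restrict_space) auto

lemma indicator_mu_measurable:
  assumes "f \<in> borel_measurable mu"
  shows "(\<lambda>x. f x * indicator {0<..1} x :: real) \<in> borel_measurable borel"
proof -
  have "f \<in> borel_measurable (restrict_space borel {0<..1})"
    using assms by (simp add: measurable_cong_sets[OF sets_mu refl])
  then show ?thesis
    by (subst (asm) borel_measurable_restrict_space_iff) (auto simp: mult.commute)
qed

lemma nn_integral_tr_left:
  assumes g: "0 < \<gamma>" and H[measurable]: "H \<in> borel_measurable mu"
  shows "(\<integral>\<^sup>+y. ennreal (tr_left \<gamma> H y) \<partial>mu) = (\<integral>\<^sup>+x. ennreal (H x) * indicator {0<..1/2} x \<partial>mu)"
proof -
  let ?f = "\<lambda>y. tr_left \<gamma> H y * indicator {0<..1} y"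
  let ?L = "\<lambda>x. x * (1 + \<bar>2*x\<bar> powr \<gamma>)"
  have mf: "?f \<in> borel_measurable borel"
    using g by (intro indicator_mu_measurable) auto
  have L: "?L 0 = 0" "?L (1/2) = 1" by auto
  have LL: "?L x = LSV \<gamma> x" if "0 \<le> x" "x \<le> 1/2" for x using that by (simp add: LSV_left)
  have "(\<integral>\<^sup>+y. ennreal (tr_left \<gamma> H y) \<partial>mu) = (\<integral>\<^sup>+x. ?f x * indicator {?L 0..?L (1/2)} x \<partial>lborel)"
    using g by (subst nn_integral_mu) (auto intro!: nn_integral_cong simp: indicator_def)
  \<comment> \<open>Substitution y = \<open>?L x\<close>. Since \<open>?f\<close> vanishes off
    (0,1], the closed range from \<open>?L 0\<close> to \<open>?L (1/2)\<close> adds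
    nothing.\<close>
  also have "\<dots> = (\<integral>\<^sup>+x. ?f (?L x) * (1 + (1+\<gamma>) * (2*x) powr \<gamma>) * indicator {0..1/2} x \<partial>lborel)"
  proof (rule nn_integral_substitution)
    show "set_borel_measurable borel {?L 0..?L (1/2)} ?f"
      unfolding set_borel_measurable_def using mf by measurable
    show "continuous_on {0..1/2} (\<lambda>x. 1 + (1+\<gamma>) * (2*x) powr \<gamma>)"
      using g by (intro continuous_intros continuous_on_powr') auto
  qed (use DERIV_left g in \<open>auto intro!: add_nonneg_nonneg mult_nonneg_nonneg\<close>)
  also have "\<dots> = (\<integral>\<^sup>+x. ennreal (H x) * indicator {0<..1/2} x * indicator {0<..1} x \<partial>lborel)"
  proof (rule nn_integral_cong, goal_cases)
    case (1 x)
    show ?case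
    proof (cases "0 < x \<and> x \<le> 1/2")
      case True
      \<comment> \<open>\<open>lweight\<close> at \<open>?L x\<close> is the reciprocal of the
        Jacobian at x, so the two cancel.\<close>
      then have "?f (?L x) * (1 + (1+\<gamma>) * (2*x) powr \<gamma>) = H x"
        using g LSV_range[of \<gamma> x] add_pos_nonneg[of 1 "(1+\<gamma>) * (2*x) powr \<gamma>"]
        unfolding LL[OF less_imp_le[OF conjunct1[OF True]] conjunct2[OF True]]
        by (simp add: tr_left_def lweight_def linv_LSV)
      then show ?thesis using True by (simp add: indicator_def)
    next
      case False
      then show ?thesis by (auto simp: indicator_def)
    qed
  qed
  also have "\<dots> = (\<integral>\<^sup>+x. ennreal (H x) * indicator {0<..1/2} x \<partial>mu)"
    by (subst nn_integral_mu) auto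
  finally show ?thesis .
qed

lemma nn_integral_right:
  assumes H[measurable]: "H \<in> borel_measurable mu"
  shows "(\<integral>\<^sup>+y. ennreal (H ((1+y)/2) / 2) \<partial>mu) = (\<integral>\<^sup>+x. ennreal (H x) * indicator {1/2<..1} x \<partial>mu)"
proof -
  let ?f = "\<lambda>y. ennreal (H y * indicator {0<..1} y) * indicator {1/2<..1} y"
  have mf: "?f \<in> borel_measurable borel"
    using indicator_mu_measurable[OF H] by measurable
  have half: "inverse 2 * ennreal z = ennreal (z / 2)" for z
  proof -
    have "ennreal (1/2 * z) = ennreal (1/2) * ennreal z"
      by (rule ennreal_mult') simp
    then show ?thesis by simp
  qed
  have "(\<integral>\<^sup>+x. ennreal (H x) * indicator {1/2<..1} x \<partial>mu) = (\<integral>\<^sup>+x. ?f x \<partial>lborel)"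
    by (subst nn_integral_mu) (auto intro!: nn_integral_cong simp: indicator_def)
  also have "\<dots> = (\<integral>\<^sup>+y. ennreal (1/2) * ?f (1/2 + 1/2 * y) \<partial>lborel)"
    using mf by (subst nn_integral_real_affine[of _ "1/2" "1/2"]) (auto simp: nn_integral_cmult)
  also have "\<dots> = (\<integral>\<^sup>+y. ennreal (H ((1+y)/2) / 2) * indicator {0<..1} y \<partial>lborel)"
    by (rule nn_integral_cong) (auto simp: indicator_def half add_divide_distrib add.commute)
  also have "\<dots> = (\<integral>\<^sup>+y. ennreal (H ((1+y)/2) / 2) \<partial>mu)"
    by (subst nn_integral_mu) auto
  finally show ?thesis ..
qed

text \<open>The left preimages fill (0,1/2] and the right ones (1/2,1], so the two branch integrals
  add up to the whole mass. Nonnegativity lets \<open>ennreal\<close> split the sum of the branches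
  pointwise.\<close>

lemma nn_integral_tr_op:
  assumes g: "0 < \<gamma>" and H[measurable]: "H \<in> borel_measurable mu"
    and nn: "\<And>x. 0 < x \<Longrightarrow> x \<le> 1 \<Longrightarrow> 0 \<le> H x"
  shows "(\<integral>\<^sup>+y. ennreal (tr_op \<gamma> H y) \<partial>mu) = (\<integral>\<^sup>+x. ennreal (H x) \<partial>mu)"
proof -
  have "(\<integral>\<^sup>+y. ennreal (tr_op \<gamma> H y) \<partial>mu) = (\<integral>\<^sup>+y. ennreal (tr_left \<gamma> H y) + ennreal (H ((1+y)/2) / 2) \<partial>mu)"
  proof (rule nn_integral_cong, goal_cases)
    case (1 y)
    then have "0 \<le> tr_left \<gamma> H y" "0 \<le> H ((1+y)/2)"
      using g linv_pos[of \<gamma> y] linv_le[of \<gamma> y] lweight_pos[of \<gamma> y] nn[of "linv \<gamma> y"] nn[of "(1+y)/2"] by (auto simp: tr_left_def)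
    then show ?case by (simp add: tr_op_def)
  qed
  also have "\<dots> = (\<integral>\<^sup>+x. ennreal (H x) * indicator {0<..1/2} x \<partial>mu) + (\<integral>\<^sup>+x. ennreal (H x) * indicator {1/2<..1} x \<partial>mu)"
    using g by (subst nn_integral_add) (auto simp: nn_integral_tr_left nn_integral_right)
  also have "\<dots> = (\<integral>\<^sup>+x. ennreal (H x) * indicator {0<..1/2} x + ennreal (H x) * indicator {1/2<..1} x \<partial>mu)"
    by (subst nn_integral_add) auto
  also have "\<dots> = (\<integral>\<^sup>+x. ennreal (H x) \<partial>mu)"
    by (rule nn_integral_cong) (auto simp: indicator_def)
  finally show ?thesis .
qed

section \<open>Decreasing functions under the transfer operators\<close>

lemma LSV_right_inv: "0 < y \<Longrightarrow> LSV \<gamma> ((1 + y) / 2) = y"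
  by (subst LSV_right) (auto simp: field_simps)

lemma tr_op_cong:
  "0 < \<gamma> \<Longrightarrow> (\<And>x. 0 < x \<Longrightarrow> x \<le> 1 \<Longrightarrow> f x = h x) \<Longrightarrow> 0 < y \<Longrightarrow> y \<le> 1 \<Longrightarrow> tr_op \<gamma> f y = tr_op \<gamma> h y"
  using linv_pos[of \<gamma> y] linv_le_one[of \<gamma> y] by (simp add: tr_op_def tr_left_def)

lemma tr_op_add: "tr_op \<gamma> (\<lambda>x. f x + h x) y = tr_op \<gamma> f y + tr_op \<gamma> h y"
  and tr_op_diff: "tr_op \<gamma> (\<lambda>x. f x - h x) y = tr_op \<gamma> f y - tr_op \<gamma> h y"
  and tr_op_cmult: "tr_op \<gamma> (\<lambda>x. c * f x) y = c * tr_op \<gamma> f y"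
  by (simp_all add: tr_op_def tr_left_def algebra_simps add_divide_distrib diff_divide_distrib)

text \<open>Both preimages of y are mapped back to y, so a factor composed with the map comes out as
  its value at y. Duality, the block recursion and the recursion for correctors all rest on this
  pointwise identity.\<close>

lemma tr_op_mult_comp: "0 < \<gamma> \<Longrightarrow> 0 < y \<Longrightarrow> y \<le> 1 \<Longrightarrow> tr_op \<gamma> (\<lambda>x. f x * h (LSV \<gamma> x)) y = tr_op \<gamma> f y * h y"
  by (simp add: tr_op_def tr_left_def LSV_linv LSV_right_inv algebra_simps)

lemma tr_op_mono:
  assumes "0 < \<gamma>" "\<And>x. 0 < x \<Longrightarrow> x \<le> 1 \<Longrightarrow> f x \<le> h x" "0 < y" "y \<le> 1"
  shows "tr_op \<gamma> f y \<le> tr_op \<gamma> h y"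
  using assms linv_pos[of \<gamma> y] linv_le_one[of \<gamma> y] lweight_pos[of \<gamma> y]
  unfolding tr_op_def tr_left_def by (intro add_mono mult_left_mono divide_right_mono assms(2)) auto

lemma tr_op_zero: "tr_op \<gamma> (\<lambda>x. 0) y = 0"
  by (simp add: tr_op_def tr_left_def)

lemma tr_op_nonneg:
  "0 < \<gamma> \<Longrightarrow> (\<And>x. 0 < x \<Longrightarrow> x \<le> 1 \<Longrightarrow> 0 \<le> f x) \<Longrightarrow> 0 < y \<Longrightarrow> y \<le> 1 \<Longrightarrow> 0 \<le> tr_op \<gamma> f y"
  using tr_op_mono[of \<gamma> "\<lambda>_. 0" f y] by (simp add: tr_op_zero)

lemma AE_mu: "(\<And>x. 0 < x \<Longrightarrow> x \<le> 1 \<Longrightarrow> Q x) \<Longrightarrow> AE x in mu. Q x"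
  by (rule AE_I2) auto

text \<open>For nonnegative functions this is \<open>nn_integral_tr_op\<close>; a general f is split
  into positive and negative parts, on which the operator acts separately by linearity.\<close>

lemma
  assumes g: "0 < \<gamma>" and f: "integrable mu f"
  shows integrable_tr_op: "integrable mu (tr_op \<gamma> f)"
    and integral_tr_op: "integral\<^sup>L mu (tr_op \<gamma> f) = integral\<^sup>L mu f"
proof -
  have nonneg: "integrable mu (tr_op \<gamma> h) \<and> integral\<^sup>L mu (tr_op \<gamma> h) = integral\<^sup>L mu h"
    if h: "integrable mu h" "\<And>x. 0 < x \<Longrightarrow> x \<le> 1 \<Longrightarrow> 0 \<le> h x" for h
  proof -
    have [measurable]: "h \<in> borel_measurable mu" using h by auto
    have nnP: "0 < x \<Longrightarrow> x \<le> 1 \<Longrightarrow> 0 \<le> tr_op \<gamma> h x" for x by (intro tr_op_nonneg g h(2))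
    have e: "(\<integral>\<^sup>+y. ennreal (tr_op \<gamma> h y) \<partial>mu) = (\<integral>\<^sup>+x. ennreal (h x) \<partial>mu)"
      by (rule nn_integral_tr_op) (use g h in auto)
    have "(\<integral>\<^sup>+x. ennreal (h x) \<partial>mu) < \<infinity>"
      using h(1) h(2) by (subst nn_integral_eq_integral) (auto intro!: AE_mu)
    then have "integrable mu (tr_op \<gamma> h)"
      using g e nnP by (intro integrableI_nonneg AE_mu) auto
    moreover have "integral\<^sup>L mu (tr_op \<gamma> h) = integral\<^sup>L mu h"
      using g e nnP h by (simp add: integral_eq_nn_integral AE_mu)
    ultimately show ?thesis by simp
  qed
  have p: "integrable mu (\<lambda>x. max 0 (f x))" "integrable mu (\<lambda>x. max 0 (- f x))"
    using f by auto
  have eq: "f = (\<lambda>x. max 0 (f x) - max 0 (- f x))" by auto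
  have eqP: "tr_op \<gamma> f = (\<lambda>x. tr_op \<gamma> (\<lambda>x. max 0 (f x)) x - tr_op \<gamma> (\<lambda>x. max 0 (- f x)) x)"
    by (subst eq, rule ext, rule tr_op_diff)
  show "integrable mu (tr_op \<gamma> f)"
    unfolding eqP using nonneg[OF p(1)] nonneg[OF p(2)] by auto
  show "integral\<^sup>L mu (tr_op \<gamma> f) = integral\<^sup>L mu f"
    unfolding eqP using nonneg[OF p(1)] nonneg[OF p(2)]
    by (subst (3) eq) (auto simp: Bochner_Integration.integral_diff p)
qed

section \<open>Compositions along a parameter sequence\<close>

fun tr_ops :: "(nat \<Rightarrow> real) \<Rightarrow> nat \<Rightarrow> (real \<Rightarrow> real) \<Rightarrow> real \<Rightarrow> real" where
  "tr_ops g 0 f = f"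
| "tr_ops g (Suc n) f = tr_op (g n) (tr_ops g n f)"

fun orb :: "(nat \<Rightarrow> real) \<Rightarrow> nat \<Rightarrow> real \<Rightarrow> real" where
  "orb g 0 x = x"
| "orb g (Suc n) x = LSV (g n) (orb g n x)"

definition adm :: "(nat \<Rightarrow> real) \<Rightarrow> bool" where
  "adm g \<longleftrightarrow> (\<forall>n. 0 < g n \<and> g n \<le> 1/9)"

lemma admD: "adm g \<Longrightarrow> 0 < g n" "adm g \<Longrightarrow> g n \<le> 1/9"
  by (auto simp: adm_def)

lemma adm_shift: "adm g \<Longrightarrow> adm (\<lambda>i. g (i + n))"
  by (auto simp: adm_def)

lemma tr_ops_shift: "tr_ops g (n + m) f = tr_ops (\<lambda>i. g (i + n)) m (tr_ops g n f)"
  by (induction m) (auto simp: add.commute)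

lemma orb_shift: "orb g (n + m) x = orb (\<lambda>i. g (i + n)) m (orb g n x)"
  by (induction m) (auto simp: add.commute)

lemma orb_range: "adm g \<Longrightarrow> 0 < x \<Longrightarrow> x \<le> 1 \<Longrightarrow> 0 < orb g n x \<and> orb g n x \<le> 1"
  by (induction n) (auto dest: LSV_range[OF admD(1)])

lemma orb_measurable [measurable]: "adm g \<Longrightarrow> orb g n \<in> measurable mu mu"
proof (induction n)
  case (Suc n)
  have "(\<lambda>x. LSV (g n) (orb g n x)) \<in> measurable mu mu"
    by (rule measurable_compose[OF Suc.IH[OF Suc.prems] LSV_measurable[OF admD(1)[OF Suc.prems]]])
  moreover have "orb g (Suc n) = (\<lambda>x. LSV (g n) (orb g n x))" by auto
  ultimately show ?case by simp
next
  case 0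
  have "orb g 0 = (\<lambda>x. x)" by auto
  then show ?case by simp
qed

lemma tr_ops_cong:
  assumes "adm g" "\<And>x. 0 < x \<Longrightarrow> x \<le> 1 \<Longrightarrow> f x = h x" "0 < y" "y \<le> 1"
  shows "tr_ops g n f y = tr_ops g n h y"
  using assms(3,4)
proof (induction n arbitrary: y)
  case (Suc n)
  then show ?case by (auto intro!: tr_op_cong admD(1)[OF assms(1)])
qed (use assms in auto)

lemma tr_ops_add: "tr_ops g n (\<lambda>x. f x + h x) = (\<lambda>y. tr_ops g n f y + tr_ops g n h y)"
  by (induction n) (auto simp: tr_op_add)

lemma tr_ops_diff: "tr_ops g n (\<lambda>x. f x - h x) = (\<lambda>y. tr_ops g n f y - tr_ops g n h y)"
  by (induction n) (auto simp: tr_op_diff)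

lemma tr_ops_cmult: "tr_ops g n (\<lambda>x. c * f x) = (\<lambda>y. c * tr_ops g n f y)"
  by (induction n) (auto simp: tr_op_cmult)

lemma tr_ops_zero: "tr_ops g n (\<lambda>x. 0) y = 0"
  using tr_ops_cmult[of g n 0 "\<lambda>_. 0"] by simp

lemma tr_ops_sum: "finite A \<Longrightarrow> tr_ops g n (\<lambda>x. \<Sum>i\<in>A. f i x) = (\<lambda>y. \<Sum>i\<in>A. tr_ops g n (f i) y)"
  by (induction A rule: finite_induct) (auto simp: tr_ops_add tr_ops_zero)

lemma tr_ops_mult_comp:
  assumes "adm g" "0 < y" "y \<le> 1"
  shows "tr_ops g n (\<lambda>x. f x * h (orb g n x)) y = tr_ops g n f y * h y"
  using assms(2,3)
proof (induction n arbitrary: y h)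
  case (Suc n)
  have "tr_ops g (Suc n) (\<lambda>x. f x * h (orb g (Suc n) x)) y = tr_op (g n) (\<lambda>y. tr_ops g n f y * h (LSV (g n) y)) y"
    unfolding tr_ops.simps orb.simps
    by (rule tr_op_cong[OF admD(1)[OF assms(1)] Suc.IH[where h = "\<lambda>y. h (LSV (g n) y)"]]) (use Suc.prems in auto)
  then show ?case using assms Suc.prems by (simp add: tr_op_mult_comp admD)
qed auto

lemma integrable_tr_ops: "adm g \<Longrightarrow> integrable mu f \<Longrightarrow> integrable mu (tr_ops g n f)"
  by (induction n) (auto intro: integrable_tr_op admD)

lemma integral_tr_ops: "adm g \<Longrightarrow> integrable mu f \<Longrightarrow> integral\<^sup>L mu (tr_ops g n f) = integral\<^sup>L mu f"
  by (induction n) (auto simp: integral_tr_op admD integrable_tr_ops)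

lemma tr_ops_mono:
  assumes "adm g" "\<And>x. 0 < x \<Longrightarrow> x \<le> 1 \<Longrightarrow> f x \<le> h x" "0 < y" "y \<le> 1"
  shows "tr_ops g n f y \<le> tr_ops g n h y"
  using assms(3,4)
proof (induction n arbitrary: y)
  case (Suc n)
  then show ?case by (auto intro!: tr_op_mono admD(1)[OF assms(1)])
qed (use assms in auto)

lemma tr_ops_minus: "tr_ops g n (\<lambda>x. - f x) y = - tr_ops g n f y"
  using tr_ops_cmult[of g n "-1" f] by simp

lemma tr_ops_nonneg:
  "adm g \<Longrightarrow> (\<And>x. 0 < x \<Longrightarrow> x \<le> 1 \<Longrightarrow> 0 \<le> f x) \<Longrightarrow> 0 < y \<Longrightarrow> y \<le> 1 \<Longrightarrow> 0 \<le> tr_ops g n f y"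
  using tr_ops_mono[of g "\<lambda>_. 0" f y n] by (simp add: tr_ops_zero)

lemma tr_ops_abs:
  "adm g \<Longrightarrow> 0 < y \<Longrightarrow> y \<le> 1 \<Longrightarrow> \<bar>tr_ops g n f y\<bar> \<le> tr_ops g n (\<lambda>x. \<bar>f x\<bar>) y"
  using tr_ops_mono[of g f "\<lambda>x. \<bar>f x\<bar>" y n] tr_ops_mono[of g "\<lambda>x. - f x" "\<lambda>x. \<bar>f x\<bar>" y n]
  by (auto simp: tr_ops_minus abs_le_iff)

text \<open>Positivity gives |P f| \<le> P |f| pointwise for the composed operator P, and P
  preserves the integral. Further steps therefore never enlarge an L1 distance.\<close>

lemma tr_ops_L1:
  assumes "adm g" "integrable mu f"
  shows "(\<integral>x. \<bar>tr_ops g n f x\<bar> \<partial>mu) \<le> (\<integral>x. \<bar>f x\<bar> \<partial>mu)"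
proof -
  have "(\<integral>x. \<bar>tr_ops g n f x\<bar> \<partial>mu) \<le> (\<integral>x. tr_ops g n (\<lambda>x. \<bar>f x\<bar>) x \<partial>mu)"
    using assms by (intro integral_mono integrable_abs integrable_tr_ops tr_ops_abs) auto
  then show ?thesis using assms by (simp add: integral_tr_ops)
qed

lemma integrable_mult_bounded:
  assumes "integrable mu f" "h \<in> borel_measurable mu" "\<And>x. 0 < x \<Longrightarrow> x \<le> 1 \<Longrightarrow> \<bar>h x\<bar> \<le> (B::real)"
  shows "integrable mu (\<lambda>x. f x * h x)"
proof (rule Bochner_Integration.integrable_bound)
  show "integrable mu (\<lambda>x. B * f x)" using assms by auto
  show "AE x in mu. norm (f x * h x) \<le> norm (B * f x)"
  proof (rule AE_mu)
    fix x :: real assume "0 < x" "x \<le> 1"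
    then have "\<bar>h x\<bar> \<le> \<bar>B\<bar>" using assms(3)[of x] by linarith
    then show "norm (f x * h x) \<le> norm (B * f x)"
      using mult_right_mono[of "\<bar>h x\<bar>" "\<bar>B\<bar>" "\<bar>f x\<bar>"] by (simp add: abs_mult mult.commute)
  qed
qed (use assms in auto)

text \<open>Pull h out of the operators with \<open>tr_ops_mult_comp\<close> and use preservation of
  the integral. The bound on h serves integrability.\<close>

lemma tr_ops_duality:
  assumes "adm g" "integrable mu f" "h \<in> borel_measurable mu" "\<And>x. 0 < x \<Longrightarrow> x \<le> 1 \<Longrightarrow> \<bar>h x\<bar> \<le> B"
  shows "(\<integral>x. f x * h (orb g n x) \<partial>mu) = (\<integral>y. tr_ops g n f y * h y \<partial>mu)"
proof -
  have "integrable mu (\<lambda>x. f x * h (orb g n x))"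
    using assms by (intro integrable_mult_bounded[where B = B] measurable_compose[OF orb_measurable]) (auto simp: orb_range)
  then have "(\<integral>x. f x * h (orb g n x) \<partial>mu) = (\<integral>y. tr_ops g n (\<lambda>x. f x * h (orb g n x)) y \<partial>mu)"
    using assms by (simp add: integral_tr_ops)
  also have "\<dots> = (\<integral>y. tr_ops g n f y * h y \<partial>mu)"
    by (rule Bochner_Integration.integral_cong) (use assms in \<open>auto simp: tr_ops_mult_comp\<close>)
  finally show ?thesis .
qed

text \<open>The class that replaces invariant cones: by the choice of the factor 5 it is invariant under every transfer operator with parameter at most 1/9, and it is closed under products with nonnegative decreasing functions.\<close>
definition decr_fn :: "real \<Rightarrow> (real \<Rightarrow> real) \<Rightarrow> bool" where
  "decr_fn M f \<longleftrightarrow> integrable mu f \<and> (\<forall>x. 0 < x \<longrightarrow> x \<le> 1 \<longrightarrow> 0 \<le> f x \<and> f x \<le> 5 * M / sqrt x)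
     \<and> (\<forall>x y. 0 < x \<longrightarrow> x \<le> y \<longrightarrow> y \<le> 1 \<longrightarrow> f y \<le> f x) \<and> integral\<^sup>L mu f \<le> M"

lemma decr_fn_integrable: "decr_fn M f \<Longrightarrow> integrable mu f"
  and decr_fn_nonneg: "decr_fn M f \<Longrightarrow> 0 < x \<Longrightarrow> x \<le> 1 \<Longrightarrow> 0 \<le> f x"
  and decr_fn_bound: "decr_fn M f \<Longrightarrow> 0 < x \<Longrightarrow> x \<le> 1 \<Longrightarrow> f x \<le> 5 * M / sqrt x"
  and decr_fn_antimono: "decr_fn M f \<Longrightarrow> 0 < x \<Longrightarrow> x \<le> y \<Longrightarrow> y \<le> 1 \<Longrightarrow> f y \<le> f x"
  and decr_fn_integral: "decr_fn M f \<Longrightarrow> integral\<^sup>L mu f \<le> M"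
  by (auto simp: decr_fn_def)

lemma decr_fn_integral_nonneg: "decr_fn M f \<Longrightarrow> 0 \<le> integral\<^sup>L mu f"
  by (intro integral_nonneg_AE AE_mu decr_fn_nonneg) auto

lemma decr_fn_M_nonneg: "decr_fn M f \<Longrightarrow> 0 \<le> M"
  using decr_fn_integral_nonneg decr_fn_integral by fastforce

lemma measure_mu: "A \<in> sets borel \<Longrightarrow> A \<subseteq> {0<..1} \<Longrightarrow> measure mu A = measure lborel A"
  unfolding mu_def by (rule measure_restrict_space) auto

lemma integral_indicator_mu:
  "0 \<le> a \<Longrightarrow> a \<le> b \<Longrightarrow> b \<le> 1 \<Longrightarrow> (\<integral>x. indicator {a<..b} x * c \<partial>mu) = (b - a) * (c::real)"
proof -
  assume *: "0 \<le> a" "a \<le> b" "b \<le> 1"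
  have "{a<..b} \<inter> {0<..1} = {a<..b}" using * by auto
  moreover have "{a<..b} \<subseteq> {0<..1}" using * by auto
  ultimately show ?thesis using * measure_mu[of "{a<..b}"] by simp
qed

lemma indicator_integrable_mu:
  assumes "integrable mu f" "A \<in> sets borel" shows "integrable mu (\<lambda>x. indicator A x * f x :: real)"
  using integrable_mult_bounded[of f "indicator A" 1] assms by (simp add: mult.commute indicator_def)

section \<open>Invariance and closure properties of the decreasing class\<close>

lemma antimono_le_integral:
  assumes f: "integrable mu f" "\<And>x. 0 < x \<Longrightarrow> x \<le> 1 \<Longrightarrow> 0 \<le> f x"
    "\<And>x y. 0 < x \<Longrightarrow> x \<le> y \<Longrightarrow> y \<le> 1 \<Longrightarrow> f y \<le> f x" and x: "0 < x" "x \<le> 1"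
  shows "x * f x \<le> integral\<^sup>L mu f"
proof -
  have "x * f x = (\<integral>z. indicator {0<..x} z * f x \<partial>mu)"
    using x by (subst integral_indicator_mu) auto
  also have "\<dots> \<le> integral\<^sup>L mu f"
    using x f by (intro integral_mono indicator_integrable_mu) (auto simp: indicator_def)
  finally show ?thesis .
qed

lemma tr_op_antimono:
  assumes g: "0 < \<gamma>" and f: "\<And>x. 0 < x \<Longrightarrow> x \<le> 1 \<Longrightarrow> 0 \<le> f x"
    "\<And>x y. 0 < x \<Longrightarrow> x \<le> y \<Longrightarrow> y \<le> 1 \<Longrightarrow> f y \<le> f x" and x: "0 < x" "x \<le> y" "y \<le> 1"
  shows "tr_op \<gamma> f y \<le> tr_op \<gamma> f x"
  unfolding tr_op_def tr_left_def
  using g x linv_pos[of \<gamma> x] linv_pos[of \<gamma> y] linv_mono[of \<gamma> x y] linv_le_one[of \<gamma> y] lweight_pos[of \<gamma> x] lweight_antimono[of \<gamma> x y]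
  by (intro add_mono mult_mono divide_right_mono f) auto

text \<open>This is the invariance of the bound 5 M / sqrt y, divided by M: the first term is the
  left branch and 1 bounds the right branch. With y = x s^2 and weight at most 1 / s^2 it reduces to
  s^2 sqrt x \<le> 5 (s - 1). Multiplying by s + 1 and using s^2 - 1 = z \<ge> sqrt x, it suffices
  that s^2 (s + 1) \<le> 5, which is the origin of the 5.\<close>

lemma sqrt_linv_ineq:
  assumes g: "0 < \<gamma>" "\<gamma> \<le> 1/9" and y: "0 < y" "y \<le> 1"
  shows "lweight \<gamma> y * (5 / sqrt (linv \<gamma> y)) + 1 \<le> 5 / sqrt y"
proof -
  define x where "x = linv \<gamma> y"
  define z where "z = (2 * x) powr \<gamma>"
  define s where "s = sqrt (1 + z)"
  have x: "0 < x" "x \<le> 1/2" using linv_pos linv_le g y by (auto simp: x_def)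
  have yx: "y = x * (1 + z)" unfolding x_def z_def using g y by (intro linv_eq) auto
  have z: "0 < z" "z \<le> 1"
    using x g powr_le1[of \<gamma> "2*x"] by (auto simp: z_def)
  \<comment> \<open>As 2 x \<le> 1, lowering the exponent from 1/2 to \<gamma> increases the
    power.\<close>
  have "sqrt x \<le> (2 * x) powr (1/2)"
    using x by (simp add: powr_half_sqrt)
  also have "\<dots> \<le> z"
    unfolding z_def using x g by (intro powr_mono') auto
  finally have zx: "sqrt x \<le> z" .
  have s2: "s * s = 1 + z" using z by (simp add: s_def)
  have s: "1 \<le> s" "s \<le> 3/2"
    unfolding s_def using z by (simp, intro real_le_lsqrt) (auto simp: power2_eq_square)
  have w: "lweight \<gamma> y \<le> 1 / (s * s)"
    unfolding lweight_def s2 x_def[symmetric] z_def[symmetric] using z g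
    by (intro divide_left_mono) (auto simp: algebra_simps intro!: add_pos_nonneg mult_pos_pos)
  have "s * s * (s + 1) * sqrt x \<le> 5 * sqrt x"
  proof (rule mult_right_mono)
    have "s * s * (s + 1) \<le> 2 * (5/2)"
      using s2 z s by (intro mult_mono) auto
    then show "s * s * (s + 1) \<le> 5" by simp
  qed (use x in auto)
  also have "\<dots> \<le> 5 * z" using zx by simp
  also have "z = (s - 1) * (s + 1)" using s2 by (simp add: algebra_simps)
  finally have k: "s * s * sqrt x \<le> 5 * (s - 1)"
    using s by (simp add: mult.assoc mult.left_commute[of _ "s+1"] mult.commute[of _ "s+1"])
  have "lweight \<gamma> y * (5 / sqrt x) + 1 \<le> 1 / (s * s) * (5 / sqrt x) + 1"
    using w x by (intro add_right_mono mult_right_mono) auto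
  also have "\<dots> \<le> 5 / (sqrt x * s)"
    using k s x by (simp add: divide_simps mult_ac)
  also have "\<dots> = 5 / sqrt y"
    by (simp add: yx s_def real_sqrt_mult)
  finally show ?thesis by (simp add: x_def)
qed

lemma decr_fn_tr_op:
  assumes g: "0 < \<gamma>" "\<gamma> \<le> 1/9" and f: "decr_fn M f"
  shows "decr_fn M (tr_op \<gamma> f)"
proof -
  note f' = decr_fn_integrable[OF f] decr_fn_nonneg[OF f] decr_fn_antimono[OF f] decr_fn_integral[OF f]
  have "tr_op \<gamma> f y \<le> 5 * M / sqrt y" if y: "0 < y" "y \<le> 1" for y
  proof -
    have p: "0 < linv \<gamma> y" "linv \<gamma> y \<le> 1" using g y linv_pos linv_le_one by auto
    \<comment> \<open>The right preimage is at least 1/2, so half the value there is bounded by the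
      mass of f, hence by M.\<close>
    have "(1+y)/2 * f ((1+y)/2) \<le> M"
      using antimono_le_integral[OF f'(1-3), of "(1+y)/2"] f'(4) y by auto
    moreover have "1/2 * f ((1+y)/2) \<le> (1+y)/2 * f ((1+y)/2)"
      using y f'(2)[of "(1+y)/2"] by (intro mult_right_mono) auto
    moreover have "lweight \<gamma> y * f (linv \<gamma> y) \<le> lweight \<gamma> y * (5 * M / sqrt (linv \<gamma> y))"
      using lweight_pos[of \<gamma> y] g p by (intro mult_left_mono decr_fn_bound[OF f]) auto
    ultimately have "tr_op \<gamma> f y \<le> lweight \<gamma> y * (5 * M / sqrt (linv \<gamma> y)) + M"
      unfolding tr_op_def tr_left_def by linarith
    also have "\<dots> = M * (lweight \<gamma> y * (5 / sqrt (linv \<gamma> y)) + 1)" by (simp add: algebra_simps)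
    also have "\<dots> \<le> M * (5 / sqrt y)"
      by (intro mult_left_mono sqrt_linv_ineq g y decr_fn_M_nonneg[OF f])
    finally show ?thesis by (simp add: mult.commute)
  qed
  then show ?thesis
    unfolding decr_fn_def using g f' by (auto intro!: integrable_tr_op tr_op_nonneg tr_op_antimono simp: integral_tr_op)
qed

lemma decr_fn_tr_ops: "adm g \<Longrightarrow> decr_fn M f \<Longrightarrow> decr_fn M (tr_ops g n f)"
  by (induction n) (auto intro: decr_fn_tr_op admD)

lemma decr_fn_one: "decr_fn 1 (\<lambda>_. 1)"
proof -
  have "1 \<le> 5 / sqrt x" if "0 < x" "x \<le> 1" for x :: real
  proof -
    have "sqrt x \<le> 1" using that by simp
    then have "sqrt x \<le> 5" by linarith
    then show ?thesis using that by (simp add: divide_simps)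
  qed
  then show ?thesis using mu.prob_space by (auto simp: decr_fn_def)
qed

lemma decr_fn_mono: "decr_fn M f \<Longrightarrow> M \<le> M' \<Longrightarrow> decr_fn M' f"
  unfolding decr_fn_def by (auto intro: order_trans[OF _ divide_right_mono[of "5 * M" "5 * M'"]])

lemma decr_fn_add: "decr_fn M f \<Longrightarrow> decr_fn M' h \<Longrightarrow> decr_fn (M + M') (\<lambda>x. f x + h x)"
  unfolding decr_fn_def by (auto simp: distrib_left add_divide_distrib intro!: add_mono)

lemma decr_fn_mult:
  assumes f: "decr_fn M f" and p: "\<And>x. 0 < x \<Longrightarrow> x \<le> 1 \<Longrightarrow> 0 \<le> p x \<and> p x \<le> B"
    "\<And>x y. 0 < x \<Longrightarrow> x \<le> y \<Longrightarrow> y \<le> 1 \<Longrightarrow> p y \<le> p x"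
  shows "decr_fn (B * M) (\<lambda>x. p x * f x)"
proof -
  note f' = decr_fn_integrable[OF f] decr_fn_nonneg[OF f] decr_fn_antimono[OF f] decr_fn_integral[OF f]
  have B: "0 \<le> B" using p(1)[of 1] by auto
  have i: "integrable mu (\<lambda>x. p x * f x)"
    using integrable_mult_bounded[OF f'(1) borel_measurable_mu_antimono[OF p(2)], where B = B] p(1)
    by (auto simp: mult.commute abs_le_iff intro: order_trans[of _ 0])
  have le: "p x * f x \<le> B * f x" if "0 < x" "x \<le> 1" for x
    using p(1)[of x] f'(2)[of x] that by (intro mult_right_mono) auto
  have "(\<integral>x. p x * f x \<partial>mu) \<le> (\<integral>x. B * f x \<partial>mu)"
    using i f' le by (intro integral_mono) auto
  also have "\<dots> \<le> B * M" using f' B by (simp add: mult_left_mono)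
  finally have I: "(\<integral>x. p x * f x \<partial>mu) \<le> B * M" .
  have "p x * f x \<le> 5 * (B * M) / sqrt x" if "0 < x" "x \<le> 1" for x
    using le[OF that] mult_left_mono[OF decr_fn_bound[OF f that] B] by (simp add: mult.left_commute)
  moreover have "p y * f y \<le> p x * f x" if "0 < x" "x \<le> y" "y \<le> 1" for x y
    using that p(1)[of y] p(1)[of x] f'(2)[of y] by (intro mult_mono p(2) f'(3)) auto
  ultimately show ?thesis unfolding decr_fn_def using i I p(1) f'(2) by auto
qed

text \<open>M acts as a norm bound for signed functions. The two parts pass through transfer
  operators separately, with M unchanged.\<close>

definition decr_diff :: "real \<Rightarrow> (real \<Rightarrow> real) \<Rightarrow> bool" where
  "decr_diff M h \<longleftrightarrow> (\<exists>f1 f2. decr_fn M f1 \<and> decr_fn M f2 \<and> (\<forall>x. 0 < x \<longrightarrow> x \<le> 1 \<longrightarrow> h x = f1 x - f2 x))"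

lemma decr_fn_zero: "0 \<le> M \<Longrightarrow> decr_fn M (\<lambda>_. 0)"
  by (auto simp: decr_fn_def)

lemma decr_fn_decr_diff: "decr_fn M f \<Longrightarrow> decr_diff M f"
  unfolding decr_diff_def using decr_fn_zero[OF decr_fn_M_nonneg] by (intro exI[of _ f] exI[of _ "\<lambda>_. 0"]) auto

lemma decr_diff_integrable: assumes "decr_diff M h" shows "integrable mu h"
proof -
  obtain f1 f2 where f: "decr_fn M f1" "decr_fn M f2" "\<And>x. 0 < x \<Longrightarrow> x \<le> 1 \<Longrightarrow> h x = f1 x - f2 x"
    using assms by (auto simp: decr_diff_def)
  have "integrable mu (\<lambda>x. f1 x - f2 x)" using f decr_fn_integrable by auto
  also have "?this \<longleftrightarrow> integrable mu h"
    by (rule Bochner_Integration.integrable_cong) (use f(3) in auto)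
  finally show ?thesis .
qed

lemma decr_diff_add: "decr_diff M f \<Longrightarrow> decr_diff M' h \<Longrightarrow> decr_diff (M + M') (\<lambda>x. f x + h x)"
  unfolding decr_diff_def
proof safe
  fix f1 f2 h1 h2
  assume *: "decr_fn M f1" "decr_fn M f2" "\<forall>x. 0 < x \<longrightarrow> x \<le> 1 \<longrightarrow> f x = f1 x - f2 x"
     "decr_fn M' h1" "decr_fn M' h2" "\<forall>x. 0 < x \<longrightarrow> x \<le> 1 \<longrightarrow> h x = h1 x - h2 x"
  show "\<exists>f1 f2. decr_fn (M + M') f1 \<and> decr_fn (M + M') f2 \<and> (\<forall>x. 0 < x \<longrightarrow> x \<le> 1 \<longrightarrow> f x + h x = f1 x - f2 x)"
    using * by (intro exI[of _ "\<lambda>x. f1 x + h1 x"] exI[of _ "\<lambda>x. f2 x + h2 x"]) (auto intro: decr_fn_add)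
qed

lemma decr_diff_minus: "decr_diff M f \<Longrightarrow> decr_diff M (\<lambda>x. - f x)"
  unfolding decr_diff_def
proof safe
  fix f1 f2
  assume *: "decr_fn M f1" "decr_fn M f2" "\<forall>x. 0 < x \<longrightarrow> x \<le> 1 \<longrightarrow> f x = f1 x - f2 x"
  show "\<exists>f1 f2. decr_fn M f1 \<and> decr_fn M f2 \<and> (\<forall>x. 0 < x \<longrightarrow> x \<le> 1 \<longrightarrow> - f x = f1 x - f2 x)"
    using * by (intro exI[of _ f2] exI[of _ f1]) auto
qed

lemma decr_diff_mono: "decr_diff M f \<Longrightarrow> M \<le> M' \<Longrightarrow> decr_diff M' f"
  unfolding decr_diff_def using decr_fn_mono by blast

lemma decr_diff_cong: "decr_diff M f \<Longrightarrow> (\<And>x. 0 < x \<Longrightarrow> x \<le> 1 \<Longrightarrow> f x = h x) \<Longrightarrow> decr_diff M h"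
  unfolding decr_diff_def by auto

lemma decr_diff_tr_ops: assumes g: "adm g" and "decr_diff M h" shows "decr_diff M (tr_ops g n h)"
proof -
  obtain f1 f2 where f: "decr_fn M f1" "decr_fn M f2" "\<And>x. 0 < x \<Longrightarrow> x \<le> 1 \<Longrightarrow> h x = f1 x - f2 x"
    using assms by (auto simp: decr_diff_def)
  have "tr_ops g n h x = tr_ops g n f1 x - tr_ops g n f2 x" if "0 < x" "x \<le> 1" for x
    using tr_ops_cong[OF g f(3) that] tr_ops_diff[of g n f1 f2] by auto
  then show ?thesis unfolding decr_diff_def using f decr_fn_tr_ops[OF g] by blast
qed

text \<open>Adding a steep decreasing linear function makes a Lipschitz multiplier nonnegative and decreasing.\<close>
lemma decr_diff_mult:
  assumes h: "decr_diff M h" and w: "\<And>x. 0 < x \<Longrightarrow> x \<le> 1 \<Longrightarrow> \<bar>w x\<bar> \<le> \<nu>"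
    "\<And>x y. 0 < x \<Longrightarrow> x \<le> y \<Longrightarrow> y \<le> 1 \<Longrightarrow> \<bar>w x - w y\<bar> \<le> lam * (y - x)" and l: "0 \<le> lam"
  shows "decr_diff ((3*\<nu> + 2*lam) * M) (\<lambda>x. w x * h x)"
proof -
  obtain f1 f2 where f: "decr_fn M f1" "decr_fn M f2" "\<And>x. 0 < x \<Longrightarrow> x \<le> 1 \<Longrightarrow> h x = f1 x - f2 x"
    using h by (auto simp: decr_diff_def)
  have nu: "0 \<le> \<nu>" using w(1)[of 1] by auto
  have "0 \<le> w x + \<nu> + lam * (1 - x) \<and> w x + \<nu> + lam * (1 - x) \<le> 2 * \<nu> + lam" if "0 < x" "x \<le> 1" for x
    using w(1)[OF that] mult_nonneg_nonneg[OF l, of "1 - x"] mult_nonneg_nonneg[OF l, of x] that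
    by (auto simp: abs_le_iff algebra_simps)
  moreover have "w y + \<nu> + lam * (1 - y) \<le> w x + \<nu> + lam * (1 - x)" if "0 < x" "x \<le> y" "y \<le> 1" for x y
    using w(2)[OF that] by (auto simp: abs_le_iff algebra_simps)
  ultimately have a: "decr_fn M f \<Longrightarrow> decr_fn ((2 * \<nu> + lam) * M) (\<lambda>x. (w x + \<nu> + lam * (1 - x)) * f x)" for f
    by (intro decr_fn_mult) auto
  have b: "decr_fn M f \<Longrightarrow> decr_fn ((\<nu> + lam) * M) (\<lambda>x. (\<nu> + lam * (1 - x)) * f x)" for f
    using nu l by (intro decr_fn_mult) (auto intro!: mult_left_mono add_nonneg_nonneg mult_left_le)
  \<comment> \<open>Here w = (w + \<nu> + lam (1 - x)) - (\<nu> + lam (1 - x)), with both brackets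
    nonnegative and decreasing, bounded by 2 \<nu> + lam and \<nu> + lam. Multiplying out against f1
    - f2 puts one product of each kind on either side, so the two constants add up.\<close>
  have e: "(2 * \<nu> + lam) * M + (\<nu> + lam) * M = (3*\<nu> + 2*lam) * M" by (simp add: algebra_simps)
  have "w x * h x = ((w x + \<nu> + lam * (1 - x)) * f1 x + (\<nu> + lam * (1 - x)) * f2 x)
      - ((w x + \<nu> + lam * (1 - x)) * f2 x + (\<nu> + lam * (1 - x)) * f1 x)" if "0 < x" "x \<le> 1" for x
    unfolding f(3)[OF that] by (simp add: algebra_simps)
  then show ?thesis
    unfolding decr_diff_def e[symmetric] using decr_fn_add[OF a[OF f(1)] b[OF f(2)]] decr_fn_add[OF a[OF f(2)] b[OF f(1)]]
    by blast
qed

section \<open>Loss of memory\<close>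

text \<open>\<open>tr_lefts g n f\<close> is the part of the pushed function that has used left
  branches only, and \<open>tau g n 1\<close> is the right end of the set of points whose positions
  at times 0 to n - 1 all lie in (0,1/2].\<close>

fun tr_lefts :: "(nat \<Rightarrow> real) \<Rightarrow> nat \<Rightarrow> (real \<Rightarrow> real) \<Rightarrow> real \<Rightarrow> real" where
  "tr_lefts g 0 f = f"
| "tr_lefts g (Suc n) f = tr_left (g n) (tr_lefts g n f)"

fun tau :: "(nat \<Rightarrow> real) \<Rightarrow> nat \<Rightarrow> real \<Rightarrow> real" where
  "tau g 0 b = b"
| "tau g (Suc n) b = tau g n (linv (g n) b)"

lemma tr_lefts_shift: "tr_lefts g (Suc n) f = tr_lefts (\<lambda>i. g (Suc i)) n (tr_left (g 0) f)"
  by (induction n) auto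

lemma tau_range: "adm g \<Longrightarrow> 0 < b \<Longrightarrow> b \<le> 1 \<Longrightarrow> 0 < tau g n b \<and> tau g n b \<le> 1"
  by (induction n arbitrary: b) (auto simp: linv_pos linv_le_one admD)

lemma tr_left_le_tr_op:
  assumes "0 < \<gamma>" "\<And>x. 0 < x \<Longrightarrow> x \<le> 1 \<Longrightarrow> 0 \<le> f x" "0 < y" "y \<le> 1"
  shows "tr_left \<gamma> f y \<le> tr_op \<gamma> f y"
  using assms(2)[of "(1 + y) / 2"] assms(3,4) by (simp add: tr_op_def)

lemma tr_left_mono:
  "0 < \<gamma> \<Longrightarrow> (\<And>x. 0 < x \<Longrightarrow> x \<le> 1 \<Longrightarrow> f x \<le> h x) \<Longrightarrow> 0 < y \<Longrightarrow> y \<le> 1 \<Longrightarrow> tr_left \<gamma> f y \<le> tr_left \<gamma> h y"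
  unfolding tr_left_def using linv_pos[of \<gamma> y] linv_le_one[of \<gamma> y] lweight_pos[of \<gamma> y] by (intro mult_left_mono) auto

lemma tr_left_nonneg:
  "0 < \<gamma> \<Longrightarrow> (\<And>x. 0 < x \<Longrightarrow> x \<le> 1 \<Longrightarrow> 0 \<le> f x) \<Longrightarrow> 0 < y \<Longrightarrow> y \<le> 1 \<Longrightarrow> 0 \<le> tr_left \<gamma> f y"
  unfolding tr_left_def using linv_pos[of \<gamma> y] linv_le_one[of \<gamma> y] lweight_pos[of \<gamma> y] by (intro mult_nonneg_nonneg) auto

lemma tr_left_antimono:
  assumes g: "0 < \<gamma>" and f: "\<And>x. 0 < x \<Longrightarrow> x \<le> 1 \<Longrightarrow> 0 \<le> f x"
    "\<And>x y. 0 < x \<Longrightarrow> x \<le> y \<Longrightarrow> y \<le> 1 \<Longrightarrow> f y \<le> f x" and x: "0 < x" "x \<le> y" "y \<le> 1"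
  shows "tr_left \<gamma> f y \<le> tr_left \<gamma> f x"
  unfolding tr_left_def
  using g x linv_pos[of \<gamma> x] linv_pos[of \<gamma> y] linv_mono[of \<gamma> x y] linv_le_one[of \<gamma> y] lweight_pos[of \<gamma> x] lweight_antimono[of \<gamma> x y]
  by (intro mult_mono f) auto

lemma integrable_tr_left:
  assumes g: "0 < \<gamma>" and f: "integrable mu f" "\<And>x. 0 < x \<Longrightarrow> x \<le> 1 \<Longrightarrow> 0 \<le> f x"
  shows "integrable mu (tr_left \<gamma> f)"
proof (rule Bochner_Integration.integrable_bound[OF integrable_tr_op[OF g f(1)]])
  show "tr_left \<gamma> f \<in> borel_measurable mu" using g f by auto
  show "AE x in mu. norm (tr_left \<gamma> f x) \<le> norm (tr_op \<gamma> f x)"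
  proof (rule AE_mu)
    fix x :: real assume x: "0 < x" "x \<le> 1"
    have "0 \<le> tr_left \<gamma> f x" "tr_left \<gamma> f x \<le> tr_op \<gamma> f x"
      by (rule tr_left_nonneg tr_left_le_tr_op; use g f x in auto)+
    then show "norm (tr_left \<gamma> f x) \<le> norm (tr_op \<gamma> f x)" by simp
  qed
qed

lemma integral_tr_left:
  assumes g: "0 < \<gamma>" and f: "integrable mu f" "\<And>x. 0 < x \<Longrightarrow> x \<le> 1 \<Longrightarrow> 0 \<le> f x"
    and b: "0 < b" "b \<le> 1"
  shows "(\<integral>x. indicator {0<..b} x * tr_left \<gamma> f x \<partial>mu) = (\<integral>x. indicator {0<..linv \<gamma> b} x * f x \<partial>mu)"
proof -
  let ?h = "\<lambda>x. indicator {0<..linv \<gamma> b} x * f x"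
  have h: "integrable mu ?h" using f by (intro indicator_integrable_mu) auto
  have gb: "0 < linv \<gamma> b" "linv \<gamma> b \<le> 1/2" using linv_pos linv_le g b by auto
  have hm: "?h \<in> borel_measurable mu" using h by auto
  have "(\<integral>\<^sup>+y. ennreal (indicator {0<..b} y * tr_left \<gamma> f y) \<partial>mu) = (\<integral>\<^sup>+y. ennreal (tr_left \<gamma> ?h y) \<partial>mu)"
  proof (rule nn_integral_cong, goal_cases)
    case (1 y)
    have "linv \<gamma> y \<le> linv \<gamma> b \<longleftrightarrow> y \<le> b"
      using linv_mono[of \<gamma> y b] linv_less[of \<gamma> b y] g b 1 by fastforce
    then show ?case using 1 linv_pos[of \<gamma> y] g by (auto simp: tr_left_def indicator_def)
  qed
  also have "\<dots> = (\<integral>\<^sup>+x. ennreal (?h x) * indicator {0<..1/2} x \<partial>mu)"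
    by (rule nn_integral_tr_left[OF g hm])
  also have "\<dots> = (\<integral>\<^sup>+x. ennreal (?h x) \<partial>mu)"
    by (rule nn_integral_cong) (use gb in \<open>auto simp: indicator_def\<close>)
  finally have e: "(\<integral>\<^sup>+y. ennreal (indicator {0<..b} y * tr_left \<gamma> f y) \<partial>mu) = (\<integral>\<^sup>+x. ennreal (?h x) \<partial>mu)" .
  have i: "integrable mu (\<lambda>x. indicator {0<..b} x * tr_left \<gamma> f x)"
    using f g by (intro indicator_integrable_mu integrable_tr_left) auto
  have "(\<integral>x. indicator {0<..b} x * tr_left \<gamma> f x \<partial>mu) = enn2real (\<integral>\<^sup>+y. ennreal (indicator {0<..b} y * tr_left \<gamma> f y) \<partial>mu)"
    using i by (intro integral_eq_nn_integral AE_mu mult_nonneg_nonneg tr_left_nonneg g f) auto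
  also have "\<dots> = (\<integral>x. ?h x \<partial>mu)"
    unfolding e using h by (intro integral_eq_nn_integral[symmetric] AE_mu mult_nonneg_nonneg f) auto
  finally show ?thesis .
qed

lemma tr_lefts_props:
  assumes g: "adm g" and f: "integrable mu f" "\<And>x. 0 < x \<Longrightarrow> x \<le> 1 \<Longrightarrow> 0 \<le> f x"
  shows "integrable mu (tr_lefts g n f)" and "\<And>x. 0 < x \<Longrightarrow> x \<le> 1 \<Longrightarrow> 0 \<le> tr_lefts g n f x"
proof (induction n)
  case (Suc n)
  { case 1 show ?case unfolding tr_lefts.simps by (rule integrable_tr_left[OF admD(1)[OF g] Suc]) }
  { case 2 then show ?case unfolding tr_lefts.simps by (intro tr_left_nonneg[OF admD(1)[OF g] Suc(2)]) auto }
qed (use f in auto)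

lemma tr_lefts_antimono:
  assumes g: "adm g" and f: "integrable mu f" "\<And>x. 0 < x \<Longrightarrow> x \<le> 1 \<Longrightarrow> 0 \<le> f x"
    "\<And>x y. 0 < x \<Longrightarrow> x \<le> y \<Longrightarrow> y \<le> 1 \<Longrightarrow> f y \<le> f x"
  shows "0 < x \<Longrightarrow> x \<le> y \<Longrightarrow> y \<le> 1 \<Longrightarrow> tr_lefts g n f y \<le> tr_lefts g n f x"
proof (induction n arbitrary: x y)
  case (Suc n)
  show ?case unfolding tr_lefts.simps
    by (rule tr_left_antimono[OF admD(1)[OF g] tr_lefts_props(2)[OF g f(1,2)] Suc.IH]) (use Suc.prems in auto)
qed (use f in auto)

lemma integral_tr_lefts:
  assumes g: "adm g" and f: "integrable mu f" "\<And>x. 0 < x \<Longrightarrow> x \<le> 1 \<Longrightarrow> 0 \<le> f x"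
  shows "0 < b \<Longrightarrow> b \<le> 1 \<Longrightarrow> (\<integral>x. indicator {0<..b} x * tr_lefts g n f x \<partial>mu) = (\<integral>x. indicator {0<..tau g n b} x * f x \<partial>mu)"
proof (induction n arbitrary: b)
  case (Suc n)
  have "(\<integral>x. indicator {0<..b} x * tr_lefts g (Suc n) f x \<partial>mu) = (\<integral>x. indicator {0<..linv (g n) b} x * tr_lefts g n f x \<partial>mu)"
    unfolding tr_lefts.simps by (rule integral_tr_left[OF admD(1)[OF g] tr_lefts_props[OF g f] Suc.prems])
  also have "\<dots> = (\<integral>x. indicator {0<..tau g n (linv (g n) b)} x * f x \<partial>mu)"
    using Suc.prems g by (intro Suc.IH linv_pos linv_le_one admD(1)[OF g]) auto
  finally show ?case by simp
qed auto

lemma integral_mu_unit: fixes f :: "real \<Rightarrow> real" shows "(\<integral>x. indicator {0<..1} x * f x \<partial>mu) = (\<integral>x. f x \<partial>mu)"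
  by (rule Bochner_Integration.integral_cong) (auto simp: indicator_def)

section \<open>Escape from the neutral fixed point\<close>

lemma root_bound:
  assumes "0 \<le> s" "s \<le> (1::real)"
  shows "(1 + s) powr (-1/8) \<le> 1 - s/16"
proof -
  define u where "u = 1 - s/16"
  have u: "0 < u" using assms by (simp add: u_def)
  \<comment> \<open>Bernoulli gives (1 - s/16)^8 \<ge> 1 - s/2, and (1 - s/2) (1 + s) \<ge> 1 for s
    in [0,1]; the power -1/8 then undoes the eighth power.\<close>
  have "1 + of_nat 8 * (- s / 16) \<le> (1 + (- s / 16)) ^ 8"
    by (rule Bernoulli_inequality) (use assms in auto)
  then have "1 - s/2 \<le> u ^ 8" by (simp add: u_def)
  then have "(1 - s/2) * (1 + s) \<le> u ^ 8 * (1 + s)"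
    using assms by (intro mult_right_mono) auto
  moreover have "1 \<le> (1 - s/2) * (1 + s)"
    using assms mult_left_le[of s s] by (simp add: algebra_simps)
  ultimately have "1 / u ^ 8 \<le> 1 + s" using u by (simp add: field_simps)
  then have "(1 + s) powr (-1/8) \<le> (1 / u ^ 8) powr (-1/8)"
    using u by (intro powr_mono2') auto
  also have "1 / u ^ 8 = u powr (-8)" using u by (simp add: powr_minus divide_inverse powr_numeral)
  also have "(u powr (-8)) powr (-1/8) = u" using u by (simp add: powr_powr)
  finally show ?thesis by (simp add: u_def)
qed

text \<open>In the coordinate y^(-1/8) a backward step is at least a translation by 1/16. Since 2 x
  \<le> 1 and \<gamma> \<le> 1/8, s = x^(1/8) \<le> z, so y \<ge> x (1 + s); the factor 1 - s/16
  from \<open>root_bound\<close> then takes x^(-1/8) s / 16 = 1/16 off x^(-1/8).\<close>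

lemma linv_decay:
  assumes g: "0 < \<gamma>" "\<gamma> \<le> 1/9" and y: "0 < y" "y \<le> 1"
  shows "y powr (-1/8) + 1/16 \<le> linv \<gamma> y powr (-1/8)"
proof -
  define x where "x = linv \<gamma> y"
  define z where "z = (2 * x) powr \<gamma>"
  define s where "s = x powr (1/8)"
  have x: "0 < x" "x \<le> 1/2" using linv_pos linv_le g y by (auto simp: x_def)
  have yx: "y = x * (1 + z)" unfolding x_def z_def using g y by (intro linv_eq) auto
  have s: "0 < s" "s \<le> 1" using x powr_le1[of "1/8" x] by (auto simp: s_def)
  have "s \<le> (2 * x) powr (1/8)" unfolding s_def using x by (intro powr_mono2) auto
  also have "\<dots> \<le> z" unfolding z_def using x g by (intro powr_mono') auto
  finally have sz: "s \<le> z" .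
  have "y powr (-1/8) \<le> (x * (1 + s)) powr (-1/8)"
    unfolding yx using x s sz by (intro powr_mono2') auto
  also have "\<dots> = x powr (-1/8) * (1 + s) powr (-1/8)"
    using x s by (intro powr_mult)
  also have "\<dots> \<le> x powr (-1/8) * (1 - s/16)"
    using s by (intro mult_left_mono root_bound) auto
  also have "\<dots> = x powr (-1/8) - 1/16"
    using x by (simp add: s_def algebra_simps powr_add[symmetric])
  finally show ?thesis by (simp add: x_def)
qed

lemma tau_decay:
  assumes g: "adm g"
  shows "0 < b \<Longrightarrow> b \<le> 1 \<Longrightarrow> b powr (-1/8) + n/16 \<le> tau g n b powr (-1/8)"
proof (induction n arbitrary: b)
  case (Suc n)
  have "b powr (-1/8) + 1/16 \<le> linv (g n) b powr (-1/8)"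
    using g Suc.prems by (intro linv_decay admD(1)[OF g] admD(2)[OF g])
  moreover have "linv (g n) b powr (-1/8) + n/16 \<le> tau g n (linv (g n) b) powr (-1/8)"
    using g Suc.prems by (intro Suc.IH linv_pos linv_le_one admD(1)[OF g]) auto
  ultimately show ?case by (simp add: add_divide_distrib)
qed auto

text \<open>With t = \<open>tau g n 1\<close>, sqrt t is the power -4 of t^(-1/8) \<ge> 1 + n/16.
  The square root is the quantity needed, because the bound 5 M / sqrt x integrates to 10 M sqrt
  t.\<close>

lemma sqrt_tau: assumes g: "adm g" shows "sqrt (tau g n 1) \<le> (16 / (16 + real n)) ^ 4"
proof -
  define t where "t = tau g n 1"
  have t: "0 < t" "t \<le> 1" using tau_range[OF g, of 1 n] by (auto simp: t_def)
  have le: "(16 + real n) / 16 \<le> t powr (-1/8)"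
    using tau_decay[OF g, of 1 n] by (simp add: t_def add_divide_distrib)
  have "sqrt t = (t powr (-1/8)) powr (-4)"
    using t by (simp add: powr_powr powr_half_sqrt)
  also have "\<dots> \<le> ((16 + real n) / 16) powr (-4)"
    using le by (intro powr_mono2') auto
  also have "\<dots> = (16 / (16 + real n)) ^ 4"
    by (simp add: powr_minus power_divide)
  finally show ?thesis by (simp add: t_def)
qed

lemma decr_fn_integral_head:
  assumes f: "decr_fn M f" and t: "0 < t" "t \<le> 1"
  shows "(\<integral>x. indicator {0<..t} x * f x \<partial>mu) \<le> 10 * M * sqrt t"
proof -
  have M: "0 \<le> M" by (rule decr_fn_M_nonneg[OF f])
  have hi: "((\<lambda>x. x powr (-1/2)) has_integral (t powr (1/2) / (1/2))) {0..t}"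
    using has_integral_powr_from_0[of "-1/2" t] t by simp
  have i: "integrable mu (\<lambda>x. indicator {0<..t} x * f x)"
    using f by (intro indicator_integrable_mu decr_fn_integrable) auto
  have "ennreal (\<integral>x. indicator {0<..t} x * f x \<partial>mu) = (\<integral>\<^sup>+x. ennreal (indicator {0<..t} x * f x) \<partial>mu)"
    using i by (intro nn_integral_eq_integral[symmetric] AE_mu mult_nonneg_nonneg decr_fn_nonneg[OF f]) auto
  also have "\<dots> \<le> (\<integral>\<^sup>+x. ennreal (5 * M) * ennreal (indicator {0..t} x * x powr (-1/2)) \<partial>mu)"
  proof (rule nn_integral_mono, goal_cases)
    case (1 x)
    then have x: "0 < x" "x \<le> 1" by auto
    show ?case
    proof (cases "x \<le> t")
      case True
      have "f x \<le> 5 * M * x powr (-1/2)"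
      proof -
        have "x powr (-1/2) = inverse (x powr (1/2))" using powr_minus[of x "1/2"] by simp
        also have "\<dots> = inverse (sqrt x)" using x by (subst powr_half_sqrt) auto
        finally have "x powr (-1/2) = inverse (sqrt x)" .
        then show ?thesis using decr_fn_bound[OF f x] by (simp only: divide_inverse)
      qed
      then have "ennreal (f x) \<le> ennreal (5 * M * x powr (-1/2))" by (rule ennreal_leI)
      also have "\<dots> = ennreal (5 * M) * ennreal (x powr (-1/2))"
        using M by (intro ennreal_mult) auto
      finally show ?thesis using True x by (simp add: indicator_def)
    qed (simp add: indicator_def)
  qed
  also have "\<dots> = (\<integral>\<^sup>+x. ennreal (5 * M) * ennreal (indicator {0..t} x * x powr (-1/2)) * indicator {0<..1} x \<partial>lborel)"
    by (rule nn_integral_mu) auto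
  also have "\<dots> \<le> (\<integral>\<^sup>+x. ennreal (5 * M) * ennreal (indicator {0..t} x * x powr (-1/2)) \<partial>lborel)"
    by (rule nn_integral_mono) (auto simp: indicator_def)
  also have "\<dots> = ennreal (5 * M) * ennreal (t powr (1/2) / (1/2))"
    using nn_integral_has_integral_lebesgue[OF _ hi] by (subst nn_integral_cmult) auto
  also have "\<dots> = ennreal (10 * M * sqrt t)"
    using M t by (simp add: ennreal_mult[symmetric] powr_half_sqrt)
  finally show ?thesis using M t by (subst (asm) ennreal_le_iff) auto
qed

text \<open>Mass that has not left through the right branch within n steps started in
  (0,\<open>tau g n 1\<close>], where the class allows little mass. This is the tail that limits
  each coupling round.\<close>

lemma decr_fn_integral_tr_lefts:
  assumes g: "adm g" and f: "decr_fn M f"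
  shows "(\<integral>x. tr_lefts g n f x \<partial>mu) \<le> 10 * M * (16 / (16 + real n)) ^ 4"
proof -
  have "(\<integral>x. tr_lefts g n f x \<partial>mu) = (\<integral>x. indicator {0<..tau g n 1} x * f x \<partial>mu)"
    using integral_tr_lefts[OF g decr_fn_integrable[OF f] decr_fn_nonneg[OF f], where b = 1 and n = n] by (simp add: integral_mu_unit)
  also have "\<dots> \<le> 10 * M * sqrt (tau g n 1)"
    using tau_range[OF g, of 1 n] by (intro decr_fn_integral_head f) auto
  also have "\<dots> \<le> 10 * M * (16 / (16 + real n)) ^ 4"
    using decr_fn_M_nonneg[OF f] sqrt_tau[OF g, of n] by (intro mult_left_mono) auto
  finally show ?thesis .
qed

section \<open>Lower bounds for pushed functions\<close>

lemma tr_lefts_le_tr_ops: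
  assumes g: "adm g" and f: "\<And>x. 0 < x \<Longrightarrow> x \<le> 1 \<Longrightarrow> 0 \<le> f x"
  shows "0 < y \<Longrightarrow> y \<le> 1 \<Longrightarrow> tr_lefts g n f y \<le> tr_ops g n f y"
proof (induction n arbitrary: y)
  case (Suc n)
  have "tr_left (g n) (tr_lefts g n f) y \<le> tr_left (g n) (tr_ops g n f) y"
    using Suc g by (intro tr_left_mono admD(1)[OF g]) auto
  also have "\<dots> \<le> tr_op (g n) (tr_ops g n f) y"
    by (rule tr_left_le_tr_op) (use Suc g f in \<open>auto intro!: tr_ops_nonneg admD\<close>)
  finally show ?case by simp
qed auto

text \<open>The value at y follows a single chain of left preimages, and each of its n weights is at
  least 1/3.\<close>

lemma tr_lefts_ge_tau:
  assumes g: "adm g" and f: "\<And>x. 0 < x \<Longrightarrow> x \<le> 1 \<Longrightarrow> 0 \<le> f x"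
  shows "0 < y \<Longrightarrow> y \<le> 1 \<Longrightarrow> (1/3) ^ n * f (tau g n y) \<le> tr_lefts g n f y"
proof (induction n arbitrary: y)
  case (Suc n)
  have gy: "0 < linv (g n) y" "linv (g n) y \<le> 1" using Suc.prems g by (auto simp: linv_pos linv_le_one admD)
  have w: "1/3 \<le> lweight (g n) y" using Suc.prems g admD(2)[OF g, of n] by (intro lweight_ge admD) auto
  have "0 \<le> f (tau g n (linv (g n) y))" using tau_range[OF g gy] f by auto
  then have "1/3 * ((1/3) ^ n * f (tau g n (linv (g n) y))) \<le> lweight (g n) y * tr_lefts g n f (linv (g n) y)"
    using w Suc.IH[OF gy] by (intro mult_mono) auto
  then show ?case by (simp add: tr_left_def)
qed auto

text \<open>After 32 left steps sqrt t, with t = \<open>tau g 32 1\<close>, is at most (16/48)^4 =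
  1/81 \<le> 1/20. By the bound 10 M sqrt t at most half of a unit mass lies below t, so a density
  has f t \<ge> 1/2, and bringing this value to the point 1 costs a factor 3^32.\<close>

definition dens_low :: real where "dens_low = (1/3) ^ 32 / 2"

lemma dens_low_pos: "0 < dens_low" and dens_low_le: "dens_low \<le> 1/2"
  by (auto simp: dens_low_def power_le_one)

lemma decr_fn_tr_ops_ge_last:
  assumes "adm g" "decr_fn M f" "0 < y" "y \<le> 1" shows "tr_ops g n f 1 \<le> tr_ops g n f y"
  using decr_fn_antimono[OF decr_fn_tr_ops[OF assms(1,2), of n] assms(3,4)] by simp

lemma tr_ops_ge_dens_low_32:
  assumes g: "adm g" and f: "decr_fn 1 f" "integral\<^sup>L mu f = 1" and y: "0 < y" "y \<le> 1"
  shows "dens_low \<le> tr_ops g 32 f y"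
proof -
  define t where "t = tau g 32 1"
  have t: "0 < t" "t \<le> 1" using tau_range[OF g, of 1] by (auto simp: t_def)
  have "sqrt t \<le> (16 / (16 + 32)) ^ 4" using sqrt_tau[OF g, of 32] by (simp add: t_def)
  then have st: "sqrt t \<le> 1/20" by (simp add: power_divide)
  have i: "integrable mu (\<lambda>x. indicator A x * f x)" if "A \<in> sets borel" for A
    using f(1) that by (intro indicator_integrable_mu decr_fn_integrable) auto
  have "1 = (\<integral>x. indicator {0<..t} x * f x + indicator {t<..1} x * f x \<partial>mu)"
  proof -
    have "integral\<^sup>L mu f = (\<integral>x. indicator {0<..t} x * f x + indicator {t<..1} x * f x \<partial>mu)"
      by (rule Bochner_Integration.integral_cong) (auto simp: indicator_def)
    then show ?thesis by (simp only: f(2))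
  qed
  also have "\<dots> = (\<integral>x. indicator {0<..t} x * f x \<partial>mu) + (\<integral>x. indicator {t<..1} x * f x \<partial>mu)"
    by (intro Bochner_Integration.integral_add i) auto
  also have "(\<integral>x. indicator {0<..t} x * f x \<partial>mu) \<le> 1/2"
    using decr_fn_integral_head[OF f(1) t] st by simp
  also have "(\<integral>x. indicator {t<..1} x * f x \<partial>mu) \<le> (\<integral>x. indicator {t<..1} x * f t \<partial>mu)"
    using t by (intro integral_mono i indicator_integrable_mu) (auto simp: indicator_def intro!: decr_fn_antimono[OF f(1)])
  also have "\<dots> \<le> 1 * f t"
    using t decr_fn_nonneg[OF f(1) t] by (subst integral_indicator_mu) (auto intro!: mult_left_le_one_le)
  finally have ft: "1/2 \<le> f t" by simp
  have "dens_low \<le> (1/3) ^ 32 * f t" using ft mult_left_mono[of "1/2" "f t" "(1/3)^32"] by (simp add: dens_low_def)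
  also have "\<dots> \<le> tr_lefts g 32 f 1" unfolding t_def by (rule tr_lefts_ge_tau[OF g decr_fn_nonneg[OF f(1)]]) auto
  also have "\<dots> \<le> tr_ops g 32 f 1" by (rule tr_lefts_le_tr_ops[OF g decr_fn_nonneg[OF f(1)]]) auto
  also have "\<dots> \<le> tr_ops g 32 f y" by (rule decr_fn_tr_ops_ge_last[OF g f(1) y])
  finally show ?thesis .
qed

text \<open>Only the last 32 steps matter; the steps before them produce another density of the
  class.\<close>

lemma tr_ops_ge_dens_low:
  assumes g: "adm g" and f: "decr_fn 1 f" "integral\<^sup>L mu f = 1" and y: "0 < y" "y \<le> 1" and n: "32 \<le> n"
  shows "dens_low \<le> tr_ops g n f y"
proof -
  have "tr_ops g n f = tr_ops (\<lambda>i. g (i + (n - 32))) 32 (tr_ops g (n - 32) f)"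
    using tr_ops_shift[of g "n - 32" 32 f] n by simp
  moreover have "integral\<^sup>L mu (tr_ops g (n - 32) f) = 1"
    using f by (simp add: integral_tr_ops[OF g decr_fn_integrable[OF f(1)]])
  ultimately show ?thesis
    using tr_ops_ge_dens_low_32[OF adm_shift[OF g] decr_fn_tr_ops[OF g f(1)] _ y] by simp
qed

lemma tr_ops_one_ge:
  assumes g: "adm g" and y: "0 < y" "y \<le> 1"
  shows "dens_low \<le> tr_ops g n (\<lambda>_. 1) y"
proof (cases "32 \<le> n")
  case True
  then show ?thesis using decr_fn_one mu.prob_space by (intro tr_ops_ge_dens_low g y) auto
next
  case False
  then have "dens_low \<le> (1/3) ^ n"
    using power_decreasing[of n 32 "1/3::real"] zero_le_power[of "1/3::real" n] unfolding dens_low_def by linarith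
  also have "\<dots> \<le> tr_lefts g n (\<lambda>_. 1) 1" using tr_lefts_ge_tau[OF g, of "\<lambda>_. 1" 1 n] by simp
  also have "\<dots> \<le> tr_ops g n (\<lambda>_. 1) 1" by (rule tr_lefts_le_tr_ops[OF g]) auto
  also have "\<dots> \<le> tr_ops g n (\<lambda>_. 1) y" by (rule decr_fn_tr_ops_ge_last[OF g decr_fn_one y])
  finally show ?thesis .
qed

text \<open>Split by the time j of the first passage through the right branch. Until then the
  function is \<open>tr_lefts g j f\<close>, which is decreasing, so its image under the right
  branch is at least half its value at 1. From then on this constant evolves as a multiple of a
  pushed uniform density and keeps at least the fraction \<open>dens_low\<close>.\<close>

lemma tr_ops_ge_sum:
  assumes g: "adm g" and f: "integrable mu f" "\<And>x. 0 < x \<Longrightarrow> x \<le> 1 \<Longrightarrow> 0 \<le> f x"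
    "\<And>x y. 0 < x \<Longrightarrow> x \<le> y \<Longrightarrow> y \<le> 1 \<Longrightarrow> f y \<le> f x" and y: "0 < y" "y \<le> 1"
  shows "dens_low / 2 * (\<Sum>j<n. tr_lefts g j f 1) \<le> tr_ops g n f y"
  using g f
proof (induction n arbitrary: g f)
  case 0
  then show ?case using y by simp
next
  case (Suc n)
  define g' where "g' = (\<lambda>i. g (Suc i))"
  have g': "adm g'" using adm_shift[OF Suc.prems(1), of 1] by (simp add: g'_def)
  note g0 = admD(1)[OF Suc.prems(1), of 0]
  have "dens_low / 2 * (\<Sum>j<n. tr_lefts g' j (tr_left (g 0) f) 1) \<le> tr_ops g' n (tr_left (g 0) f) y"
    by (rule Suc.IH[OF g' integrable_tr_left[OF g0 Suc.prems(2,3)] tr_left_nonneg[OF g0 Suc.prems(3)] tr_left_antimono[OF g0 Suc.prems(3,4)]])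
  moreover have "f 1 / 2 * dens_low \<le> tr_ops g' n (\<lambda>y. f ((1 + y) / 2) / 2) y"
  proof -
    have "f 1 / 2 * dens_low \<le> f 1 / 2 * tr_ops g' n (\<lambda>_. 1) y"
      using Suc.prems(3)[of 1] by (intro mult_left_mono tr_ops_one_ge g' y) auto
    also have "\<dots> = tr_ops g' n (\<lambda>_. f 1 / 2 * 1) y" by (subst tr_ops_cmult) simp
    also have "\<dots> \<le> tr_ops g' n (\<lambda>y. f ((1 + y) / 2) / 2) y"
      by (rule tr_ops_mono) (use y g' in \<open>auto intro!: Suc.prems(4)\<close>)
    finally show ?thesis .
  qed
  moreover have "tr_ops g (Suc n) f y = tr_ops g' n (tr_left (g 0) f) y + tr_ops g' n (\<lambda>y. f ((1 + y) / 2) / 2) y"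
    using tr_ops_shift[of g 1 n f] by (simp add: g'_def tr_op_def[abs_def] tr_ops_add)
  moreover have "(\<Sum>j<Suc n. tr_lefts g j f 1) = f 1 + (\<Sum>j<n. tr_lefts g' j (tr_left (g 0) f) 1)"
    by (subst sum.lessThan_Suc_shift) (simp add: tr_lefts_shift g'_def del: tr_lefts.simps(2))
  ultimately show ?case by (simp add: algebra_simps)
qed

text \<open>No distortion estimate is needed: the left branch moves the value at 1/2 to the value at 1, losing a factor of at most 3, and for a decreasing function the value at 1/2 bounds the mass on (1/2,1].\<close>
lemma tr_ops_ge_mass:
  assumes g: "adm g" and f: "integrable mu f" "\<And>x. 0 < x \<Longrightarrow> x \<le> 1 \<Longrightarrow> 0 \<le> f x"
    "\<And>x y. 0 < x \<Longrightarrow> x \<le> y \<Longrightarrow> y \<le> 1 \<Longrightarrow> f y \<le> f x" and y: "0 < y" "y \<le> 1"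
  shows "dens_low / 3 * ((\<integral>x. f x \<partial>mu) - (\<integral>x. tr_lefts g n f x \<partial>mu)) \<le> tr_ops g (Suc n) f y"
proof -
  \<comment> \<open>The mass leaving at time j is the mass of \<open>?h\<close> on (1/2,1], at most
    \<open>?h (1/2)\<close> / 2, while the next left step has value at least \<open>?h (1/2)\<close>
    / 3 at the point 1; hence the ratio 2/3.\<close>
  have step: "2/3 * ((\<integral>x. tr_lefts g j f x \<partial>mu) - (\<integral>x. tr_lefts g (Suc j) f x \<partial>mu)) \<le> tr_lefts g (Suc j) f 1" for j
  proof -
    let ?h = "tr_lefts g j f"
    have h: "integrable mu ?h" "\<And>x. 0 < x \<Longrightarrow> x \<le> 1 \<Longrightarrow> 0 \<le> ?h x"
      "\<And>x y. 0 < x \<Longrightarrow> x \<le> y \<Longrightarrow> y \<le> 1 \<Longrightarrow> ?h y \<le> ?h x"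
      by (rule tr_lefts_props[OF g f(1,2)] tr_lefts_antimono[OF g f]; assumption)+
    have i: "integrable mu (\<lambda>x. indicator A x * ?h x)" if "A \<in> sets borel" for A
      using h that by (intro indicator_integrable_mu) auto
    have "(\<integral>x. ?h x \<partial>mu) = (\<integral>x. indicator {0<..1/2} x * ?h x + indicator {1/2<..1} x * ?h x \<partial>mu)"
      by (rule Bochner_Integration.integral_cong) (auto simp: indicator_def)
    also have "\<dots> = (\<integral>x. indicator {0<..1/2} x * ?h x \<partial>mu) + (\<integral>x. indicator {1/2<..1} x * ?h x \<partial>mu)"
      by (intro Bochner_Integration.integral_add i) auto
    also have "(\<integral>x. indicator {0<..1/2} x * ?h x \<partial>mu) = (\<integral>x. tr_lefts g (Suc j) f x \<partial>mu)"
      using integral_tr_left[OF admD(1)[OF g, of j] h(1) h(2), of 1] admD(1)[OF g] by (simp add: linv_one integral_mu_unit)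
    finally have "(\<integral>x. ?h x \<partial>mu) - (\<integral>x. tr_lefts g (Suc j) f x \<partial>mu) = (\<integral>x. indicator {1/2<..1} x * ?h x \<partial>mu)" by simp
    also have "\<dots> \<le> (\<integral>x. indicator {1/2<..1} x * ?h (1/2) \<partial>mu)"
      by (intro integral_mono i indicator_integrable_mu) (auto simp: indicator_def intro!: h(3))
    also have "\<dots> = 1/2 * ?h (1/2)" by (subst integral_indicator_mu) auto
    finally have *: "2/3 * ((\<integral>x. ?h x \<partial>mu) - (\<integral>x. tr_lefts g (Suc j) f x \<partial>mu)) \<le> 1/3 * ?h (1/2)" by simp
    have "1/3 * ?h (1/2) \<le> lweight (g j) 1 * ?h (1/2)"
      using h(2)[of "1/2"] admD(2)[OF g, of j] by (intro mult_right_mono lweight_ge admD g) auto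
    also have "\<dots> = tr_lefts g (Suc j) f 1" using g by (simp add: tr_left_def linv_one admD)
    finally show ?thesis using * by linarith
  qed
  \<comment> \<open>Telescoping over j collects all mass that has left; 2/3 and
    \<open>dens_low\<close> / 2 combine to \<open>dens_low\<close> / 3.\<close>
  have "2/3 * ((\<integral>x. f x \<partial>mu) - (\<integral>x. tr_lefts g n f x \<partial>mu))
      = (\<Sum>j<n. 2/3 * ((\<integral>x. tr_lefts g j f x \<partial>mu) - (\<integral>x. tr_lefts g (Suc j) f x \<partial>mu)))"
    unfolding sum_distrib_left[symmetric] by (subst sum_lessThan_telescope') simp
  also have "\<dots> \<le> (\<Sum>j<n. tr_lefts g (Suc j) f 1)" by (intro sum_mono step)
  also have "\<dots> \<le> (\<Sum>j<Suc n. tr_lefts g j f 1)"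
    using f(2)[of 1] by (simp only: sum.lessThan_Suc_shift) simp
  finally have "dens_low / 2 * (2/3 * ((\<integral>x. f x \<partial>mu) - (\<integral>x. tr_lefts g n f x \<partial>mu))) \<le> dens_low / 2 * (\<Sum>j<Suc n. tr_lefts g j f 1)"
    using dens_low_pos by (intro mult_left_mono) auto
  also have "\<dots> \<le> tr_ops g (Suc n) f y" by (rule tr_ops_ge_sum[OF g f y])
  finally show ?thesis by (simp add: algebra_simps)
qed

text \<open>Both pushed functions lie above the same constant k, since the lower bound depends only
  on the common mass and on M. Subtracting k leaves their difference unchanged, lowers the mass and
  stays in the class with the same M, so rounds can be repeated without growth of constants.\<close>

lemma coupling_step:
  assumes g: "adm g" and F: "decr_fn M F" and G: "decr_fn M G" and eq: "integral\<^sup>L mu F = integral\<^sup>L mu G"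
  shows "\<exists>F' G'. decr_fn M F' \<and> decr_fn M G' \<and> integral\<^sup>L mu F' = integral\<^sup>L mu G'
    \<and> integral\<^sup>L mu F' \<le> (1 - dens_low/3) * integral\<^sup>L mu F + dens_low/3 * (10 * M * (16 / (16 + real n)) ^ 4)
    \<and> (\<forall>y. tr_ops g (Suc n) F y - tr_ops g (Suc n) G y = F' y - G' y)"
proof -
  define e where "e = 10 * M * (16 / (16 + real n)) ^ 4"
  \<comment> \<open>The maximum covers the case where the remaining mass is already below the tail
    e; then nothing is subtracted.\<close>
  define k where "k = max 0 (dens_low/3 * (integral\<^sup>L mu F - e))"
  have k: "decr_fn M (\<lambda>y. tr_ops g (Suc n) H y - k) \<and> integral\<^sup>L mu (\<lambda>y. tr_ops g (Suc n) H y - k) = integral\<^sup>L mu F - k"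
    if H: "decr_fn M H" "integral\<^sup>L mu H = integral\<^sup>L mu F" for H
  proof -
    note H' = decr_fn_tr_ops[OF g H(1), of "Suc n"]
    have ge: "k \<le> tr_ops g (Suc n) H y" if y: "0 < y" "y \<le> 1" for y
    proof -
      have "dens_low/3 * (integral\<^sup>L mu F - e) \<le> dens_low / 3 * ((\<integral>x. H x \<partial>mu) - (\<integral>x. tr_lefts g n H x \<partial>mu))"
        using dens_low_pos decr_fn_integral_tr_lefts[OF g H(1), of n] H(2) by (intro mult_left_mono) (auto simp: e_def)
      also have "\<dots> \<le> tr_ops g (Suc n) H y"
        by (rule tr_ops_ge_mass[OF g decr_fn_integrable[OF H(1)] decr_fn_nonneg[OF H(1)] decr_fn_antimono[OF H(1)] y])
      finally show ?thesis using decr_fn_nonneg[OF H' y] by (simp add: k_def)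
    qed
    have I: "integral\<^sup>L mu (\<lambda>y. tr_ops g (Suc n) H y - k) = integral\<^sup>L mu F - k"
      using decr_fn_integrable[OF H'] integral_tr_ops[OF g decr_fn_integrable[OF H(1)], of "Suc n"] H(2) mu.prob_space
      by (subst Bochner_Integration.integral_diff) auto
    have k0: "0 \<le> k" by (simp add: k_def)
    have "decr_fn M (\<lambda>y. tr_ops g (Suc n) H y - k)"
      unfolding decr_fn_def I
      using decr_fn_integrable[OF H'] ge decr_fn_bound[OF H'] decr_fn_antimono[OF H'] k0 decr_fn_integral[OF F]
      by (auto simp: algebra_simps simp del: tr_ops.simps intro: order_trans[OF decr_fn_bound[OF H']])
    then show ?thesis using I by blast
  qed
  have "integral\<^sup>L mu F - k \<le> (1 - dens_low/3) * integral\<^sup>L mu F + dens_low/3 * e"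
  proof -
    have "dens_low/3 * (integral\<^sup>L mu F - e) \<le> k" by (simp only: k_def max.cobounded2)
    then show ?thesis by (simp add: algebra_simps)
  qed
  then show ?thesis
    using k[OF F refl] k[OF G eq[symmetric]] unfolding e_def
    by (intro exI[of _ "\<lambda>y. tr_ops g (Suc n) F y - k"] exI[of _ "\<lambda>y. tr_ops g (Suc n) G y - k"]) auto
qed

text \<open>The masses obey a' \<le> (1 - d) a + d e with d = \<open>dens_low / 3\<close>. As M
  never changes, neither does e, and the recursion solves to (1 - d)^j a + (1 - (1 - d)^j) e. The
  factor 2 bounds the L1 distance by the sum of two equal masses.\<close>

lemma coupling:
  assumes g: "adm g" and F: "decr_fn M F" and G: "decr_fn M G" and eq: "integral\<^sup>L mu F = integral\<^sup>L mu G"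
  shows "(\<integral>x. \<bar>tr_ops g (j * Suc n) (\<lambda>x. F x - G x) x\<bar> \<partial>mu)
    \<le> 2 * ((1 - dens_low/3) ^ j * integral\<^sup>L mu F + (1 - (1 - dens_low/3) ^ j) * (10 * M * (16 / (16 + real n)) ^ 4))"
  using g F G eq
proof (induction j arbitrary: g F G)
  case 0
  have "(\<integral>x. \<bar>F x - G x\<bar> \<partial>mu) \<le> (\<integral>x. F x + G x \<partial>mu)"
    using decr_fn_integrable[OF 0(2)] decr_fn_integrable[OF 0(3)] decr_fn_nonneg[OF 0(2)] decr_fn_nonneg[OF 0(3)]
    by (intro integral_mono) (auto simp: abs_le_iff)
  also have "\<dots> = 2 * integral\<^sup>L mu F"
    using decr_fn_integrable[OF 0(2)] decr_fn_integrable[OF 0(3)] 0(4) by simp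
  finally show ?case using decr_fn_M_nonneg[OF 0(2)] by (auto intro: order_trans)
next
  case (Suc j)
  define e where "e = 10 * M * (16 / (16 + real n)) ^ 4"
  define g' where "g' = (\<lambda>i. g (i + Suc n))"
  have g': "adm g'" using adm_shift[OF Suc.prems(1), of "Suc n"] by (simp add: g'_def)
  obtain F' G' where F': "decr_fn M F'" "decr_fn M G'" "integral\<^sup>L mu F' = integral\<^sup>L mu G'"
    "integral\<^sup>L mu F' \<le> (1 - dens_low/3) * integral\<^sup>L mu F + dens_low/3 * e"
    "\<And>y. tr_ops g (Suc n) F y - tr_ops g (Suc n) G y = F' y - G' y"
    using coupling_step[OF Suc.prems, of n] unfolding e_def by blast
  have "tr_ops g (Suc j * Suc n) (\<lambda>x. F x - G x) = tr_ops g' (j * Suc n) (tr_ops g (Suc n) (\<lambda>x. F x - G x))"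
    using tr_ops_shift[of g "Suc n" "j * Suc n"] by (simp only: g'_def mult_Suc)
  also have "tr_ops g (Suc n) (\<lambda>x. F x - G x) = (\<lambda>x. F' x - G' x)"
    using F'(5) by (auto simp: fun_eq_iff tr_ops_diff simp del: tr_ops.simps)
  finally have "(\<integral>x. \<bar>tr_ops g (Suc j * Suc n) (\<lambda>x. F x - G x) x\<bar> \<partial>mu) \<le> 2 * ((1 - dens_low/3) ^ j * integral\<^sup>L mu F' + (1 - (1 - dens_low/3) ^ j) * e)"
    using Suc.IH[OF g' F'(1-3)] by (simp add: e_def)
  also have "\<dots> \<le> 2 * ((1 - dens_low/3) ^ j * ((1 - dens_low/3) * integral\<^sup>L mu F + dens_low/3 * e) + (1 - (1 - dens_low/3) ^ j) * e)"
    using F'(4) dens_low_le by (intro mult_left_mono add_right_mono) auto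
  also have "\<dots> = 2 * ((1 - dens_low/3) ^ Suc j * integral\<^sup>L mu F + (1 - (1 - dens_low/3) ^ Suc j) * e)"
    by (simp add: algebra_simps)
  finally show ?case unfolding e_def .
qed

text \<open>The geometric term is absorbed by the polynomial one. The 15 + n is 16 + m for rounds of
  length n = m + 1.\<close>

lemma ex_decay_const:
  "\<exists>C>0. \<forall>n::nat. 2 * ((1 - dens_low/3) ^ n + 10 * (16 / (15 + real n)) ^ 4) \<le> C / (real n + 1) ^ 4"
proof -
  define q where "q = 1 - dens_low/3"
  have q: "0 < q" "q < 1" using dens_low_pos dens_low_le by (auto simp: q_def)
  \<comment> \<open>A quarter of \<open>dens_low / 3\<close>: then q \<le> exp(-4 a), and the fourth
    power beats (n + 1)^4 through a (n + 1) \<le> 1 + a n \<le> exp(a n).\<close>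
  define a where "a = dens_low/12"
  have a: "0 < a" "a \<le> 1" using dens_low_pos dens_low_le by (auto simp: a_def)
  have K: "q ^ n * (real n + 1) ^ 4 \<le> 1 / a ^ 4" for n :: nat
  proof -
    have "q \<le> exp (- (4 * a))" using exp_ge_add_one_self[of "- (4 * a)"] by (simp add: q_def a_def)
    then have "q ^ n \<le> exp (- (4 * a)) ^ n" using q by (intro power_mono) auto
    also have "\<dots> = exp (- (a * n)) ^ 4" by (simp add: exp_of_nat_mult[symmetric] mult_ac)
    finally have 1: "q ^ n \<le> exp (- (a * n)) ^ 4" .
    have "a * (real n + 1) \<le> 1 + a * n" using a by (simp add: algebra_simps)
    also have "\<dots> \<le> exp (a * n)" by (rule exp_ge_add_one_self)
    finally have "(a * (real n + 1)) ^ 4 \<le> exp (a * n) ^ 4" using a by (intro power_mono) auto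
    then have "q ^ n * (a * (real n + 1)) ^ 4 \<le> exp (- (a * n)) ^ 4 * exp (a * n) ^ 4"
      using 1 q a by (intro mult_mono) auto
    also have "\<dots> = 1" by (simp add: power_mult_distrib[symmetric] exp_add[symmetric])
    finally have "q ^ n * (real n + 1) ^ 4 * a ^ 4 \<le> 1" by (simp only: power_mult_distrib mult_ac)
    then show ?thesis using a by (simp only: pos_le_divide_eq zero_less_power)
  qed
  define K where "K = 1 / a ^ 4"
  have K0: "0 < K" using a by (simp add: K_def)
  have "2 * (q ^ n + 10 * (16 / (15 + real n)) ^ 4) \<le> (2 * (K + 10 * 16 ^ 4)) / (real n + 1) ^ 4" for n :: nat
  proof -
    have "q ^ n \<le> K / (real n + 1) ^ 4" using K[of n] unfolding K_def[symmetric] by (subst pos_le_divide_eq) auto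
    moreover have "(16 / (15 + real n)) ^ 4 \<le> (16 / (real n + 1)) ^ 4"
      by (intro power_mono divide_left_mono) auto
    ultimately show ?thesis by (simp add: power_divide add_divide_distrib)
  qed
  then show ?thesis using K0 unfolding q_def by (intro exI[of _ "2 * (K + 10 * 16 ^ 4)"]) auto
qed

definition decay_const :: real where
  "decay_const = (SOME C. C > 0 \<and> (\<forall>n::nat. 2 * ((1 - dens_low/3) ^ n + 10 * (16 / (15 + real n)) ^ 4) \<le> C / (real n + 1) ^ 4))"

lemma decay_const_pos: "0 < decay_const"
  and decay_const: "2 * ((1 - dens_low/3) ^ n + 10 * (16 / (15 + real n)) ^ 4) \<le> decay_const / (real n + 1) ^ 4"
  using someI_ex[OF ex_decay_const] unfolding decay_const_def[symmetric] by blast+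

definition decay :: "nat \<Rightarrow> real" where
  "decay n = decay_const / (real n + 1) ^ 2"

lemma decay_pos: "0 < decay n" using decay_const_pos by (simp add: decay_def)

lemma decay_antimono: "m \<le> n \<Longrightarrow> decay n \<le> decay m"
  unfolding decay_def using decay_const_pos by (intro divide_left_mono power_mono) auto

text \<open>With s the integer part of sqrt n, s rounds of s steps fit into n steps, and the
  remaining steps only contract L1. A bound of order (s + 1)^(-4) becomes (n + 1)^(-2) because n + 1
  \<le> (s + 1)^2.\<close>

lemma loss_of_memory_decr_fn:
  assumes g: "adm g" and F: "decr_fn M F" and G: "decr_fn M G" and eq: "integral\<^sup>L mu F = integral\<^sup>L mu G"
  shows "(\<integral>x. \<bar>tr_ops g n (\<lambda>x. F x - G x) x\<bar> \<partial>mu) \<le> M * decay n"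
proof -
  define s where "s = nat \<lfloor>sqrt n\<rfloor>"
  have s1: "real s \<le> sqrt n" "sqrt n < real s + 1" by (auto simp: s_def) 
  have "real (s * s) \<le> sqrt n * sqrt n" unfolding of_nat_mult using s1 by (intro mult_mono) auto
  then have "real (s * s) \<le> real n" by simp
  then have sn: "s * s \<le> n" unfolding of_nat_le_iff .
  have ns: "real n + 1 \<le> (real s + 1) ^ 2"
  proof -
    have "sqrt n ^ 2 < (real s + 1) ^ 2" using s1 by (intro power_strict_mono) auto
    then have "real n < real ((s + 1) ^ 2)" by (simp add: add.commute)
    then have "n + 1 \<le> (s + 1) ^ 2" unfolding of_nat_less_iff by simp
    then have "real (n + 1) \<le> real ((s + 1) ^ 2)" unfolding of_nat_le_iff .
    then show ?thesis by (simp add: add.commute)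
  qed
  have M: "0 \<le> M" by (rule decr_fn_M_nonneg[OF F])
  have i: "integrable mu (\<lambda>x. F x - G x)" using F G decr_fn_integrable by auto
  have "(\<integral>x. \<bar>tr_ops g n (\<lambda>x. F x - G x) x\<bar> \<partial>mu) \<le> (\<integral>x. \<bar>tr_ops g (s * s) (\<lambda>x. F x - G x) x\<bar> \<partial>mu)"
    using tr_ops_shift[of g "s * s" "n - s * s"] sn tr_ops_L1[OF adm_shift[OF g] integrable_tr_ops[OF g i]] by simp
  also have "\<dots> \<le> M * (2 * ((1 - dens_low/3) ^ s + 10 * (16 / (15 + real s)) ^ 4))"
  \<comment> \<open>Round lengths in \<open>coupling\<close> are successors, so s = 0 is settled by
    the bound without rounds.\<close>
  proof (cases s)
    case 0
    have "(\<integral>x. \<bar>F x - G x\<bar> \<partial>mu) \<le> 2 * integral\<^sup>L mu F"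
      using coupling[OF assms, of 0 0] by simp
    also have "\<dots> \<le> M * 2" using decr_fn_integral[OF F] by simp
    also have "\<dots> \<le> M * (2 * ((1 - dens_low/3) ^ s + 10 * (16 / (15 + real s)) ^ 4))"
      using M 0 by (intro mult_left_mono) auto
    finally show ?thesis using 0 by simp
  next
    case (Suc m)
    have q: "0 \<le> (1 - dens_low/3)" "(1 - dens_low/3) ^ s \<le> 1" using dens_low_le dens_low_pos by (auto intro!: power_le_one)
    have "(\<integral>x. \<bar>tr_ops g (s * s) (\<lambda>x. F x - G x) x\<bar> \<partial>mu)
       \<le> 2 * ((1 - dens_low/3) ^ s * integral\<^sup>L mu F + (1 - (1 - dens_low/3) ^ s) * (10 * M * (16 / (16 + m)) ^ 4))"
      using coupling[OF assms, of s m] Suc by simp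
    also have "\<dots> \<le> 2 * ((1 - dens_low/3) ^ s * M + 1 * (10 * M * (16 / (16 + m)) ^ 4))"
      using q M decr_fn_integral[OF F] by (intro mult_left_mono add_mono mult_right_mono) auto
    also have "\<dots> = M * (2 * ((1 - dens_low/3) ^ s + 10 * (16 / (15 + real s)) ^ 4))"
      using Suc by (simp add: algebra_simps)
    finally show ?thesis .
  qed
  also have "\<dots> \<le> M * (decay_const / (real s + 1) ^ 4)" by (intro mult_left_mono decay_const M)
  also have "\<dots> \<le> M * (decay_const / (real n + 1) ^ 2)"
  proof -
    have "(real n + 1) ^ 2 \<le> ((real s + 1) ^ 2) ^ 2" using ns by (intro power_mono) auto
    then show ?thesis using M decay_const_pos by (intro mult_left_mono divide_left_mono) auto
  qed
  finally show ?thesis by (simp add: decay_def)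
qed

lemma loss_of_memory:
  assumes g: "adm g" and H: "decr_diff M H" and z: "integral\<^sup>L mu H = 0"
  shows "(\<integral>x. \<bar>tr_ops g n H x\<bar> \<partial>mu) \<le> M * decay n"
proof -
  obtain F G where f: "decr_fn M F" "decr_fn M G" "\<And>x. 0 < x \<Longrightarrow> x \<le> 1 \<Longrightarrow> H x = F x - G x"
    using H by (auto simp: decr_diff_def)
  have "integral\<^sup>L mu H = integral\<^sup>L mu (\<lambda>x. F x - G x)"
    by (rule Bochner_Integration.integral_cong) (use f(3) in auto)
  then have "integral\<^sup>L mu F = integral\<^sup>L mu G" using z decr_fn_integrable[OF f(1)] decr_fn_integrable[OF f(2)] by simp
  then have "(\<integral>x. \<bar>tr_ops g n (\<lambda>x. F x - G x) x\<bar> \<partial>mu) \<le> M * decay n" by (rule loss_of_memory_decr_fn[OF g f(1,2)])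
  also have "(\<integral>x. \<bar>tr_ops g n (\<lambda>x. F x - G x) x\<bar> \<partial>mu) = (\<integral>x. \<bar>tr_ops g n H x\<bar> \<partial>mu)"
    by (rule Bochner_Integration.integral_cong) (use tr_ops_cong[OF g f(3)] in auto)
  finally show ?thesis .
qed

lemma decay_summable: "summable decay"
proof -
  have "summable (\<lambda>n. decay_const * (1 / (of_nat (Suc n)) ^ 2 :: real))"
    using inverse_power_summable[of 2, where 'a=real] summable_Suc_iff[of "\<lambda>n. inverse ((of_nat n)^2) :: real"]
    by (intro summable_mult) (simp add: field_simps)
  then show ?thesis by (simp add: decay_def[abs_def] add.commute)
qed

section \<open>Decay of correlations\<close>

lemma abs_integral_mult_le:
  assumes "integrable mu f" "h \<in> borel_measurable mu" "\<And>x. 0 < x \<Longrightarrow> x \<le> 1 \<Longrightarrow> \<bar>h x\<bar> \<le> (B::real)"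
  shows "\<bar>\<integral>x. f x * h x \<partial>mu\<bar> \<le> B * (\<integral>x. \<bar>f x\<bar> \<partial>mu)"
proof -
  have i: "integrable mu (\<lambda>x. f x * h x)" by (rule integrable_mult_bounded[OF assms])
  have "\<bar>\<integral>x. f x * h x \<partial>mu\<bar> \<le> (\<integral>x. \<bar>f x * h x\<bar> \<partial>mu)" by (rule integral_abs_bound)
  also have "\<dots> \<le> (\<integral>x. B * \<bar>f x\<bar> \<partial>mu)"
  proof (rule integral_mono)
    fix x assume "x \<in> space mu"
    then show "\<bar>f x * h x\<bar> \<le> B * \<bar>f x\<bar>"
      using mult_right_mono[OF assms(3)[of x], of "\<bar>f x\<bar>"] by (simp add: abs_mult mult.commute)
  qed (use i assms in auto)
  finally show ?thesis by simp
qed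

definition dens :: "(real \<Rightarrow> real) \<Rightarrow> bool" where
  "dens f \<longleftrightarrow> decr_fn 1 f \<and> integral\<^sup>L mu f = 1"

lemma dens_decr_fn: "dens f \<Longrightarrow> decr_fn 1 f" and dens_integral: "dens f \<Longrightarrow> integral\<^sup>L mu f = 1"
  and dens_integrable: "dens f \<Longrightarrow> integrable mu f"
  and dens_nonneg: "dens f \<Longrightarrow> 0 < x \<Longrightarrow> x \<le> 1 \<Longrightarrow> 0 \<le> f x"
  by (auto simp: dens_def decr_fn_integrable decr_fn_nonneg)

lemma dens_tr_ops: "adm g \<Longrightarrow> dens f \<Longrightarrow> dens (tr_ops g n f)"
  by (auto simp: dens_def decr_fn_tr_ops integral_tr_ops decr_fn_integrable)

lemma dens_tr_op: "0 < \<gamma> \<Longrightarrow> \<gamma> \<le> 1/9 \<Longrightarrow> dens f \<Longrightarrow> dens (tr_op \<gamma> f)"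
  by (auto simp: dens_def decr_fn_tr_op integral_tr_op decr_fn_integrable)

lemma dens_one: "dens (\<lambda>_. 1)"
  using decr_fn_one mu.prob_space by (simp add: dens_def)

lemma dens_abs_integral: "dens f \<Longrightarrow> (\<integral>x. \<bar>f x\<bar> \<partial>mu) = 1"
  using Bochner_Integration.integral_cong[of mu mu "\<lambda>x. \<bar>f x\<bar>" f] dens_nonneg[of f] dens_integral[of f] by auto

lemma dens_bound:
  assumes "dens f" "h \<in> borel_measurable mu" "\<And>x. 0 < x \<Longrightarrow> x \<le> 1 \<Longrightarrow> \<bar>h x\<bar> \<le> (B::real)"
  shows "\<bar>\<integral>x. f x * h x \<partial>mu\<bar> \<le> B"
  using abs_integral_mult_le[OF dens_integrable[OF assms(1)] assms(2,3)] dens_abs_integral[OF assms(1)] by simp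

abbreviation shift_seq :: "(nat \<Rightarrow> real) \<Rightarrow> nat \<Rightarrow> nat \<Rightarrow> real" where
  "shift_seq g n \<equiv> (\<lambda>i. g (i + n))"

lemma sum_decay_dist:
  assumes "finite B" shows "(\<Sum>k\<in>B. decay (if k \<le> j then j - k else k - j)) \<le> 2 * suminf decay"
proof -
  have *: "(\<Sum>k\<in>A. decay (u k)) \<le> suminf decay" if "finite A" "inj_on u A" for A and u :: "nat \<Rightarrow> nat"
  proof -
    have "(\<Sum>k\<in>A. decay (u k)) = (\<Sum>k\<in>u ` A. decay k)" using that by (simp add: sum.reindex)
    also have "\<dots> \<le> suminf decay"
      using that decay_pos by (intro sum_le_suminf decay_summable) (auto simp: less_imp_le)
    finally show ?thesis .
  qed
  have "(\<Sum>k\<in>B. decay (if k \<le> j then j - k else k - j)) =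
     (\<Sum>k\<in>B \<inter> {k. k \<le> j}. decay (if k \<le> j then j - k else k - j)) + (\<Sum>k\<in>B \<inter> - {k. k \<le> j}. decay (if k \<le> j then j - k else k - j))"
    using assms by (subst sum.union_disjoint[symmetric]) (auto intro: sum.cong)
  also have "\<dots> = (\<Sum>k\<in>B \<inter> {k. k \<le> j}. decay (j - k)) + (\<Sum>k\<in>B \<inter> - {k. k \<le> j}. decay (k - j))"
    by (intro arg_cong2[where f = "(+)"] sum.cong) auto
  also have "\<dots> \<le> suminf decay + suminf decay"
    using assms by (intro add_mono *) (auto intro!: inj_onI)
  finally show ?thesis by simp
qed

definition decay_tail :: "nat \<Rightarrow> real" where
  "decay_tail n = (\<Sum>i. decay (i + n))"

lemma decay_tail_nonneg: "0 \<le> decay_tail n"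
  unfolding decay_tail_def using decay_summable by (intro suminf_nonneg summable_ignore_initial_segment) (auto simp: less_imp_le decay_pos)

lemma decay_tail_tendsto: "decay_tail \<longlonglongrightarrow> 0"
proof -
  have e: "decay_tail n = suminf decay - (\<Sum>i<n. decay i)" for n
    using suminf_split_initial_segment[OF decay_summable, of n] by (simp add: decay_tail_def)
  have "(\<lambda>n. suminf decay - (\<Sum>i<n. decay i)) \<longlonglongrightarrow> suminf decay - suminf decay"
    by (intro tendsto_intros summable_LIMSEQ decay_summable)
  moreover have "decay_tail = (\<lambda>n. suminf decay - (\<Sum>i<n. decay i))" using e by (rule ext)
  ultimately show ?thesis by simp
qed

lemma sum_decay_tail:
  assumes "finite B" "\<And>k. k \<in> B \<Longrightarrow> j + n \<le> k" shows "(\<Sum>k\<in>B. decay (k - j)) \<le> decay_tail n"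
proof -
  have "(\<Sum>k\<in>B. decay (k - j)) = (\<Sum>i\<in>(\<lambda>k. k - j - n) ` B. decay (i + n))"
  proof (subst sum.reindex)
    show "inj_on (\<lambda>k. k - j - n) B"
    proof (rule inj_onI)
      fix k l assume "k \<in> B" "l \<in> B" "k - j - n = l - j - n"
      then show "k = l" using assms(2)[of k] assms(2)[of l] by linarith
    qed
    show "(\<Sum>k\<in>B. decay (k - j)) = sum ((\<lambda>i. decay (i + n)) \<circ> (\<lambda>k. k - j - n)) B"
    proof (rule sum.cong)
      fix k assume "k \<in> B"
      then have "k - j = k - j - n + n" using assms(2)[of k] by linarith
      then show "decay (k - j) = ((\<lambda>i. decay (i + n)) \<circ> (\<lambda>k. k - j - n)) k" by (simp del: diff_diff_left)
    qed simp
  qed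
  also have "\<dots> \<le> decay_tail n"
    unfolding decay_tail_def using assms decay_summable
    by (intro sum_le_suminf summable_ignore_initial_segment) (auto simp: less_imp_le decay_pos)
  finally show ?thesis .
qed

text \<open>One constant L bounds both the size and the Lipschitz constant; this is all that the C1
  hypothesis contributes.\<close>

locale obs =
  fixes \<phi> :: "real \<Rightarrow> real" and L :: real
  assumes L_pos: "0 < L"
    and phi_bound: "0 < x \<Longrightarrow> x \<le> 1 \<Longrightarrow> \<bar>\<phi> x\<bar> \<le> L"
    and phi_lip: "0 < x \<Longrightarrow> x \<le> y \<Longrightarrow> y \<le> 1 \<Longrightarrow> \<bar>\<phi> x - \<phi> y\<bar> \<le> L * (y - x)"
begin

text \<open>Adding L x turns a Lipschitz function into an increasing one, and monotone functions are
  Borel.\<close>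

lemma phi_measurable [measurable]: "\<phi> \<in> borel_measurable mu"
proof -
  have "(\<lambda>x. \<phi> x + L * x) \<in> borel_measurable mu"
  proof (rule borel_measurable_mu_mono)
    fix x y :: real assume "0 < x" "x \<le> y" "y \<le> 1"
    from phi_lip[OF this] show "\<phi> x + L * x \<le> \<phi> y + L * y" by (simp add: algebra_simps abs_le_iff)
  qed
  then have "(\<lambda>x. (\<phi> x + L * x) - L * x) \<in> borel_measurable mu" by measurable
  then show ?thesis by simp
qed

text \<open>The mean at time j when the start has density f. \<open>cphi\<close> is the centred
  observable at the current point, \<open>cobs\<close> the same as a function of the initial point.
  Shifting time by n replaces f by \<open>tr_ops g n f\<close> and g by its shift.\<close>

definition phi_mean :: "(nat \<Rightarrow> real) \<Rightarrow> (real \<Rightarrow> real) \<Rightarrow> nat \<Rightarrow> real" where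
  "phi_mean g f j = (\<integral>x. tr_ops g j f x * \<phi> x \<partial>mu)"

definition cphi :: "(nat \<Rightarrow> real) \<Rightarrow> (real \<Rightarrow> real) \<Rightarrow> nat \<Rightarrow> real \<Rightarrow> real" where
  "cphi g f j x = \<phi> x - phi_mean g f j"

definition cobs :: "(nat \<Rightarrow> real) \<Rightarrow> (real \<Rightarrow> real) \<Rightarrow> nat \<Rightarrow> real \<Rightarrow> real" where
  "cobs g f j x = cphi g f j (orb g j x)"

lemma phi_mean_shift: "phi_mean g f (n + j) = phi_mean (shift_seq g n) (tr_ops g n f) j"
  by (simp add: phi_mean_def tr_ops_shift)

lemma cphi_shift: "cphi g f (n + j) = cphi (shift_seq g n) (tr_ops g n f) j"
  by (simp add: cphi_def[abs_def] phi_mean_shift)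

lemma cobs_shift: "cobs g f (n + j) x = cobs (shift_seq g n) (tr_ops g n f) j (orb g n x)"
  by (simp add: cobs_def cphi_shift orb_shift)

lemma phi_mean_bound: "adm g \<Longrightarrow> dens f \<Longrightarrow> \<bar>phi_mean g f j\<bar> \<le> L"
  unfolding phi_mean_def by (rule dens_bound[OF dens_tr_ops phi_measurable phi_bound])

lemma cphi_bound: "adm g \<Longrightarrow> dens f \<Longrightarrow> 0 < x \<Longrightarrow> x \<le> 1 \<Longrightarrow> \<bar>cphi g f j x\<bar> \<le> 2 * L"
  unfolding cphi_def using phi_mean_bound[of g f j] phi_bound[of x] by linarith

lemma cphi_lip: "0 < x \<Longrightarrow> x \<le> y \<Longrightarrow> y \<le> 1 \<Longrightarrow> \<bar>cphi g f j x - cphi g f j y\<bar> \<le> L * (y - x)"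
  unfolding cphi_def using phi_lip[of x y] by simp

lemma cphi_measurable [measurable]: "cphi g f j \<in> borel_measurable mu"
  unfolding cphi_def[abs_def] by measurable

lemma cobs_measurable [measurable]: "adm g \<Longrightarrow> cobs g f j \<in> borel_measurable mu"
  unfolding cobs_def[abs_def] by (rule measurable_compose[OF orb_measurable cphi_measurable])

lemma cobs_bound: "adm g \<Longrightarrow> dens f \<Longrightarrow> 0 < x \<Longrightarrow> x \<le> 1 \<Longrightarrow> \<bar>cobs g f j x\<bar> \<le> 2 * L"
  unfolding cobs_def using orb_range[of g x j] by (intro cphi_bound) auto

lemma cphi_mean: "adm g \<Longrightarrow> dens f \<Longrightarrow> (\<integral>x. tr_ops g j f x * cphi g f j x \<partial>mu) = 0"
proof -
  assume *: "adm g" "dens f"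
  note d = dens_tr_ops[OF *, of j]
  have "integrable mu (\<lambda>x. tr_ops g j f x * \<phi> x)"
    by (rule integrable_mult_bounded[OF dens_integrable[OF d] phi_measurable phi_bound])
  then show ?thesis
    using dens_integrable[OF d] dens_integral[OF d] by (simp add: cphi_def right_diff_distrib phi_mean_def)
qed

text \<open>The constant is 3 (2 L) + 2 L from \<open>decr_diff_mult\<close>: the centred observable
  is bounded by 2 L and has Lipschitz constant L, and a density has M = 1.\<close>

lemma cphi_decr_diff: "adm g \<Longrightarrow> dens f \<Longrightarrow> decr_diff (8 * L) (\<lambda>x. tr_ops g j f x * cphi g f j x)"
proof -
  assume *: "adm g" "dens f"
  have "decr_diff ((3 * (2 * L) + 2 * L) * 1) (\<lambda>x. cphi g f j x * tr_ops g j f x)"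
    using * L_pos cphi_bound cphi_lip by (intro decr_diff_mult decr_fn_decr_diff dens_decr_fn dens_tr_ops) auto
  then show ?thesis by (simp add: mult.commute)
qed

text \<open>Pushing f to time j and multiplying by the centred observable gives a function of
  integral zero in the class with constant 8 L. The n further steps make it small in L1 before h is
  tested.\<close>

lemma cobs_decor:
  assumes g: "adm g" and f: "dens f" and h: "h \<in> borel_measurable mu" "\<And>x. 0 < x \<Longrightarrow> x \<le> 1 \<Longrightarrow> \<bar>h x\<bar> \<le> B"
  shows "\<bar>\<integral>x. f x * (cobs g f j x * h (orb g (j + n) x)) \<partial>mu\<bar> \<le> 8 * L * B * decay n"
proof -
  let ?g = "shift_seq g j" and ?u = "\<lambda>x. cphi g f j x * h (orb (shift_seq g j) n x)"
  have g': "adm ?g" by (rule adm_shift[OF g])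
  have hm: "(\<lambda>x. h (orb ?g n x)) \<in> borel_measurable mu"
    by (rule measurable_compose[OF orb_measurable[OF g'] h(1)])
  have hb: "\<bar>h (orb ?g n x)\<bar> \<le> B" if "0 < x" "x \<le> 1" for x using orb_range[OF g' that] h(2) by auto
  have B: "0 \<le> B" using h(2)[of 1] by auto
  have "(\<integral>x. f x * (cobs g f j x * h (orb g (j + n) x)) \<partial>mu) = (\<integral>x. f x * ?u (orb g j x) \<partial>mu)"
    by (simp add: cobs_def orb_shift)
  also have "\<dots> = (\<integral>x. tr_ops g j f x * ?u x \<partial>mu)"
  proof (rule tr_ops_duality[OF g dens_integrable[OF f]])
    show "\<bar>?u x\<bar> \<le> 2 * L * B" if "0 < x" "x \<le> 1" for x
      unfolding abs_mult using cphi_bound[OF g f that] hb[OF that] L_pos by (intro mult_mono) auto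
  qed (use hm in measurable)
  also have "\<dots> = (\<integral>x. (tr_ops g j f x * cphi g f j x) * h (orb ?g n x) \<partial>mu)" by (simp add: mult.assoc)
  also have "\<dots> = (\<integral>x. tr_ops ?g n (\<lambda>x. tr_ops g j f x * cphi g f j x) x * h x \<partial>mu)"
    by (rule tr_ops_duality[OF g' decr_diff_integrable[OF cphi_decr_diff[OF g f]] h])
  finally have "\<bar>\<integral>x. f x * (cobs g f j x * h (orb g (j + n) x)) \<partial>mu\<bar>
     \<le> B * (\<integral>x. \<bar>tr_ops ?g n (\<lambda>x. tr_ops g j f x * cphi g f j x) x\<bar> \<partial>mu)"
    using abs_integral_mult_le[OF integrable_tr_ops[OF g' decr_diff_integrable[OF cphi_decr_diff[OF g f]]] h] by simp
  also have "\<dots> \<le> B * (8 * L * decay n)"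
    by (intro mult_left_mono B loss_of_memory[OF g' cphi_decr_diff[OF g f] cphi_mean[OF g f]])
  finally show ?thesis by (simp add: mult_ac)
qed

lemma cov_bound:
  assumes g: "adm g" and f: "dens f" and jk: "j \<le> k"
  shows "\<bar>\<integral>x. f x * (cobs g f j x * cobs g f k x) \<partial>mu\<bar> \<le> 16 * L\<^sup>2 * decay (k - j)"
  using cobs_decor[OF g f cphi_measurable[of g f k] cphi_bound[OF g f, of _ k], of j "k - j"] jk
  by (simp add: cobs_def[of g f k] power2_eq_square)

lemma cov_bound':
  assumes g: "adm g" and f: "dens f"
  shows "\<bar>\<integral>x. f x * (cobs g f j x * cobs g f k x) \<partial>mu\<bar> \<le> 16 * L\<^sup>2 * decay (if k \<le> j then j - k else k - j)"
  using cov_bound[OF g f, of j k] cov_bound[OF g f, of k j] by (auto simp: mult.commute)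

definition bsum :: "(nat \<Rightarrow> real) \<Rightarrow> (real \<Rightarrow> real) \<Rightarrow> nat set \<Rightarrow> real \<Rightarrow> real" where
  "bsum g f A x = (\<Sum>j\<in>A. cobs g f j x)"

lemma bsum_measurable [measurable]: "adm g \<Longrightarrow> bsum g f A \<in> borel_measurable mu"
  unfolding bsum_def[abs_def] by (intro borel_measurable_sum cobs_measurable)

lemma bsum_bound: "adm g \<Longrightarrow> dens f \<Longrightarrow> 0 < x \<Longrightarrow> x \<le> 1 \<Longrightarrow> \<bar>bsum g f A x\<bar> \<le> 2 * L * card A"
proof -
  assume *: "adm g" "dens f" "0 < x" "x \<le> 1"
  have "\<bar>bsum g f A x\<bar> \<le> (\<Sum>j\<in>A. \<bar>cobs g f j x\<bar>)" unfolding bsum_def by (rule sum_abs)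
  also have "\<dots> \<le> (\<Sum>j\<in>A. 2 * L)" by (intro sum_mono cobs_bound *)
  finally show ?thesis by (simp add: mult_ac)
qed

lemma bsum_shift: "finite A \<Longrightarrow> bsum g f ((+) n ` A) x = bsum (shift_seq g n) (tr_ops g n f) A (orb g n x)"
  unfolding bsum_def by (subst sum.reindex) (auto simp: cobs_shift)

lemma integrable_XX:
  assumes g: "adm g" and f: "dens f" shows "integrable mu (\<lambda>x. f x * (cobs g f j x * cobs g f k x))"
proof (rule integrable_mult_bounded[OF dens_integrable[OF f]])
  show "(\<lambda>x. cobs g f j x * cobs g f k x) \<in> borel_measurable mu"
    using cobs_measurable[OF g] by (intro borel_measurable_times)
  show "\<bar>cobs g f j x * cobs g f k x\<bar> \<le> (2 * L) * (2 * L)" if "0 < x" "x \<le> 1" for x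
    unfolding abs_mult using cobs_bound[OF g f that] L_pos by (intro mult_mono) auto
qed

lemma bsum_cov_expand:
  assumes g: "adm g" and f: "dens f" and A: "finite A" "finite B"
  shows "(\<integral>x. f x * (bsum g f A x * bsum g f B x) \<partial>mu) = (\<Sum>j\<in>A. \<Sum>k\<in>B. \<integral>x. f x * (cobs g f j x * cobs g f k x) \<partial>mu)"
proof -
  have "(\<integral>x. f x * (bsum g f A x * bsum g f B x) \<partial>mu) = (\<integral>x. (\<Sum>j\<in>A. \<Sum>k\<in>B. f x * (cobs g f j x * cobs g f k x)) \<partial>mu)"
    unfolding bsum_def sum_product by (simp only: sum_distrib_left)
  also have "\<dots> = (\<Sum>j\<in>A. \<integral>x. (\<Sum>k\<in>B. f x * (cobs g f j x * cobs g f k x)) \<partial>mu)"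
    by (intro Bochner_Integration.integral_sum Bochner_Integration.integrable_sum integrable_XX[OF g f])
  also have "\<dots> = (\<Sum>j\<in>A. \<Sum>k\<in>B. \<integral>x. f x * (cobs g f j x * cobs g f k x) \<partial>mu)"
    by (intro sum.cong Bochner_Integration.integral_sum integrable_XX[OF g f] refl)
  finally show ?thesis .
qed

definition cov_const :: real where "cov_const = 32 * L\<^sup>2 * suminf decay"

lemma cov_const_pos: "0 < cov_const"
proof -
  have "0 < suminf decay" using decay_summable decay_pos by (intro suminf_pos) auto
  then show ?thesis using L_pos by (simp add: cov_const_def)
qed

text \<open>Summing over B first uses only summability of \<open>decay\<close>, so B may be
  arbitrarily large and only the size of A enters. This asymmetry later allows removing a small set
  of indices from a long sum.\<close>

lemma bsum_cov:
  assumes g: "adm g" and f: "dens f" and A: "finite A" "finite B"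
  shows "\<bar>\<integral>x. f x * (bsum g f A x * bsum g f B x) \<partial>mu\<bar> \<le> cov_const * card A"
proof -
  have "\<bar>\<integral>x. f x * (bsum g f A x * bsum g f B x) \<partial>mu\<bar> \<le> (\<Sum>j\<in>A. \<Sum>k\<in>B. \<bar>\<integral>x. f x * (cobs g f j x * cobs g f k x) \<partial>mu\<bar>)"
    unfolding bsum_cov_expand[OF assms] by (intro order_trans[OF sum_abs] sum_mono order_refl)
  also have "\<dots> \<le> (\<Sum>j\<in>A. \<Sum>k\<in>B. 16 * L\<^sup>2 * decay (if k \<le> j then j - k else k - j))"
    by (intro sum_mono cov_bound' g f)
  also have "\<dots> \<le> (\<Sum>j\<in>A. 16 * L\<^sup>2 * (2 * suminf decay))"
  proof (rule sum_mono)
    fix j assume "j \<in> A"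
    show "(\<Sum>k\<in>B. 16 * L\<^sup>2 * decay (if k \<le> j then j - k else k - j)) \<le> 16 * L\<^sup>2 * (2 * suminf decay)"
      unfolding sum_distrib_left[symmetric] using A by (intro mult_left_mono sum_decay_dist) auto
  qed
  finally show ?thesis by (simp add: cov_const_def mult_ac)
qed

lemma bsum_cov_gap:
  assumes g: "adm g" and f: "dens f" and A: "finite A" "finite B"
    and gap: "\<And>j k. j \<in> A \<Longrightarrow> k \<in> B \<Longrightarrow> j + n \<le> k"
  shows "\<bar>\<integral>x. f x * (bsum g f A x * bsum g f B x) \<partial>mu\<bar> \<le> 16 * L\<^sup>2 * decay_tail n * card A"
proof -
  have "\<bar>\<integral>x. f x * (bsum g f A x * bsum g f B x) \<partial>mu\<bar> \<le> (\<Sum>j\<in>A. \<Sum>k\<in>B. \<bar>\<integral>x. f x * (cobs g f j x * cobs g f k x) \<partial>mu\<bar>)"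
    unfolding bsum_cov_expand[OF g f A] by (intro order_trans[OF sum_abs] sum_mono order_refl)
  also have "\<dots> \<le> (\<Sum>j\<in>A. \<Sum>k\<in>B. 16 * L\<^sup>2 * decay (k - j))"
    using gap by (intro sum_mono cov_bound g f) fastforce
  also have "\<dots> \<le> (\<Sum>j\<in>A. 16 * L\<^sup>2 * decay_tail n)"
  proof (rule sum_mono)
    fix j assume "j \<in> A"
    then show "(\<Sum>k\<in>B. 16 * L\<^sup>2 * decay (k - j)) \<le> 16 * L\<^sup>2 * decay_tail n"
      unfolding sum_distrib_left[symmetric] using A gap by (intro mult_left_mono sum_decay_tail) auto
  qed
  finally show ?thesis by (simp add: mult_ac)
qed

end

section \<open>Characteristic functions of block sums\<close>

lemma tr_ops_Suc_front: "tr_ops g (Suc k) f = tr_ops (shift_seq g 1) k (tr_op (g 0) f)"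
  using tr_ops_shift[of g 1 k f] by simp

lemma orb_Suc_front: "orb g (Suc k) x = orb (shift_seq g 1) k (LSV (g 0) x)"
  using orb_shift[of g 1 k x] by simp

text \<open>Characteristic function of Y under the density f at frequency 1; the actual frequency is
  carried inside Y.\<close>

definition cfun :: "(real \<Rightarrow> real) \<Rightarrow> (real \<Rightarrow> real) \<Rightarrow> complex" where
  "cfun f Y = (CLINT x|mu. complex_of_real (f x) * iexp (Y x))"

lemma integrable_cfun:
  assumes "integrable mu f" "Y \<in> borel_measurable mu"
  shows "integrable mu (\<lambda>x. complex_of_real (f x) * iexp (Y x))"
proof (rule Bochner_Integration.integrable_bound[OF assms(1)])
  show "(\<lambda>x. complex_of_real (f x) * iexp (Y x)) \<in> borel_measurable mu"
    using assms by (intro borel_measurable_times borel_measurable_of_real) auto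
qed (simp add: norm_mult)

lemma Re_cfun: "integrable mu f \<Longrightarrow> Y \<in> borel_measurable mu \<Longrightarrow> Re (cfun f Y) = (\<integral>x. f x * cos (Y x) \<partial>mu)"
  and Im_cfun: "integrable mu f \<Longrightarrow> Y \<in> borel_measurable mu \<Longrightarrow> Im (cfun f Y) = (\<integral>x. f x * sin (Y x) \<partial>mu)"
  unfolding cfun_def by (simp_all add: integral_Re[OF integrable_cfun, symmetric] integral_Im[OF integrable_cfun, symmetric] Re_exp Im_exp)

lemma norm_cfun_le: "dens f \<Longrightarrow> Y \<in> borel_measurable mu \<Longrightarrow> norm (cfun f Y) \<le> 1"
  unfolding cfun_def using dens_abs_integral[of f]
  by (intro order_trans[OF integral_norm_bound]) (simp add: norm_mult)

lemma cfun_diff_le: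
  assumes f: "dens f" and Y: "Y \<in> borel_measurable mu" "Z \<in> borel_measurable mu"
    and i: "integrable mu (\<lambda>x. f x * \<bar>Y x - Z x\<bar>)"
  shows "norm (cfun f Y - cfun f Z) \<le> (\<integral>x. f x * \<bar>Y x - Z x\<bar> \<partial>mu)"
proof -
  have "norm (iexp a - iexp b) \<le> \<bar>a - b\<bar>" for a b
  proof -
    have "iexp a - iexp b = iexp b * (iexp (a - b) - 1)"
      by (simp add: right_diff_distrib exp_add[symmetric])
    then show ?thesis using iexp_approx1[of "a - b" 0] by (simp add: norm_mult)
  qed
  note le = this
  have "cfun f Y - cfun f Z = (CLINT x|mu. complex_of_real (f x) * iexp (Y x) - complex_of_real (f x) * iexp (Z x))"
    unfolding cfun_def using f Y by (intro Bochner_Integration.integral_diff[symmetric] integrable_cfun dens_integrable)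
  also have "norm \<dots> \<le> (\<integral>x. norm (complex_of_real (f x) * iexp (Y x) - complex_of_real (f x) * iexp (Z x)) \<partial>mu)"
    by (rule integral_norm_bound)
  also have "\<dots> \<le> (\<integral>x. f x * \<bar>Y x - Z x\<bar> \<partial>mu)"
  proof (rule integral_mono)
    show "integrable mu (\<lambda>x. norm (complex_of_real (f x) * iexp (Y x) - complex_of_real (f x) * iexp (Z x)))"
      using f Y by (intro integrable_norm Bochner_Integration.integrable_diff integrable_cfun dens_integrable)
    fix x assume "x \<in> space mu"
    then have "0 \<le> f x" using dens_nonneg[OF f, of x] by auto
    then show "norm (complex_of_real (f x) * iexp (Y x) - complex_of_real (f x) * iexp (Z x)) \<le> f x * \<bar>Y x - Z x\<bar>"
      using le[of "Y x" "Z x"] by (simp add: right_diff_distrib[symmetric] norm_mult mult_left_mono)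
  qed (rule i)
  finally show ?thesis .
qed

lemma cos_lip: "\<bar>cos a - cos b\<bar> \<le> \<bar>a - b :: real\<bar>" and sin_lip: "\<bar>sin a - sin b\<bar> \<le> \<bar>a - b :: real\<bar>"
proof -
  have "norm (cos a - cos b) \<le> 1 * norm (a - b)"
    by (rule field_differentiable_bound[of UNIV cos "\<lambda>x. - sin x"]) (auto intro!: derivative_eq_intros)
  then show "\<bar>cos a - cos b\<bar> \<le> \<bar>a - b\<bar>" by simp
  have "norm (sin a - sin b) \<le> 1 * norm (a - b)"
    by (rule field_differentiable_bound[of UNIV sin cos]) (auto intro!: derivative_eq_intros)
  then show "\<bar>sin a - sin b\<bar> \<le> \<bar>a - b\<bar>" by simp
qed

lemma abs_exp_diff: "0 \<le> a \<Longrightarrow> 0 \<le> b \<Longrightarrow> \<bar>exp (- a) - exp (- b)\<bar> \<le> \<bar>a - b :: real\<bar>"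
proof -
  have *: "exp (- a) - exp (- b) \<le> b - a" if "0 \<le> a" "a \<le> b" for a b :: real
  proof -
    have "exp (- a) - exp (- b) = exp (- a) * (1 - exp (- (b - a)))" by (simp add: algebra_simps exp_add[symmetric])
    also have "\<dots> \<le> 1 * (1 - exp (- (b - a)))" using that by (intro mult_right_mono) auto
    also have "\<dots> \<le> b - a" using exp_ge_add_one_self[of "a - b"] by (simp add: algebra_simps)
    finally show ?thesis .
  qed
  assume "0 \<le> a" "0 \<le> b"
  then show ?thesis using *[of a b] *[of b a] by (cases "a \<le> b") (auto simp: abs_le_iff)
qed

lemma exp_quad: "0 \<le> y \<Longrightarrow> \<bar>exp (- y) - (1 - y)\<bar> \<le> y\<^sup>2 / (2::real)"
proof -
  assume y: "0 \<le> y"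
  have "exp (- y) \<le> 1 - y + y\<^sup>2 / 2"
  proof -
    have "1 + y + y\<^sup>2/2 \<le> exp y" using exp_lower_Taylor_quadratic[OF y] by simp
    then have "exp (- y) * (1 + y + y\<^sup>2/2) \<le> exp (- y) * exp y" by (intro mult_left_mono) auto
    then have *: "exp (- y) * (1 + y + y\<^sup>2/2) \<le> 1" by (simp add: exp_minus)
    \<comment> \<open>The product equals 1 + y^4 / 4.\<close>
    have "1 \<le> (1 - y + y\<^sup>2/2) * (1 + y + y\<^sup>2/2)" using y by (simp add: algebra_simps power2_eq_square)
    then have "exp (- y) * (1 + y + y\<^sup>2/2) \<le> (1 - y + y\<^sup>2/2) * (1 + y + y\<^sup>2/2)" using * by linarith
    moreover have "0 < 1 + y + y\<^sup>2/2" using y by (auto intro: add_pos_nonneg)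
    ultimately show ?thesis by (simp only: mult_le_cancel_right_pos)
  qed
  then show ?thesis using exp_ge_add_one_self[of "- y"] by (simp add: abs_le_iff)
qed

context obs
begin

lemma bsum_Suc_front:
  "bsum g f {..<Suc k} x = cphi g f 0 x + bsum (shift_seq g 1) (tr_op (g 0) f) {..<k} (LSV (g 0) x)"
proof -
  have "bsum g f {..<Suc k} x = cobs g f 0 x + (\<Sum>j<k. cobs g f (1 + j) x)"
    unfolding bsum_def by (subst sum.lessThan_Suc_shift) simp
  then show ?thesis by (simp only: cobs_shift bsum_def) (simp add: cobs_def)
qed

text \<open>This is the real part of (F + i H) exp(i \<theta> \<open>cphi\<close>). Writing cos as 1
  - (1 - cos) isolates F with coefficient 1; 1 - cos and sin are bounded by 2 L |\<theta>| with
  Lipschitz constant L |\<theta>|, so each costs (3 (2 L) + 2 L) |\<theta>| = 8 L |\<theta>|. A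
  factor 1 + O(|\<theta>|) per step stays bounded over k steps when \<theta> k is bounded.\<close>

lemma decr_diff_trig:
  assumes g: "adm g" and f: "dens f" and F: "decr_diff M F" "decr_diff M H"
  shows "decr_diff ((1 + 16 * L * \<bar>\<theta>\<bar>) * M) (\<lambda>x. F x * cos (\<theta> * cphi g f j x) - H x * sin (\<theta> * cphi g f j x))"
proof -
  have lip: "\<bar>\<theta> * cphi g f j x - \<theta> * cphi g f j y\<bar> \<le> \<bar>\<theta>\<bar> * L * (y - x)" if "0 < x" "x \<le> y" "y \<le> 1" for x y
    using mult_left_mono[OF cphi_lip[OF that, of g f j], of "\<bar>\<theta>\<bar>"]
    by (simp add: right_diff_distrib[symmetric] abs_mult mult.assoc)
  have bd: "\<bar>\<theta> * cphi g f j x\<bar> \<le> \<bar>\<theta>\<bar> * (2 * L)" if "0 < x" "x \<le> 1" for x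
    using mult_left_mono[OF cphi_bound[OF g f that, of j], of "\<bar>\<theta>\<bar>"] by (simp add: abs_mult)
  have 1: "decr_diff ((3 * (\<bar>\<theta>\<bar> * (2 * L)) + 2 * (\<bar>\<theta>\<bar> * L)) * M) (\<lambda>x. (1 - cos (\<theta> * cphi g f j x)) * F x)"
  proof (rule decr_diff_mult[OF F(1)])
    fix x :: real assume x: "0 < x" "x \<le> 1"
    show "\<bar>1 - cos (\<theta> * cphi g f j x)\<bar> \<le> \<bar>\<theta>\<bar> * (2 * L)"
      using cos_lip[of 0 "\<theta> * cphi g f j x"] bd[OF x] by simp
  next
    fix x y :: real assume x: "0 < x" "x \<le> y" "y \<le> 1"
    have "1 - cos (\<theta> * cphi g f j x) - (1 - cos (\<theta> * cphi g f j y)) = cos (\<theta> * cphi g f j y) - cos (\<theta> * cphi g f j x)" by simp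
    then show "\<bar>1 - cos (\<theta> * cphi g f j x) - (1 - cos (\<theta> * cphi g f j y))\<bar> \<le> \<bar>\<theta>\<bar> * L * (y - x)"
      using cos_lip[of "\<theta> * cphi g f j y" "\<theta> * cphi g f j x"] lip[OF x] by (simp add: abs_minus_commute)
  qed (use L_pos in auto)
  have 2: "decr_diff ((3 * (\<bar>\<theta>\<bar> * (2 * L)) + 2 * (\<bar>\<theta>\<bar> * L)) * M) (\<lambda>x. sin (\<theta> * cphi g f j x) * H x)"
  proof (rule decr_diff_mult[OF F(2)])
    fix x :: real assume x: "0 < x" "x \<le> 1"
    show "\<bar>sin (\<theta> * cphi g f j x)\<bar> \<le> \<bar>\<theta>\<bar> * (2 * L)"
      using sin_lip[of "\<theta> * cphi g f j x" 0] bd[OF x] by simp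
  next
    fix x y :: real assume x: "0 < x" "x \<le> y" "y \<le> 1"
    show "\<bar>sin (\<theta> * cphi g f j x) - sin (\<theta> * cphi g f j y)\<bar> \<le> \<bar>\<theta>\<bar> * L * (y - x)"
      using sin_lip[of "\<theta> * cphi g f j x" "\<theta> * cphi g f j y"] lip[OF x] by simp
  qed (use L_pos in auto)
  have "decr_diff (M + (3 * (\<bar>\<theta>\<bar> * (2 * L)) + 2 * (\<bar>\<theta>\<bar> * L)) * M + (3 * (\<bar>\<theta>\<bar> * (2 * L)) + 2 * (\<bar>\<theta>\<bar> * L)) * M)
     (\<lambda>x. F x + - ((1 - cos (\<theta> * cphi g f j x)) * F x) + - (sin (\<theta> * cphi g f j x) * H x))"
    by (intro decr_diff_add decr_diff_minus 1 2 F)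
  then show ?thesis
    by (elim decr_diff_mono[OF decr_diff_cong]) (auto simp: algebra_simps)
qed

text \<open>For the complex density F + i H this tracks the real part of its product with exp(i theta S).\<close>
lemma decr_diff_block:
  assumes "adm g" and "dens f" and "decr_diff M F" "decr_diff M H"
  shows "decr_diff ((1 + 16 * L * \<bar>\<theta>\<bar>) ^ k * M)
    (tr_ops g k (\<lambda>x. F x * cos (\<theta> * bsum g f {..<k} x) - H x * sin (\<theta> * bsum g f {..<k} x)))"
  using assms
proof (induction k arbitrary: g f F H M)
  case 0
  then show ?case by (simp add: bsum_def)
next
  case (Suc k)
  define q where "q = 1 + 16 * L * \<bar>\<theta>\<bar>"
  let ?g = "shift_seq g 1" and ?f = "tr_op (g 0) f"
  let ?x = "\<lambda>x. \<theta> * cphi g f 0 x" and ?B = "\<lambda>x. \<theta> * bsum ?g ?f {..<k} x"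
  note g0 = admD[OF Suc.prems(1), of 0] and g' = adm_shift[OF Suc.prems(1), of 1]
  \<comment> \<open>Real and imaginary part of (F + i H) exp(i \<open>?x\<close>). The imaginary
    part has the shape of the real part for the pair (H, -F), so \<open>decr_diff_trig\<close>
    covers both.\<close>
  let ?F = "\<lambda>x. F x * cos (?x x) - H x * sin (?x x)" and ?H = "\<lambda>x. H x * cos (?x x) - (- F x) * sin (?x x)"
  have V': "decr_diff (q * M) (tr_op (g 0) ?F)" "decr_diff (q * M) (tr_op (g 0) ?H)"
    using decr_diff_tr_ops[OF Suc.prems(1) decr_diff_trig[OF Suc.prems(1-4), of \<theta> 0], of 1]
      decr_diff_tr_ops[OF Suc.prems(1) decr_diff_trig[OF Suc.prems(1,2,4) decr_diff_minus[OF Suc.prems(3)], of \<theta> 0], of 1]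
    by (simp_all add: q_def)
  have "decr_diff (q ^ k * (q * M)) (tr_ops ?g k (\<lambda>x. tr_op (g 0) ?F x * cos (?B x) - tr_op (g 0) ?H x * sin (?B x)))"
    unfolding q_def by (rule Suc.IH[OF g' dens_tr_op[OF g0 Suc.prems(2)] V'[unfolded q_def]])
  also have "q ^ k * (q * M) = q ^ Suc k * M" by simp
  finally show ?case unfolding q_def[symmetric]
  proof (rule decr_diff_cong)
    fix y :: real assume y: "0 < y" "y \<le> 1"
    show "tr_ops ?g k (\<lambda>x. tr_op (g 0) ?F x * cos (?B x) - tr_op (g 0) ?H x * sin (?B x)) y =
      tr_ops g (Suc k) (\<lambda>x. F x * cos (\<theta> * bsum g f {..<Suc k} x) - H x * sin (\<theta> * bsum g f {..<Suc k} x)) y"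
      unfolding tr_ops_Suc_front
    proof (rule tr_ops_cong[OF g' _ y])
      fix x :: real assume x: "0 < x" "x \<le> 1"
      have "tr_op (g 0) ?F x * cos (?B x) - tr_op (g 0) ?H x * sin (?B x) =
        tr_op (g 0) (\<lambda>x. ?F x * cos (?B (LSV (g 0) x)) - ?H x * sin (?B (LSV (g 0) x))) x"
        using tr_op_mult_comp[OF g0(1) x, of ?F "\<lambda>y. cos (?B y)"] tr_op_mult_comp[OF g0(1) x, of ?H "\<lambda>y. sin (?B y)"]
          tr_op_diff[of "g 0" "\<lambda>x. ?F x * cos (?B (LSV (g 0) x))" "\<lambda>x. ?H x * sin (?B (LSV (g 0) x))" x]
        by (simp only:)
      also have "(\<lambda>x. ?F x * cos (?B (LSV (g 0) x)) - ?H x * sin (?B (LSV (g 0) x))) =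
        (\<lambda>x. F x * cos (\<theta> * bsum g f {..<Suc k} x) - H x * sin (\<theta> * bsum g f {..<Suc k} x))"
        by (rule ext) (simp add: bsum_Suc_front distrib_left cos_add sin_add algebra_simps)
      finally show "tr_op (g 0) ?F x * cos (?B x) - tr_op (g 0) ?H x * sin (?B x) =
        tr_op (g 0) (\<lambda>x. F x * cos (\<theta> * bsum g f {..<Suc k} x) - H x * sin (\<theta> * bsum g f {..<Suc k} x)) x" .
    qed
  qed
qed

text \<open>It is the image of f u at time k, not f u itself, that is known to lie in the class.
  Subtracting c f makes the integral zero; c times a density costs at most 3, and Q + 3 \<le> 4 Q.
  The n steps of the gap then make the remainder small in L1.\<close>

lemma decor_decr_diff:
  assumes g: "adm g" and f: "dens f" and u: "u \<in> borel_measurable mu" "\<And>x. 0 < x \<Longrightarrow> x \<le> 1 \<Longrightarrow> \<bar>u x\<bar> \<le> 1"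
    and Vu: "decr_diff Q (tr_ops g k (\<lambda>x. f x * u x))" and Q: "1 \<le> Q"
    and R: "R \<in> borel_measurable mu" "\<And>x. 0 < x \<Longrightarrow> x \<le> 1 \<Longrightarrow> \<bar>R x\<bar> \<le> 1"
  shows "\<bar>(\<integral>x. f x * (u x * R (orb g (k + n) x)) \<partial>mu) - (\<integral>x. f x * u x \<partial>mu) * (\<integral>x. f x * R (orb g (k + n) x) \<partial>mu)\<bar>
    \<le> 4 * Q * decay n"
proof -
  define c where "c = (\<integral>x. f x * u x \<partial>mu)"
  define w where "w = (\<lambda>x. f x * u x - c * f x)"
  have c: "\<bar>c\<bar> \<le> 1" unfolding c_def by (rule dens_bound[OF f u])
  have i: "integrable mu f" "integrable mu (\<lambda>x. f x * u x)"
    using dens_integrable[OF f] integrable_mult_bounded[OF dens_integrable[OF f] u] by auto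
  have iw: "integrable mu w" unfolding w_def using i by auto
  have w0: "integral\<^sup>L mu w = 0" unfolding w_def using i dens_integral[OF f] by (simp add: c_def)
  have RT: "(\<lambda>x. R (orb g (k + n) x)) \<in> borel_measurable mu" "\<And>x. 0 < x \<Longrightarrow> x \<le> 1 \<Longrightarrow> \<bar>R (orb g (k + n) x)\<bar> \<le> 1"
    using measurable_compose[OF orb_measurable[OF g] R(1)] orb_range[OF g] R(2) by auto
  have "decr_diff ((3 * 1 + 2 * 0) * 1) (\<lambda>x. c * tr_ops g k f x)"
    using c by (intro decr_diff_mult decr_fn_decr_diff dens_decr_fn dens_tr_ops g f) auto
  from decr_diff_add[OF Vu decr_diff_minus[OF this]]
  have "decr_diff (Q + 3) (\<lambda>x. tr_ops g k (\<lambda>x. f x * u x) x + - (c * tr_ops g k f x))" by simp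
  moreover have "tr_ops g k w = (\<lambda>x. tr_ops g k (\<lambda>x. f x * u x) x + - (c * tr_ops g k f x))"
    unfolding w_def by (simp add: tr_ops_diff tr_ops_cmult)
  ultimately have VW: "decr_diff (4 * Q) (tr_ops g k w)"
    using decr_diff_mono[of "Q + 3" _ "4 * Q"] Q by simp
  have "(\<integral>x. f x * (u x * R (orb g (k + n) x)) \<partial>mu) - c * (\<integral>x. f x * R (orb g (k + n) x) \<partial>mu)
     = (\<integral>x. w x * R (orb g (k + n) x) \<partial>mu)"
    unfolding w_def
    using integrable_mult_bounded[OF i(1) RT] integrable_mult_bounded[OF i(2) RT]
    by (simp add: left_diff_distrib mult.assoc)
  also have "\<dots> = (\<integral>x. tr_ops g (k + n) w x * R x \<partial>mu)"
    by (rule tr_ops_duality[OF g iw R])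
  also have "\<bar>\<dots>\<bar> \<le> 1 * (\<integral>x. \<bar>tr_ops g (k + n) w x\<bar> \<partial>mu)"
    by (rule abs_integral_mult_le[OF integrable_tr_ops[OF g iw] R])
  also have "(\<integral>x. \<bar>tr_ops g (k + n) w x\<bar> \<partial>mu) = (\<integral>x. \<bar>tr_ops (shift_seq g k) n (tr_ops g k w) x\<bar> \<partial>mu)"
    by (simp add: tr_ops_shift)
  also have "1 * \<dots> \<le> 4 * Q * decay n"
    using loss_of_memory[OF adm_shift[OF g] VW, of k n] w0 by (simp add: integral_tr_ops[OF g iw])
  finally show ?thesis unfolding c_def .
qed

lemma decor_trig:
  assumes g: "adm g" and f: "dens f"
    and R: "R \<in> borel_measurable mu" "\<And>x. 0 < x \<Longrightarrow> x \<le> 1 \<Longrightarrow> \<bar>R x\<bar> \<le> 1"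
    and u: "u = cos \<or> u = sin"
  shows "\<bar>(\<integral>x. f x * (u (\<theta> * bsum g f {..<k} x) * R (orb g (k + n) x)) \<partial>mu)
      - (\<integral>x. f x * u (\<theta> * bsum g f {..<k} x) \<partial>mu) * (\<integral>x. f x * R (orb g (k + n) x) \<partial>mu)\<bar>
    \<le> 4 * (1 + 16 * L * \<bar>\<theta>\<bar>) ^ k * decay n"
proof (rule decor_decr_diff[OF g f _ _ _ _ R])
  have m: "bsum g f {..<k} \<in> borel_measurable mu" by (rule bsum_measurable[OF g])
  show "(\<lambda>x. u (\<theta> * bsum g f {..<k} x)) \<in> borel_measurable mu"
    using u m by (elim disjE) simp_all
  show "\<bar>u (\<theta> * bsum g f {..<k} x)\<bar> \<le> 1" for x
    using u by auto
  show "1 \<le> (1 + 16 * L * \<bar>\<theta>\<bar>) ^ k" using L_pos by (intro one_le_power) auto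
  have z: "decr_diff 1 (\<lambda>x. 0)" using decr_fn_decr_diff[OF decr_fn_zero[of 1]] by simp
  note v = decr_fn_decr_diff[OF dens_decr_fn[OF f]]
  \<comment> \<open>In \<open>decr_diff_block\<close> the pair (f, 0) produces the cosine and the
    pair (0, -f) the sine.\<close>
  show "decr_diff ((1 + 16 * L * \<bar>\<theta>\<bar>) ^ k) (tr_ops g k (\<lambda>x. f x * u (\<theta> * bsum g f {..<k} x)))"
    using u decr_diff_block[OF g f v z, of \<theta> k] decr_diff_block[OF g f z decr_diff_minus[OF v], of \<theta> k] by (elim disjE) simp_all
qed

text \<open>The addition theorems split the real and the imaginary part into two products each; all
  four decorrelate with error e, and 4 e is the stated bound. The second factor is read off at time
  k + n, under the density pushed there.\<close>

lemma cfun_decor: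
  assumes g: "adm g" and f: "dens f" and Z: "Z \<in> borel_measurable mu"
  shows "norm (cfun f (\<lambda>x. \<theta> * bsum g f {..<k} x + Z (orb g (k + n) x))
      - cfun f (\<lambda>x. \<theta> * bsum g f {..<k} x) * cfun (tr_ops g (k + n) f) Z)
    \<le> 16 * (1 + 16 * L * \<bar>\<theta>\<bar>) ^ k * decay n"
proof -
  define e where "e = 4 * (1 + 16 * L * \<bar>\<theta>\<bar>) ^ k * decay n"
  let ?Y = "\<lambda>x. \<theta> * bsum g f {..<k} x" and ?Z = "\<lambda>x. Z (orb g (k + n) x)"
  have mY: "?Y \<in> borel_measurable mu" using bsum_measurable[OF g] by simp
  have mZ: "?Z \<in> borel_measurable mu" by (rule measurable_compose[OF orb_measurable[OF g] Z])
  note i = dens_integrable[OF f]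
  have int: "integrable mu (\<lambda>x. f x * (u (?Y x) * v (?Z x)))" if "u = cos \<or> u = sin" "v = cos \<or> v = sin" for u v
  proof (rule integrable_mult_bounded[OF i, where B = "1 * 1"])
    show "(\<lambda>x. u (?Y x) * v (?Z x)) \<in> borel_measurable mu"
      using that mY mZ by (elim disjE) simp_all
    show "\<bar>u (?Y x) * v (?Z x)\<bar> \<le> 1 * 1" for x
      unfolding abs_mult using that by (intro mult_mono) auto
  qed
  have d: "\<bar>(\<integral>x. f x * (u (?Y x) * v (?Z x)) \<partial>mu) - (\<integral>x. f x * u (?Y x) \<partial>mu) * (\<integral>x. tr_ops g (k + n) f x * v (Z x) \<partial>mu)\<bar> \<le> e"
    if "u = cos \<or> u = sin" "v = cos \<or> v = sin" for u v
  proof -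
    have mv: "(\<lambda>x. v (Z x)) \<in> borel_measurable mu" using that Z by (elim disjE) simp_all
    have bv: "\<bar>v (Z x)\<bar> \<le> 1" for x using that by auto
    have "(\<integral>x. f x * v (?Z x) \<partial>mu) = (\<integral>x. tr_ops g (k + n) f x * v (Z x) \<partial>mu)"
      by (rule tr_ops_duality[OF g i mv bv])
    then show ?thesis using decor_trig[OF g f mv bv that(1), of \<theta> k n] by (simp add: e_def)
  qed
  have mYZ: "(\<lambda>x. ?Y x + ?Z x) \<in> borel_measurable mu" using mY mZ by simp
  note i' = dens_integrable[OF dens_tr_ops[OF g f, of "k + n"]]
  let ?decr_fn = "cfun f (\<lambda>x. ?Y x + ?Z x) - cfun f ?Y * cfun (tr_ops g (k + n) f) Z"
  have "Re (cfun f (\<lambda>x. ?Y x + ?Z x)) = (\<integral>x. f x * (cos (?Y x) * cos (?Z x)) \<partial>mu) - (\<integral>x. f x * (sin (?Y x) * sin (?Z x)) \<partial>mu)"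
    by (subst Bochner_Integration.integral_diff[symmetric]) (simp_all add: int Re_cfun[OF i mYZ] cos_add right_diff_distrib)
  then have "Re ?decr_fn = ((\<integral>x. f x * (cos (?Y x) * cos (?Z x)) \<partial>mu) - (\<integral>x. f x * cos (?Y x) \<partial>mu) * (\<integral>x. tr_ops g (k + n) f x * cos (Z x) \<partial>mu))
      - ((\<integral>x. f x * (sin (?Y x) * sin (?Z x)) \<partial>mu) - (\<integral>x. f x * sin (?Y x) \<partial>mu) * (\<integral>x. tr_ops g (k + n) f x * sin (Z x) \<partial>mu))"
    by (simp add: Re_cfun[OF i mY] Im_cfun[OF i mY] Re_cfun[OF i' Z] Im_cfun[OF i' Z])
  then have re: "\<bar>Re ?decr_fn\<bar> \<le> e + e" using d[OF disjI1[OF refl] disjI1[OF refl]] d[OF disjI2[OF refl] disjI2[OF refl]] by linarith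
  have "Im (cfun f (\<lambda>x. ?Y x + ?Z x)) = (\<integral>x. f x * (sin (?Y x) * cos (?Z x)) \<partial>mu) + (\<integral>x. f x * (cos (?Y x) * sin (?Z x)) \<partial>mu)"
    by (subst Bochner_Integration.integral_add[symmetric]) (simp_all add: int Im_cfun[OF i mYZ] sin_add distrib_left)
  then have "Im ?decr_fn = ((\<integral>x. f x * (sin (?Y x) * cos (?Z x)) \<partial>mu) - (\<integral>x. f x * sin (?Y x) \<partial>mu) * (\<integral>x. tr_ops g (k + n) f x * cos (Z x) \<partial>mu))
      + ((\<integral>x. f x * (cos (?Y x) * sin (?Z x)) \<partial>mu) - (\<integral>x. f x * cos (?Y x) \<partial>mu) * (\<integral>x. tr_ops g (k + n) f x * sin (Z x) \<partial>mu))"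
    by (simp add: Re_cfun[OF i mY] Im_cfun[OF i mY] Re_cfun[OF i' Z] Im_cfun[OF i' Z])
  then have im: "\<bar>Im ?decr_fn\<bar> \<le> e + e" using d[OF disjI2[OF refl] disjI1[OF refl]] d[OF disjI1[OF refl] disjI2[OF refl]] by linarith
  have "norm ?decr_fn \<le> \<bar>Re ?decr_fn\<bar> + \<bar>Im ?decr_fn\<bar>" by (rule cmod_le)
  then show ?thesis using re im unfolding e_def by linarith
qed

lemma bsum_mean: assumes g: "adm g" and f: "dens f" shows "(\<integral>x. f x * bsum g f A x \<partial>mu) = 0"
proof -
  have cobs: "integrable mu (\<lambda>x. f x * cobs g f j x)" "(\<integral>x. f x * cobs g f j x \<partial>mu) = 0" for j
  proof -
    show "integrable mu (\<lambda>x. f x * cobs g f j x)"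
      by (rule integrable_mult_bounded[OF dens_integrable[OF f] cobs_measurable[OF g] cobs_bound[OF g f]])
    show "(\<integral>x. f x * cobs g f j x \<partial>mu) = 0"
      unfolding cobs_def by (subst tr_ops_duality[OF g dens_integrable[OF f] cphi_measurable cphi_bound[OF g f]]) (auto simp: cphi_mean[OF g f])
  qed
  show ?thesis by (simp add: bsum_def sum_distrib_left cobs)
qed

lemma integrable_bsum_pow: assumes g: "adm g" and f: "dens f"
  shows "integrable mu (\<lambda>x. f x * \<bar>bsum g f A x\<bar> ^ m)" "integrable mu (\<lambda>x. f x * bsum g f A x ^ m)"
proof -
  have m: "bsum g f A \<in> borel_measurable mu" by (rule bsum_measurable[OF g])
  have b: "\<bar>bsum g f A x\<bar> ^ m \<le> (2 * L * card A) ^ m" if "0 < x" "x \<le> 1" for x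
    using bsum_bound[OF g f that] by (intro power_mono) auto
  show "integrable mu (\<lambda>x. f x * \<bar>bsum g f A x\<bar> ^ m)" "integrable mu (\<lambda>x. f x * bsum g f A x ^ m)"
    by (rule integrable_mult_bounded[OF dens_integrable[OF f], where B = "(2 * L * card A) ^ m"];
      use m b in \<open>simp add: power_abs\<close>)+
qed

definition bvar :: "(nat \<Rightarrow> real) \<Rightarrow> (real \<Rightarrow> real) \<Rightarrow> nat set \<Rightarrow> real" where
  "bvar g f A = (\<integral>x. f x * (bsum g f A x)\<^sup>2 \<partial>mu)"

lemma bvar_nonneg: "dens f \<Longrightarrow> 0 \<le> bvar g f A"
  unfolding bvar_def by (intro integral_nonneg_AE AE_mu) (simp add: dens_nonneg)

lemma bvar_le: "adm g \<Longrightarrow> dens f \<Longrightarrow> finite A \<Longrightarrow> bvar g f A \<le> cov_const * card A"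
  using bsum_cov[of g f A A] by (simp add: bvar_def power2_eq_square)

text \<open>Second-order expansion whose linear term vanishes by centring. In the remainder one
  factor of |S|^3 is bounded by 2 L k, so that the variance bound \<open>cov_const\<close> k
  suffices and no higher moment is estimated. The second error term compares 1 - y with
  exp(-y).\<close>

lemma cfun_taylor:
  assumes g: "adm g" and f: "dens f"
  shows "norm (cfun f (\<lambda>x. \<theta> * bsum g f {..<k} x) - exp (- (\<theta>\<^sup>2 * bvar g f {..<k} / 2)))
     \<le> \<bar>\<theta>\<bar> ^ 3 * L * cov_const * k\<^sup>2 + \<theta> ^ 4 * cov_const\<^sup>2 * k\<^sup>2"
proof -
  let ?Y = "\<lambda>x. \<theta> * bsum g f {..<k} x" and ?S = "bsum g f {..<k}"
  define v where "v = bvar g f {..<k}"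
  have v: "0 \<le> v" "v \<le> cov_const * k" using bvar_nonneg[OF f] bvar_le[OF g f, of "{..<k}"] by (auto simp: v_def)
  have m: "?S \<in> borel_measurable mu" by (rule bsum_measurable[OF g])
  note i = dens_integrable[OF f]
  note ip = integrable_bsum_pow[OF g f, of "{..<k}"]
  define T where "T = (\<lambda>x. complex_of_real (f x) + \<i> * complex_of_real (\<theta> * (f x * ?S x ^ 1)) - complex_of_real (\<theta>\<^sup>2 / 2 * (f x * ?S x ^ 2)))"
  have iT: "integrable mu T" unfolding T_def
    by (intro Bochner_Integration.integrable_diff Bochner_Integration.integrable_add integrable_mult_right integrable_of_real i ip)
  have IT: "(CLINT x|mu. T x) = complex_of_real (1 - \<theta>\<^sup>2 * v / 2)"
    unfolding T_def
    apply (subst Bochner_Integration.integral_diff)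
      apply (intro Bochner_Integration.integrable_add integrable_mult_right integrable_of_real i ip)
     apply (intro integrable_mult_right integrable_of_real i ip)
    apply (subst Bochner_Integration.integral_add)
      apply (intro integrable_of_real i)
     apply (intro integrable_mult_right integrable_of_real i ip)
    by (simp only: integral_mult_right_zero integral_complex_of_real power_one_right bsum_mean[OF g f] dens_integral[OF f]
      bvar_def[symmetric] v_def[symmetric]) simp
  have le: "norm (complex_of_real (f x) * iexp (?Y x) - T x) \<le> \<bar>\<theta>\<bar> ^ 3 / 6 * (2 * L * k) * (f x * ?S x ^ 2)"
    if x: "0 < x" "x \<le> 1" for x
  proof -
    have "T x = complex_of_real (f x) * (\<Sum>j\<le>2. (\<i> * ?Y x) ^ j / fact j)"
      by (simp add: T_def numeral_2_eq_2 algebra_simps power2_eq_square)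
    then have "norm (complex_of_real (f x) * iexp (?Y x) - T x) = f x * norm (iexp (?Y x) - (\<Sum>j\<le>2. (\<i> * ?Y x) ^ j / fact j))"
      using dens_nonneg[OF f x] by (simp only: right_diff_distrib[symmetric] norm_mult norm_of_real abs_of_nonneg)
    also have "\<dots> \<le> f x * (\<bar>?Y x\<bar> ^ 3 / 6)"
      using iexp_approx1[of "?Y x" 2] dens_nonneg[OF f x] by (intro mult_left_mono) (auto simp: fact_numeral eval_nat_numeral)
    also have "\<dots> = \<bar>\<theta>\<bar> ^ 3 / 6 * \<bar>?S x\<bar> * (f x * ?S x ^ 2)"
    proof -
      have "\<bar>?S x\<bar> ^ 3 = \<bar>?S x\<bar> * ?S x ^ 2" by (simp add: power3_eq_cube power2_eq_square mult.commute)
      then show ?thesis by (simp only: abs_mult power_mult_distrib) simp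
    qed
    also have "\<dots> \<le> \<bar>\<theta>\<bar> ^ 3 / 6 * (2 * L * k) * (f x * ?S x ^ 2)"
      using bsum_bound[OF g f x, of "{..<k}"] dens_nonneg[OF f x] by (intro mult_right_mono mult_left_mono) auto
    finally show ?thesis .
  qed
  have mY: "?Y \<in> borel_measurable mu" using m by simp
  have "norm (cfun f ?Y - complex_of_real (1 - \<theta>\<^sup>2 * v / 2)) = norm (CLINT x|mu. complex_of_real (f x) * iexp (?Y x) - T x)"
    unfolding IT[symmetric] cfun_def using integrable_cfun[OF i mY] iT by simp
  also have "\<dots> \<le> (\<integral>x. norm (complex_of_real (f x) * iexp (?Y x) - T x) \<partial>mu)" by (rule integral_norm_bound)
  also have "\<dots> \<le> (\<integral>x. \<bar>\<theta>\<bar> ^ 3 / 6 * (2 * L * k) * (f x * ?S x ^ 2) \<partial>mu)"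
    using integrable_cfun[OF i mY] iT ip le by (intro integral_mono) auto
  also have "\<dots> = \<bar>\<theta>\<bar> ^ 3 / 6 * (2 * L * k) * v" by (simp add: v_def bvar_def)
  also have "\<dots> \<le> \<bar>\<theta>\<bar> ^ 3 / 6 * (2 * L * k) * (cov_const * k)" using v L_pos by (intro mult_left_mono) auto
  also have "\<dots> \<le> \<bar>\<theta>\<bar> ^ 3 * L * cov_const * k\<^sup>2"
    using mult_nonneg_nonneg[of "\<bar>\<theta>\<bar> ^ 3" "L * (cov_const * (real k)\<^sup>2)"] L_pos cov_const_pos by (simp add: power2_eq_square mult_ac)
  finally have 1: "norm (cfun f ?Y - complex_of_real (1 - \<theta>\<^sup>2 * v / 2)) \<le> \<bar>\<theta>\<bar> ^ 3 * L * cov_const * k\<^sup>2" .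
  have "norm (complex_of_real (1 - \<theta>\<^sup>2 * v / 2) - complex_of_real (exp (- (\<theta>\<^sup>2 * v / 2)))) = \<bar>exp (- (\<theta>\<^sup>2 * v / 2)) - (1 - \<theta>\<^sup>2 * v / 2)\<bar>"
    by (simp only: of_real_diff[symmetric] norm_of_real abs_minus_commute)
  also have "\<dots> \<le> (\<theta>\<^sup>2 * v / 2)\<^sup>2 / 2" using v by (intro exp_quad) auto
  also have "\<dots> \<le> (\<theta>\<^sup>2 * v)\<^sup>2" by (simp add: power_divide)
  also have "\<dots> \<le> (\<theta>\<^sup>2 * (cov_const * k))\<^sup>2" using v by (intro power_mono mult_left_mono) auto
  also have "\<dots> = \<theta> ^ 4 * cov_const\<^sup>2 * k\<^sup>2" by (simp add: power_mult_distrib)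
  finally have 2: "norm (complex_of_real (1 - \<theta>\<^sup>2 * v / 2) - complex_of_real (exp (- (\<theta>\<^sup>2 * v / 2)))) \<le> \<theta> ^ 4 * cov_const\<^sup>2 * k\<^sup>2" .
  show ?thesis
    using norm_triangle_ineq[of "cfun f ?Y - complex_of_real (1 - \<theta>\<^sup>2 * v / 2)" "complex_of_real (1 - \<theta>\<^sup>2 * v / 2) - complex_of_real (exp (- (\<theta>\<^sup>2 * v / 2)))"] 1 2
    unfolding v_def by (simp del: of_real_diff of_real_minus of_real_divide of_real_mult)
qed

section \<open>Blocks separated by gaps\<close>

fun blocks :: "nat \<Rightarrow> nat \<Rightarrow> nat \<Rightarrow> nat set" where
  "blocks k n 0 = {}"
| "blocks k n (Suc p) = {..<k} \<union> (+) (k + n) ` blocks k n p"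

lemma blocks_props: "finite (blocks k n p) \<and> blocks k n p \<subseteq> {..<p * (k + n)} \<and> card (blocks k n p) = p * k"
proof (induction p)
  case (Suc p)
  have "card (blocks k n (Suc p)) = card {..<k} + card ((+) (k + n) ` blocks k n p)"
    using Suc unfolding blocks.simps by (intro card_Un_disjoint) auto
  also have "\<dots> = Suc p * k" using Suc by (subst card_image) (auto intro!: inj_onI)
  finally show ?case using Suc by auto
qed auto

lemma bsum_blocks_Suc:
  "bsum g f (blocks k n (Suc p)) x = bsum g f {..<k} x + bsum (shift_seq g (k + n)) (tr_ops g (k + n) f) (blocks k n p) (orb g (k + n) x)"
proof -
  have "bsum g f (blocks k n (Suc p)) x = bsum g f {..<k} x + bsum g f ((+) (k + n) ` blocks k n p) x"
    unfolding bsum_def blocks.simps using blocks_props[of k n p] by (intro sum.union_disjoint) auto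
  then show ?thesis using blocks_props[of k n p] by (simp only: bsum_shift)
qed

text \<open>The cross term pairs the first block with indices at distance at least n, so only the
  decay tail from n on enters, multiplied by the length k of the first block and not by that of the
  remainder.\<close>

lemma bvar_blocks_Suc:
  assumes g: "adm g" and f: "dens f"
  shows "\<bar>bvar g f (blocks k n (Suc p)) - (bvar g f {..<k} + bvar (shift_seq g (k + n)) (tr_ops g (k + n) f) (blocks k n p))\<bar>
     \<le> 32 * L\<^sup>2 * decay_tail n * k"
proof -
  let ?B = "(+) (k + n) ` blocks k n p"
  have fin: "finite ?B" using blocks_props by auto
  let ?Y = "bsum g f {..<k}" and ?Z = "bsum g f ?B"
  have mS: "bsum g f A \<in> borel_measurable mu" for A by (rule bsum_measurable[OF g])
  have iYZ: "integrable mu (\<lambda>x. f x * (?Y x * ?Z x))"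
  proof (rule integrable_mult_bounded[OF dens_integrable[OF f]])
    show "(\<lambda>x. ?Y x * ?Z x) \<in> borel_measurable mu" using mS by simp
    show "\<bar>?Y x * ?Z x\<bar> \<le> (2 * L * card {..<k}) * (2 * L * card ?B)" if "0 < x" "x \<le> 1" for x
      unfolding abs_mult by (intro mult_mono bsum_bound[OF g f that]) (use L_pos in auto)
  qed
  note ip = integrable_bsum_pow(2)[OF g f, of _ 2]
  have "f x * (bsum g f (blocks k n (Suc p)) x)\<^sup>2 = f x * (?Y x)\<^sup>2 + f x * (?Z x)\<^sup>2 + 2 * (f x * (?Y x * ?Z x))" for x
  proof -
    have "bsum g f (blocks k n (Suc p)) x = ?Y x + ?Z x"
      unfolding bsum_def blocks.simps using blocks_props[of k n p] by (intro sum.union_disjoint) auto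
    then show ?thesis by (simp add: power2_eq_square algebra_simps)
  qed
  then have "bvar g f (blocks k n (Suc p)) = bvar g f {..<k} + bvar g f ?B + 2 * (\<integral>x. f x * (?Y x * ?Z x) \<partial>mu)"
    unfolding bvar_def using ip iYZ by simp
  moreover have "bvar g f ?B = bvar (shift_seq g (k + n)) (tr_ops g (k + n) f) (blocks k n p)"
  proof -
    let ?S = "bsum (shift_seq g (k + n)) (tr_ops g (k + n) f) (blocks k n p)"
    note g' = adm_shift[OF g, of "k + n"] and f' = dens_tr_ops[OF g f, of "k + n"]
    have "bvar g f ?B = (\<integral>x. f x * (?S (orb g (k + n) x))\<^sup>2 \<partial>mu)"
      unfolding bvar_def using blocks_props[of k n p] by (simp only: bsum_shift)
    also have "\<dots> = (\<integral>x. tr_ops g (k + n) f x * (?S x)\<^sup>2 \<partial>mu)"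
    proof (rule tr_ops_duality[OF g dens_integrable[OF f], where h = "\<lambda>x. (?S x)\<^sup>2"])
      show "(\<lambda>x. (?S x)\<^sup>2) \<in> borel_measurable mu" using bsum_measurable[OF g'] by simp
      show "\<bar>(?S x)\<^sup>2\<bar> \<le> (2 * L * card (blocks k n p))\<^sup>2" if "0 < x" "x \<le> 1" for x
        unfolding power_abs using bsum_bound[OF g' f' that] by (intro power_mono) auto
    qed
    finally show ?thesis by (simp add: bvar_def)
  qed
  moreover have "\<bar>\<integral>x. f x * (?Y x * ?Z x) \<partial>mu\<bar> \<le> 16 * L\<^sup>2 * decay_tail n * card {..<k}"
    by (rule bsum_cov_gap[OF g f _ fin]) auto
  ultimately show ?thesis by simp
qed

text \<open>Error per block: decorrelation over the gap, Taylor expansion of one factor, and the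
  failure of variances to add exactly.\<close>

definition err :: "real \<Rightarrow> nat \<Rightarrow> nat \<Rightarrow> real" where
  "err \<theta> k n = 16 * (1 + 16 * L * \<bar>\<theta>\<bar>) ^ k * decay n + (\<bar>\<theta>\<bar> ^ 3 * L * cov_const * k\<^sup>2 + \<theta> ^ 4 * cov_const\<^sup>2 * k\<^sup>2)
     + \<theta>\<^sup>2 * (32 * L\<^sup>2 * decay_tail n * k)"

text \<open>Induction from the front, over all g and f: split off the first block, replace both
  factors by Gaussians, then merge the exponents. Factors kept while the other is replaced have
  modulus at most 1, so the errors simply add.\<close>

lemma cfun_blocks:
  assumes "adm g" and "dens f"
  shows "norm (cfun f (\<lambda>x. \<theta> * bsum g f (blocks k n p) x) - exp (- (\<theta>\<^sup>2 * bvar g f (blocks k n p) / 2))) \<le> p * err \<theta> k n"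
  using assms
proof (induction p arbitrary: g f)
  case 0
  then show ?case using dens_integral[OF 0(2)] dens_integrable[OF 0(2)] by (simp add: bsum_def bvar_def cfun_def)
next
  case (Suc p)
  note g = Suc.prems(1) and f = Suc.prems(2)
  note g' = adm_shift[OF g, of "k + n"] and f' = dens_tr_ops[OF g f, of "k + n"]
  let ?S' = "bsum (shift_seq g (k + n)) (tr_ops g (k + n) f) (blocks k n p)"
  define v w u where "v = bvar g f {..<k}" and "w = bvar (shift_seq g (k + n)) (tr_ops g (k + n) f) (blocks k n p)"
    and "u = bvar g f (blocks k n (Suc p))"
  define c1 c2 c where "c1 = cfun f (\<lambda>x. \<theta> * bsum g f {..<k} x)" and "c2 = cfun (tr_ops g (k + n) f) (\<lambda>x. \<theta> * ?S' x)"
    and "c = cfun f (\<lambda>x. \<theta> * bsum g f (blocks k n (Suc p)) x)"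
  define e1 e2 where "e1 = complex_of_real (exp (- (\<theta>\<^sup>2 * v / 2)))" and "e2 = complex_of_real (exp (- (\<theta>\<^sup>2 * w / 2)))"
  have vw: "0 \<le> v" "0 \<le> w" "0 \<le> u" using bvar_nonneg f f' by (auto simp: v_def w_def u_def)
  have 1: "norm (c - c1 * c2) \<le> 16 * (1 + 16 * L * \<bar>\<theta>\<bar>) ^ k * decay n"
  proof -
    have "(\<lambda>x. \<theta> * bsum g f (blocks k n (Suc p)) x) = (\<lambda>x. \<theta> * bsum g f {..<k} x + \<theta> * ?S' (orb g (k + n) x))"
      by (simp only: bsum_blocks_Suc distrib_left)
    moreover have "(\<lambda>x. \<theta> * ?S' x) \<in> borel_measurable mu" using bsum_measurable[OF g'] by simp
    ultimately show ?thesis using cfun_decor[OF g f, of "\<lambda>x. \<theta> * ?S' x" \<theta> k n] by (simp only: c_def c1_def c2_def)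
  qed
  have 2: "norm (c1 - e1) \<le> \<bar>\<theta>\<bar> ^ 3 * L * cov_const * k\<^sup>2 + \<theta> ^ 4 * cov_const\<^sup>2 * k\<^sup>2"
    using cfun_taylor[OF g f, of \<theta> k] by (simp only: c1_def e1_def v_def)
  have 3: "norm (c2 - e2) \<le> p * err \<theta> k n"
    using Suc.IH[OF g' f'] by (simp only: c2_def e2_def w_def)
  have n: "norm c1 \<le> 1" "norm e2 \<le> 1"
    using norm_cfun_le[OF f] bsum_measurable[OF g] vw by (auto simp: c1_def e2_def)
  have 4: "norm (c1 * c2 - e1 * e2) \<le> norm (c1 - e1) + norm (c2 - e2)"
  proof -
    have "c1 * c2 - e1 * e2 = c1 * (c2 - e2) + (c1 - e1) * e2" by (simp add: algebra_simps)
    then have "norm (c1 * c2 - e1 * e2) \<le> norm c1 * norm (c2 - e2) + norm (c1 - e1) * norm e2"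
      by (metis norm_mult norm_triangle_ineq)
    also have "\<dots> \<le> 1 * norm (c2 - e2) + norm (c1 - e1) * 1" using n by (intro add_mono mult_mono) auto
    finally show ?thesis by simp
  qed
  have 5: "norm (e1 * e2 - complex_of_real (exp (- (\<theta>\<^sup>2 * u / 2)))) \<le> \<theta>\<^sup>2 * (32 * L\<^sup>2 * decay_tail n * k)"
  proof -
    have e: "e1 * e2 = complex_of_real (exp (- (\<theta>\<^sup>2 * (v + w) / 2)))"
      by (simp only: e1_def e2_def of_real_mult[symmetric] exp_add[symmetric]) (simp add: algebra_simps add_divide_distrib)
    have "norm (e1 * e2 - complex_of_real (exp (- (\<theta>\<^sup>2 * u / 2)))) \<le> \<bar>\<theta>\<^sup>2 * (v + w) / 2 - \<theta>\<^sup>2 * u / 2\<bar>"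
      unfolding e of_real_diff[symmetric] norm_of_real using vw by (intro abs_exp_diff) auto
    also have "\<dots> = \<theta>\<^sup>2 / 2 * \<bar>u - (v + w)\<bar>"
      by (simp add: abs_mult right_diff_distrib[symmetric] diff_divide_distrib[symmetric] abs_minus_commute)
    also have "\<dots> \<le> \<theta>\<^sup>2 / 2 * (32 * L\<^sup>2 * decay_tail n * k)"
      using bvar_blocks_Suc[OF g f, of k n p] by (intro mult_left_mono) (auto simp: u_def v_def w_def)
    also have "\<dots> \<le> \<theta>\<^sup>2 * (32 * L\<^sup>2 * decay_tail n * k)"
      using decay_tail_nonneg[of n] by (intro mult_right_mono) auto
    finally show ?thesis .
  qed
  have "norm (c - complex_of_real (exp (- (\<theta>\<^sup>2 * u / 2)))) \<le>
     norm (c - c1 * c2) + norm (c1 * c2 - e1 * e2) + norm (e1 * e2 - complex_of_real (exp (- (\<theta>\<^sup>2 * u / 2))))"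
    by (smt (verit) norm_triangle_ineq diff_add_cancel add_diff_eq)
  also have "\<dots> \<le> Suc p * err \<theta> k n"
    using 1 2 3 4 5 by (simp add: err_def algebra_simps)
  finally show ?case by (simp only: c_def u_def)
qed

text \<open>The set A collects the gaps and the incomplete rest. Dropping it costs |\<theta>| times
  the mean of |S_A| in the characteristic function and a change of variance in the Gaussian; both
  are controlled by the size of A through \<open>bsum_cov\<close>.\<close>

lemma cfun_main:
  fixes k n m p :: nat
  assumes g: "adm g" and f: "dens f" and p: "p * (k + n) \<le> m"
  shows "norm (cfun f (\<lambda>x. \<theta> * bsum g f {..<m} x) - exp (- (\<theta>\<^sup>2 * bvar g f {..<m} / 2)))
    \<le> p * err \<theta> k n + \<bar>\<theta>\<bar> * sqrt (cov_const * real (m - p * k)) + \<theta>\<^sup>2 * (3 * cov_const * real (m - p * k))"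
proof -
  define J where "J = blocks k n p"
  define A where "A = {..<m} - J"
  define r where "r = cov_const * real (m - p * k)"
  have J: "finite J" "J \<subseteq> {..<m}" "card J = p * k"
    using blocks_props[of k n p] p by (auto simp: J_def intro: less_le_trans)
  have A: "finite A" "card A = m - p * k" using J by (auto simp: A_def card_Diff_subset)
  have S: "bsum g f {..<m} x = bsum g f J x + bsum g f A x" for x
    unfolding bsum_def A_def using J by (metis finite_lessThan sum.subset_diff add.commute)
  have mS: "bsum g f B \<in> borel_measurable mu" for B by (rule bsum_measurable[OF g])
  note ip = integrable_bsum_pow[OF g f]
  have r0: "0 \<le> r" using cov_const_pos by (simp add: r_def)
  have vA: "bvar g f A \<le> r" using bvar_le[OF g f A(1)] by (simp add: r_def A)
  have E: "(\<integral>x. f x * \<bar>bsum g f A x\<bar> \<partial>mu) \<le> sqrt r"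
  \<comment> \<open>For r > 0 the inequality |a| \<le> s/2 + a^2 / (2 s) with s = sqrt r takes the
    place of Cauchy-Schwarz; it divides by s.\<close>
  proof (cases "r = 0")
    case True
    then have "A = {}" using A cov_const_pos by (auto simp: r_def)
    then show ?thesis using r0 by (simp add: bsum_def)
  next
    case False
    define s where "s = sqrt r"
    have s: "0 < s" "s * s = r" using False r0 by (auto simp: s_def)
    have "(\<integral>x. f x * \<bar>bsum g f A x\<bar> \<partial>mu) \<le> (\<integral>x. s / 2 * f x + 1 / (2 * s) * (f x * (bsum g f A x)\<^sup>2) \<partial>mu)"
    proof (rule integral_mono)
      show "integrable mu (\<lambda>x. f x * \<bar>bsum g f A x\<bar>)" using ip(1)[of A 1] by simp
      show "integrable mu (\<lambda>x. s / 2 * f x + 1 / (2 * s) * (f x * (bsum g f A x)\<^sup>2))"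
        using dens_integrable[OF f] ip(2)[of A 2] by simp
      fix x assume "x \<in> space mu"
      then have fx: "0 \<le> f x" using dens_nonneg[OF f, of x] by auto
      have "0 \<le> (\<bar>bsum g f A x\<bar> - s)\<^sup>2" by simp
      then have "\<bar>bsum g f A x\<bar> \<le> s / 2 + 1 / (2 * s) * (bsum g f A x)\<^sup>2"
        using s(1) by (simp add: field_simps power2_eq_square)
      from mult_left_mono[OF this fx] show "f x * \<bar>bsum g f A x\<bar> \<le> s / 2 * f x + 1 / (2 * s) * (f x * (bsum g f A x)\<^sup>2)"
        by (simp add: algebra_simps)
    qed
    also have "\<dots> = s / 2 + 1 / (2 * s) * bvar g f A"
      using dens_integrable[OF f] ip(2)[of A 2] dens_integral[OF f] by (simp add: bvar_def)
    also have "\<dots> \<le> s / 2 + 1 / (2 * s) * (s * s)" using s vA by (intro add_left_mono mult_left_mono) auto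
    also have "\<dots> = s" using s(1) by simp
    finally show ?thesis by (simp add: s_def)
  qed
  have 1: "norm (cfun f (\<lambda>x. \<theta> * bsum g f {..<m} x) - cfun f (\<lambda>x. \<theta> * bsum g f J x)) \<le> \<bar>\<theta>\<bar> * sqrt r"
  proof -
    have d: "\<bar>\<theta> * bsum g f {..<m} x - \<theta> * bsum g f J x\<bar> = \<bar>\<theta>\<bar> * \<bar>bsum g f A x\<bar>" for x
      by (simp add: S algebra_simps abs_mult)
    have "norm (cfun f (\<lambda>x. \<theta> * bsum g f {..<m} x) - cfun f (\<lambda>x. \<theta> * bsum g f J x)) \<le> (\<integral>x. f x * (\<bar>\<theta>\<bar> * \<bar>bsum g f A x\<bar>) \<partial>mu)"
      using cfun_diff_le[OF f, of "\<lambda>x. \<theta> * bsum g f {..<m} x" "\<lambda>x. \<theta> * bsum g f J x"] mS ip(1)[of A 1] unfolding d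
      by (simp add: mult.left_commute)
    also have "\<dots> = \<bar>\<theta>\<bar> * (\<integral>x. f x * \<bar>bsum g f A x\<bar> \<partial>mu)" by (simp add: mult.left_commute)
    also have "\<dots> \<le> \<bar>\<theta>\<bar> * sqrt r" by (intro mult_left_mono E) auto
    finally show ?thesis .
  qed
  have 2: "norm (cfun f (\<lambda>x. \<theta> * bsum g f J x) - exp (- (\<theta>\<^sup>2 * bvar g f J / 2))) \<le> p * err \<theta> k n"
    unfolding J_def by (rule cfun_blocks[OF g f])
  have v: "\<bar>bvar g f J - bvar g f {..<m}\<bar> \<le> 3 * r"
  proof -
    have iAS: "integrable mu (\<lambda>x. f x * (bsum g f A x * bsum g f {..<m} x))"
    proof (rule integrable_mult_bounded[OF dens_integrable[OF f]])
      show "(\<lambda>x. bsum g f A x * bsum g f {..<m} x) \<in> borel_measurable mu" using mS by simp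
      show "\<bar>bsum g f A x * bsum g f {..<m} x\<bar> \<le> (2 * L * card A) * (2 * L * card {..<m})" if "0 < x" "x \<le> 1" for x
        unfolding abs_mult by (intro mult_mono bsum_bound[OF g f that]) (use L_pos in auto)
    qed
    have e: "f x * (bsum g f J x)\<^sup>2 = f x * (bsum g f {..<m} x)\<^sup>2 + f x * (bsum g f A x)\<^sup>2 - 2 * (f x * (bsum g f A x * bsum g f {..<m} x))" for x
      by (simp add: S power2_eq_square algebra_simps)
    \<comment> \<open>The variance of A is at most r, and so is its covariance with the full sum,
      which is counted twice.\<close>
    have "bvar g f J = bvar g f {..<m} + bvar g f A - 2 * (\<integral>x. f x * (bsum g f A x * bsum g f {..<m} x) \<partial>mu)"
      unfolding bvar_def e using ip(2)[of _ 2] iAS by simp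
    moreover have "\<bar>\<integral>x. f x * (bsum g f A x * bsum g f {..<m} x) \<partial>mu\<bar> \<le> r"
      using bsum_cov[OF g f A(1), of "{..<m}"] A by (simp add: r_def)
    ultimately show ?thesis using vA bvar_nonneg[OF f, of g A] by linarith
  qed
  have 3: "norm (complex_of_real (exp (- (\<theta>\<^sup>2 * bvar g f J / 2))) - exp (- (\<theta>\<^sup>2 * bvar g f {..<m} / 2))) \<le> \<theta>\<^sup>2 * (3 * r)"
  proof -
    have "norm (complex_of_real (exp (- (\<theta>\<^sup>2 * bvar g f J / 2))) - complex_of_real (exp (- (\<theta>\<^sup>2 * bvar g f {..<m} / 2))))
       \<le> \<bar>\<theta>\<^sup>2 * bvar g f J / 2 - \<theta>\<^sup>2 * bvar g f {..<m} / 2\<bar>"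
      unfolding of_real_diff[symmetric] norm_of_real using bvar_nonneg[OF f] by (intro abs_exp_diff) auto
    also have "\<dots> = \<theta>\<^sup>2 / 2 * \<bar>bvar g f J - bvar g f {..<m}\<bar>"
      by (simp add: abs_mult right_diff_distrib[symmetric] diff_divide_distrib[symmetric])
    also have "\<dots> \<le> \<theta>\<^sup>2 / 2 * (3 * r)" using v by (intro mult_left_mono) auto
    also have "\<dots> \<le> \<theta>\<^sup>2 * (3 * r)" using r0 by (intro mult_right_mono) auto
    finally show ?thesis .
  qed
  have "norm (a - d) \<le> norm (a - b) + norm (b - c) + norm (c - d)" for a b c d :: complex
    by (smt (verit) norm_triangle_ineq diff_add_cancel add_diff_eq)
  from this[of "cfun f (\<lambda>x. \<theta> * bsum g f {..<m} x)" "complex_of_real (exp (- (\<theta>\<^sup>2 * bvar g f {..<m} / 2)))"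
    "cfun f (\<lambda>x. \<theta> * bsum g f J x)" "complex_of_real (exp (- (\<theta>\<^sup>2 * bvar g f J / 2)))"]
  show ?thesis using 1 2 3 unfolding r_def by (simp only: mult.assoc)
qed

end

section \<open>The central limit theorem under linear variance growth\<close>

text \<open>Block and gap lengths. Any exponents with gap < block < 1/2 and 1 < block + 2 gap would do.\<close>
definition blk :: "nat \<Rightarrow> nat" where "blk m = nat \<lfloor>real m powr (9/20)\<rfloor>"
definition gp :: "nat \<Rightarrow> nat" where "gp m = nat \<lfloor>real m powr (2/5)\<rfloor>"

lemma blk_real: "real (blk m) = of_int \<lfloor>real m powr (9/20)\<rfloor>" and gp_real: "real (gp m) = of_int \<lfloor>real m powr (2/5)\<rfloor>"
  by (auto simp: blk_def gp_def)

text \<open>In order: number of blocks times decay over a gap, of order m^(0.55 - 0.8); third-order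
  Taylor error; fourth-order error; proportion of indices lost to gaps and to the incomplete
  rest.\<close>

lemma blk_asymp:
  "(\<lambda>m. (real m / blk m) / (real (gp m) + 1)\<^sup>2) \<longlonglongrightarrow> 0"
  "(\<lambda>m. real (blk m) / sqrt m) \<longlonglongrightarrow> 0"
  "(\<lambda>m. real (blk m) / m) \<longlonglongrightarrow> 0"
  "(\<lambda>m. real (gp m) / blk m + (real (blk m) + gp m) / m) \<longlonglongrightarrow> 0"
  "filterlim gp at_top sequentially"
proof -
  show "(\<lambda>m. (real m / blk m) / (real (gp m) + 1)\<^sup>2) \<longlonglongrightarrow> 0"
    unfolding blk_real gp_real by real_asymp
  show "(\<lambda>m. real (blk m) / sqrt m) \<longlonglongrightarrow> 0"
    unfolding blk_real by real_asymp
  show "(\<lambda>m. real (blk m) / m) \<longlonglongrightarrow> 0"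
    unfolding blk_real by real_asymp
  show "(\<lambda>m. real (gp m) / blk m + (real (blk m) + gp m) / m) \<longlonglongrightarrow> 0"
    unfolding blk_real gp_real by real_asymp
  have "filterlim (\<lambda>m. real (gp m)) at_top sequentially"
    unfolding gp_real by real_asymp
  then show "filterlim gp at_top sequentially"
    by (simp add: filterlim_sequentially_iff_filterlim_real)
qed

context obs
begin

text \<open>The bound of \<open>cfun_main\<close> after inserting p \<le> m / k and |\<theta>| \<le>
  \<tau> / sqrt m, arranged so that each quantity depending on m tends to 0.\<close>

definition bnd :: "real \<Rightarrow> nat \<Rightarrow> real" where
  "bnd \<tau> m = 16 * exp (16 * L * \<tau>) * decay_const * ((real m / blk m) / (real (gp m) + 1)\<^sup>2)
     + \<tau> ^ 3 * L * cov_const * (real (blk m) / sqrt m) + \<tau> ^ 4 * cov_const\<^sup>2 * (real (blk m) / m)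
     + 32 * L\<^sup>2 * \<tau>\<^sup>2 * decay_tail (gp m)
     + \<tau> * sqrt (cov_const * (real (gp m) / blk m + (real (blk m) + gp m) / m))
     + 3 * \<tau>\<^sup>2 * cov_const * (real (gp m) / blk m + (real (blk m) + gp m) / m)"

lemma bnd_tendsto: "bnd \<tau> \<longlonglongrightarrow> 0"
proof -
  have "(\<lambda>m. decay_tail (gp m)) \<longlonglongrightarrow> 0" by (rule filterlim_compose[OF decay_tail_tendsto blk_asymp(5)])
  then have "bnd \<tau> \<longlonglongrightarrow> 16 * exp (16 * L * \<tau>) * decay_const * 0
     + \<tau> ^ 3 * L * cov_const * 0 + \<tau> ^ 4 * cov_const\<^sup>2 * 0 + 32 * L\<^sup>2 * \<tau>\<^sup>2 * 0 + \<tau> * sqrt (cov_const * 0) + 3 * \<tau>\<^sup>2 * cov_const * 0"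
    unfolding bnd_def by (intro tendsto_intros blk_asymp)
  then show ?thesis by simp
qed

lemma cfun_bnd:
  assumes g: "adm g" and f: "dens f" and m: "0 < m" and th: "\<bar>\<theta>\<bar> \<le> \<tau> / sqrt m" and tau: "0 \<le> \<tau>"
  shows "norm (cfun f (\<lambda>x. \<theta> * bsum g f {..<m} x) - exp (- (\<theta>\<^sup>2 * bvar g f {..<m} / 2))) \<le> bnd \<tau> m"
proof -
  define k n where "k = blk m" and "n = gp m"
  define p where "p = m div (k + n)"
  have k1: "1 \<le> k"
  proof -
    have "1 \<le> real m powr (9/20)" using m by (intro ge_one_powr_ge_zero) auto
    then show ?thesis unfolding k_def blk_def by (simp add: le_nat_iff le_floor_iff)
  qed
  have km: "real k \<le> sqrt m"
  proof -
    have "real k \<le> real m powr (9/20)" unfolding k_def blk_real by simp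
    also have "\<dots> \<le> real m powr (1/2)" using m by (intro powr_mono) auto
    finally show ?thesis by (simp add: powr_half_sqrt)
  qed
  have pm: "p * (k + n) \<le> m" unfolding p_def by simp
  have pk: "real p \<le> real m / k"
  proof -
    have "p * k \<le> m" using pm by (simp add: algebra_simps)
    then have "real (p * k) \<le> real m" unfolding of_nat_le_iff .
    then show ?thesis using k1 by (simp add: field_simps)
  qed
  \<comment> \<open>The lost indices are p gaps of length n and a rest shorter than k + n.\<close>
  have mk: "real (m - p * k) \<le> m * (real n / k + (real k + n) / m)"
  proof -
    have "m mod (k + n) < k + n" using k1 by simp
    then have "m - p * (k + n) \<le> k + n"
      unfolding p_def by (simp add: minus_div_mult_eq_mod)
    then have "m - p * k \<le> p * n + (k + n)" using pm by (simp add: algebra_simps)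
    then have "real (m - p * k) \<le> real (p * n + (k + n))" unfolding of_nat_le_iff .
    also have "\<dots> \<le> real m / k * n + (k + n)" using mult_right_mono[OF pk, of "real n"] by simp
    also have "\<dots> = m * (real n / k + (real k + n) / m)" using m by (simp add: field_simps)
    finally show ?thesis .
  qed
  have sm: "0 < sqrt m" using m by simp
  have th2: "\<theta>\<^sup>2 \<le> \<tau>\<^sup>2 / m"
  proof -
    have "\<bar>\<theta>\<bar>\<^sup>2 \<le> (\<tau> / sqrt m)\<^sup>2" using th by (intro power_mono) auto
    then show ?thesis by (simp add: power_divide)
  qed
  have th3: "\<bar>\<theta>\<bar> ^ 3 \<le> \<tau> ^ 3 / (sqrt m * m)"
  proof -
    have "\<bar>\<theta>\<bar> ^ 3 \<le> (\<tau> / sqrt m) ^ 3" using th by (intro power_mono) auto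
    also have "(sqrt m) ^ 3 = sqrt m * m" by (simp add: power3_eq_cube)
    then have "(\<tau> / sqrt m) ^ 3 = \<tau> ^ 3 / (sqrt m * m)" by (simp add: power_divide)
    finally show ?thesis .
  qed
  have th4: "\<theta> ^ 4 \<le> \<tau> ^ 4 / (real m * m)"
  proof -
    have "(\<theta>\<^sup>2)\<^sup>2 \<le> (\<tau>\<^sup>2 / m)\<^sup>2" using th2 by (intro power_mono) auto
    then show ?thesis by (simp add: power_divide power2_eq_square mult_ac) (simp add: eval_nat_numeral mult_ac)
  qed
  have a1: "p * (16 * (1 + 16 * L * \<bar>\<theta>\<bar>) ^ k * decay n) \<le> 16 * exp (16 * L * \<tau>) * decay_const * ((real m / k) / (real n + 1)\<^sup>2)"
  proof -
    \<comment> \<open>With 1 + x \<le> exp x and k \<le> sqrt m, the k-th power is bounded uniformly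
      in m.\<close>
    have "1 + 16 * L * \<bar>\<theta>\<bar> \<le> exp (16 * L * \<tau> / sqrt m)"
    proof -
      have "16 * L * \<bar>\<theta>\<bar> \<le> 16 * L * (\<tau> / sqrt m)" using th L_pos by (intro mult_left_mono) auto
      then show ?thesis using exp_ge_add_one_self[of "16 * L * \<tau> / sqrt m"]
        unfolding times_divide_eq_right by linarith
    qed
    then have "(1 + 16 * L * \<bar>\<theta>\<bar>) ^ k \<le> exp (16 * L * \<tau> / sqrt m) ^ k"
      using L_pos by (intro power_mono) auto
    also have "\<dots> = exp (16 * L * \<tau> * (k / sqrt m))" by (simp add: exp_of_nat_mult[symmetric] mult_ac)
    also have "\<dots> \<le> exp (16 * L * \<tau> * 1)"
      using km sm L_pos tau by (intro exp_le_cancel_iff[THEN iffD2] mult_left_mono) (auto simp: field_simps)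
    finally have e: "(1 + 16 * L * \<bar>\<theta>\<bar>) ^ k \<le> exp (16 * L * \<tau>)" by simp
    have "p * (16 * (1 + 16 * L * \<bar>\<theta>\<bar>) ^ k * decay n) \<le> real m / k * (16 * exp (16 * L * \<tau>) * decay n)"
      using e pk decay_pos[of n] L_pos by (intro mult_mono mult_right_mono mult_left_mono) (auto intro!: mult_nonneg_nonneg simp: less_imp_le)
    also have "\<dots> = 16 * exp (16 * L * \<tau>) * decay_const * ((real m / k) / (real n + 1)\<^sup>2)"
      by (simp add: decay_def)
    finally show ?thesis .
  qed
  have kk: "real m / k * k\<^sup>2 = real m * k" using k1 by (simp add: power2_eq_square)
  have a2: "p * (\<bar>\<theta>\<bar> ^ 3 * L * cov_const * k\<^sup>2) \<le> \<tau> ^ 3 * L * cov_const * (real k / sqrt m)"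
  proof -
    have "p * (\<bar>\<theta>\<bar> ^ 3 * L * cov_const * k\<^sup>2) \<le> real m / k * (\<tau> ^ 3 / (sqrt m * m) * L * cov_const * k\<^sup>2)"
      using pk th3 L_pos cov_const_pos by (intro mult_mono mult_right_mono) auto
    also have "\<dots> = \<tau> ^ 3 / (sqrt m * m) * L * cov_const * (real m / k * k\<^sup>2)" by (simp only: mult_ac)
    also have "\<dots> = \<tau> ^ 3 * L * cov_const * (real k / sqrt m)" unfolding kk using m by (simp add: field_simps)
    finally show ?thesis .
  qed
  have a3: "p * (\<theta> ^ 4 * cov_const\<^sup>2 * k\<^sup>2) \<le> \<tau> ^ 4 * cov_const\<^sup>2 * (real k / m)"
  proof -
    have "p * (\<theta> ^ 4 * cov_const\<^sup>2 * k\<^sup>2) \<le> real m / k * (\<tau> ^ 4 / (real m * m) * cov_const\<^sup>2 * k\<^sup>2)"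
      using pk th4 by (intro mult_mono mult_right_mono) auto
    also have "\<dots> = \<tau> ^ 4 / (real m * m) * cov_const\<^sup>2 * (real m / k * k\<^sup>2)" by (simp only: mult_ac)
    also have "\<dots> = \<tau> ^ 4 * cov_const\<^sup>2 * (real k / m)" unfolding kk using m by (simp add: field_simps)
    finally show ?thesis .
  qed
  have a4: "p * (\<theta>\<^sup>2 * (32 * L\<^sup>2 * decay_tail n * k)) \<le> 32 * L\<^sup>2 * \<tau>\<^sup>2 * decay_tail n"
  proof -
    have "p * (\<theta>\<^sup>2 * (32 * L\<^sup>2 * decay_tail n * k)) \<le> real m / k * (\<tau>\<^sup>2 / m * (32 * L\<^sup>2 * decay_tail n * k))"
      using pk th2 decay_tail_nonneg[of n] by (intro mult_mono mult_right_mono) auto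
    also have "\<dots> = 32 * L\<^sup>2 * \<tau>\<^sup>2 * decay_tail n" using m k1 by (simp add: field_simps)
    finally show ?thesis .
  qed
  define \<rho> where "\<rho> = real n / k + (real k + n) / m"
  have rho: "0 \<le> \<rho>" by (simp add: \<rho>_def)
  have a5: "\<bar>\<theta>\<bar> * sqrt (cov_const * real (m - p * k)) \<le> \<tau> * sqrt (cov_const * \<rho>)"
  proof -
    have "\<bar>\<theta>\<bar> * sqrt (cov_const * real (m - p * k)) \<le> \<tau> / sqrt m * sqrt (cov_const * (m * \<rho>))"
      using th mk cov_const_pos tau unfolding \<rho>_def[symmetric]
      by (intro mult_mono real_sqrt_le_mono mult_left_mono) (auto intro!: divide_nonneg_nonneg)
    also have "\<dots> = \<tau> * sqrt (cov_const * \<rho>)" using m by (simp add: real_sqrt_mult)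
    finally show ?thesis .
  qed
  have a6: "\<theta>\<^sup>2 * (3 * cov_const * real (m - p * k)) \<le> 3 * \<tau>\<^sup>2 * cov_const * \<rho>"
  proof -
    have "\<theta>\<^sup>2 * (3 * cov_const * real (m - p * k)) \<le> \<tau>\<^sup>2 / m * (3 * cov_const * (m * \<rho>))"
      using th2 mk cov_const_pos unfolding \<rho>_def[symmetric] by (intro mult_mono mult_left_mono) auto
    also have "\<dots> = 3 * \<tau>\<^sup>2 * cov_const * \<rho>" using m by simp
    finally show ?thesis .
  qed
  have "real p * err \<theta> k n \<le> 16 * exp (16 * L * \<tau>) * decay_const * ((real m / k) / (real n + 1)\<^sup>2) +
     \<tau> ^ 3 * L * cov_const * (real k / sqrt m) + \<tau> ^ 4 * cov_const\<^sup>2 * (real k / m) + 32 * L\<^sup>2 * \<tau>\<^sup>2 * decay_tail n"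
    using a1 a2 a3 a4 unfolding err_def distrib_left by linarith
  then have "real p * err \<theta> k n + \<bar>\<theta>\<bar> * sqrt (cov_const * real (m - p * k)) + \<theta>\<^sup>2 * (3 * cov_const * real (m - p * k)) \<le> bnd \<tau> m"
    using a5 a6 unfolding bnd_def k_def[symmetric] n_def[symmetric] \<rho>_def[symmetric] by linarith
  then show ?thesis using cfun_main[OF g f pm, of \<theta>] by linarith
qed

text \<open>Linear growth makes \<theta> = t / sqrt(variance) at most \<tau> / sqrt m in modulus
  with \<tau> = |t| / sqrt c, while \<theta>^2 times the variance is exactly t^2.\<close>

lemma cfun_clt:
  assumes g: "adm g" and f: "dens f" and c: "0 < c" and v: "\<And>m. N \<le> m \<Longrightarrow> c * real m \<le> bvar g f {..<m}"
  shows "(\<lambda>m. cfun f (\<lambda>x. t / sqrt (bvar g f {..<m}) * bsum g f {..<m} x)) \<longlonglongrightarrow> exp (- (t\<^sup>2 / 2))"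
proof -
  define \<tau> where "\<tau> = \<bar>t\<bar> / sqrt c"
  have "\<forall>\<^sub>F m in sequentially. norm (cfun f (\<lambda>x. t / sqrt (bvar g f {..<m}) * bsum g f {..<m} x) - complex_of_real (exp (- (t\<^sup>2 / 2)))) \<le> bnd \<tau> m"
    using eventually_ge_at_top[of "Suc N"]
  proof eventually_elim
    case (elim m)
    define w where "w = bvar g f {..<m}"
    define \<theta> where "\<theta> = t / sqrt w"
    have m: "0 < m" using elim by simp
    have w: "c * m \<le> w" using v[of m] elim by (simp add: w_def)
    have w0: "0 < w" using m c w by (intro less_le_trans[OF _ w]) simp
    have "\<bar>\<theta>\<bar> \<le> \<bar>t\<bar> / sqrt (c * m)"
      unfolding \<theta>_def abs_divide using w w0 c m by (simp add: frac_le)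
    then have th: "\<bar>\<theta>\<bar> \<le> \<tau> / sqrt m" by (simp add: \<tau>_def real_sqrt_mult)
    have "\<theta>\<^sup>2 * w = t\<^sup>2" using w0 by (simp add: \<theta>_def power_divide)
    then show ?case
      using cfun_bnd[OF g f m th] c unfolding w_def[symmetric] \<theta>_def[symmetric] by (simp add: \<tau>_def)
  qed
  then have "(\<lambda>m. cfun f (\<lambda>x. t / sqrt (bvar g f {..<m}) * bsum g f {..<m} x) - complex_of_real (exp (- (t\<^sup>2 / 2)))) \<longlonglongrightarrow> 0"
    using bnd_tendsto[of \<tau>] by (rule Lim_null_comparison)
  then show ?thesis by (simp only: LIM_zero_iff)
qed

section \<open>Laws of the normalized sums and their weak limit\<close>

definition law :: "(nat \<Rightarrow> real) \<Rightarrow> (real \<Rightarrow> real) \<Rightarrow> nat \<Rightarrow> real measure" where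
  "law g f m = distr (density mu (\<lambda>x. ennreal (f x))) borel (\<lambda>x. bsum g f {..<m} x / sqrt (bvar g f {..<m}))"

lemma prob_space_density: "dens f \<Longrightarrow> prob_space (density mu (\<lambda>x. ennreal (f x)))"
proof (rule prob_spaceI)
  assume f: "dens f"
  have [measurable]: "f \<in> borel_measurable mu" using dens_integrable[OF f] by auto
  have "emeasure (density mu (\<lambda>x. ennreal (f x))) (space mu) = (\<integral>\<^sup>+x. ennreal (f x) \<partial>mu)"
    using sets.top[of mu] by (subst emeasure_density) (auto intro!: nn_integral_cong simp: indicator_def)
  also have "\<dots> = ennreal (integral\<^sup>L mu f)"
    using dens_integrable[OF f] dens_nonneg[OF f] by (intro nn_integral_eq_integral AE_mu) auto
  finally show "emeasure (density mu (\<lambda>x. ennreal (f x))) (space (density mu (\<lambda>x. ennreal (f x)))) = 1"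
    using dens_integral[OF f] by simp
qed

lemma law_measurable: "adm g \<Longrightarrow> (\<lambda>x. bsum g f {..<m} x / sqrt (bvar g f {..<m})) \<in> measurable (density mu (\<lambda>x. ennreal (f x))) borel"
  using bsum_measurable[of g f "{..<m}"] by simp

lemma real_distribution_law: "adm g \<Longrightarrow> dens f \<Longrightarrow> real_distribution (law g f m)"
  unfolding law_def using law_measurable[of g f m]
  by (intro real_distribution.intro prob_space.prob_space_distr prob_space_density) (auto simp: real_distribution_axioms_def)

lemma char_law:
  assumes g: "adm g" and f: "dens f"
  shows "char (law g f m) t = cfun f (\<lambda>x. t / sqrt (bvar g f {..<m}) * bsum g f {..<m} x)"
proof -
  have [measurable]: "f \<in> borel_measurable mu" using dens_integrable[OF f] by auto
  have m: "bsum g f {..<m} \<in> borel_measurable mu" by (rule bsum_measurable[OF g])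
  have "char (law g f m) t = (CLINT x|density mu (\<lambda>x. ennreal (f x)). iexp (t * (bsum g f {..<m} x / sqrt (bvar g f {..<m}))))"
    unfolding char_def law_def by (rule integral_distr[OF law_measurable[OF g]]) simp
  also have "\<dots> = (CLINT x|mu. f x *\<^sub>R iexp (t * (bsum g f {..<m} x / sqrt (bvar g f {..<m}))))"
    using m dens_nonneg[OF f] by (intro integral_density AE_mu) auto
  also have "\<dots> = cfun f (\<lambda>x. t / sqrt (bvar g f {..<m}) * bsum g f {..<m} x)"
    unfolding cfun_def by (simp add: scaleR_conv_of_real)
  finally show ?thesis .
qed

lemma clt_law:
  assumes g: "adm g" and f: "dens f" and c: "0 < c" and v: "\<And>m. N \<le> m \<Longrightarrow> c * real m \<le> bvar g f {..<m}"
  shows "(\<lambda>m. cdf (law g f m) a) \<longlonglongrightarrow> cdf std_normal_distribution a"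
proof -
  have "weak_conv_m (law g f) std_normal_distribution"
  proof (rule levy_continuity)
    show "real_distribution (law g f m)" for m by (rule real_distribution_law[OF g f])
    show "real_distribution std_normal_distribution" by (rule real_dist_normal_dist)
    show "(\<lambda>m. char (law g f m) t) \<longlonglongrightarrow> char std_normal_distribution t" for t
      unfolding char_law[OF g f] char_std_normal_distribution
      using cfun_clt[OF g f c v, of N t] by simp
  qed
  \<comment> \<open>Weak convergence gives convergence at continuity points of the limit; the normal
    law has no atoms.\<close>
  moreover have "isCont (cdf std_normal_distribution) a"
  proof -
    interpret s: real_distribution std_normal_distribution by (rule real_dist_normal_dist)
    have "emeasure std_normal_distribution {a} = 0"
      by (subst emeasure_density) (auto intro!: nn_integral_null_set simp: null_sets_def)
    then show ?thesis by (subst s.isCont_cdf) (simp add: measure_def)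
  qed
  ultimately show ?thesis by (simp add: weak_conv_m_def weak_conv_def)
qed

end

lemma cdf_std_normal: "cdf std_normal_distribution t = std_normal_cdf t"
proof -
  have "cdf std_normal_distribution t = (\<integral>x. indicator {..t} x \<partial>std_normal_distribution)"
    by (simp add: cdf_def)
  also have "\<dots> = (\<integral>x. std_normal_density x *\<^sub>R indicator {..t} x \<partial>lborel)"
    by (rule integral_density) auto
  also have "\<dots> = std_normal_cdf t"
    unfolding std_normal_cdf_def set_lebesgue_integral_def std_normal_density_def
    by (simp add: mult.commute)
  finally show ?thesis .
qed

section \<open>Martingale lower bound for the variance\<close>

lemma tr_ops_seq_cong: "(\<And>i. i < n \<Longrightarrow> g i = g' i) \<Longrightarrow> tr_ops g n f = tr_ops g' n f"
  by (induction n) auto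

lemma tr_ops_pos:
  assumes g: "adm g" and f: "\<And>x. 0 < x \<Longrightarrow> x \<le> 1 \<Longrightarrow> 0 < f x"
  shows "0 < y \<Longrightarrow> y \<le> 1 \<Longrightarrow> 0 < tr_ops g n f y"
proof (induction n arbitrary: y)
  case (Suc n)
  have "0 < tr_left (g n) (tr_ops g n f) y"
    unfolding tr_left_def using Suc.prems admD(1)[OF g]
    by (intro mult_pos_pos lweight_pos Suc.IH linv_pos linv_le_one) auto
  also have "\<dots> \<le> tr_op (g n) (tr_ops g n f) y"
    by (rule tr_left_le_tr_op[OF admD(1)[OF g]]) (use Suc in \<open>auto intro: less_imp_le\<close>)
  finally show ?case by simp
qed (use f in auto)

lemma tr_op_duality:
  assumes "0 < \<gamma>" "\<gamma> \<le> 1/9" "integrable mu f" "h \<in> borel_measurable mu" "\<And>x. 0 < x \<Longrightarrow> x \<le> 1 \<Longrightarrow> \<bar>h x\<bar> \<le> B"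
  shows "(\<integral>x. f x * h (LSV \<gamma> x) \<partial>mu) = (\<integral>y. tr_op \<gamma> f y * h y \<partial>mu)"
  using tr_ops_duality[of "\<lambda>_. \<gamma>" f h B 1] assms by (simp add: adm_def)

text \<open>The map is nonsingular: by duality the preimage of a null set N has as measure the
  integral of \<open>tr_op \<gamma> (\<lambda>_. 1)\<close> over N, which is 0.\<close>

lemma AE_LSV:
  assumes "0 < \<gamma>" "\<gamma> \<le> 1/9" "AE x in mu. Q x"
  shows "AE x in mu. Q (LSV \<gamma> x)"
proof -
  obtain N where N: "N \<in> null_sets mu" "{x\<in>space mu. \<not> Q x} \<subseteq> N"
    using assms(3) by (auto simp: eventually_ae_filter)
  have [measurable]: "N \<in> sets mu" using N by auto
  have m: "(\<lambda>x. indicator N x :: real) \<in> borel_measurable mu" by simp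
  have mT: "(\<lambda>x. indicator N (LSV \<gamma> x) :: real) \<in> borel_measurable mu"
    by (rule measurable_compose[OF LSV_measurable[OF assms(1)] m])
  have iT: "integrable mu (\<lambda>x. indicator N (LSV \<gamma> x) :: real)"
    by (rule mu.integrable_const_bound[where B = 1]) (use mT in auto)
  have "(\<integral>x. 1 * indicator N (LSV \<gamma> x) \<partial>mu) = (\<integral>y. tr_op \<gamma> (\<lambda>_. 1) y * indicator N y \<partial>mu)"
    by (rule tr_op_duality[OF assms(1,2) _ m, where B = 1]) (auto simp: indicator_def)
  also have "\<dots> = (\<integral>y. 0 \<partial>mu)"
    using AE_not_in[OF N(1)] assms(1) m by (intro integral_cong_AE) (auto simp: indicator_def)
  finally have "AE x in mu. (indicator N (LSV \<gamma> x) :: real) = 0"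
    using integral_nonneg_eq_0_iff_AE[OF iT] by simp
  then show ?thesis
  proof (rule AE_mp, intro AE_mu impI)
    fix x :: real assume x: "0 < x" "x \<le> 1" "(indicator N (LSV \<gamma> x) :: real) = 0"
    then have "LSV \<gamma> x \<notin> N" by (auto simp: indicator_def split: if_splits)
    then show "Q (LSV \<gamma> x)" using N(2) LSV_range[OF assms(1) x(1,2)] by auto
  qed
qed

text \<open>The L1 norms are dominated by a geometric series, so the sum of the |u m| has finite
  integral and is finite almost everywhere. With geometric rates no subsequence has to be
  extracted.\<close>

lemma AE_summable_fast:
  fixes u :: "nat \<Rightarrow> real \<Rightarrow> real"
  assumes i: "\<And>m. integrable mu (u m)" and b: "\<And>m. (\<integral>x. \<bar>u m x\<bar> \<partial>mu) \<le> B * (1/4) ^ m"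
  shows "AE x in mu. summable (\<lambda>m. \<bar>u m x\<bar>)"
proof -
  have "0 \<le> (\<integral>x. \<bar>u 0 x\<bar> \<partial>mu)" by simp
  also have "\<dots> \<le> B" using b[of 0] by simp
  finally have B: "0 \<le> B" .
  have m: "(\<lambda>x. ennreal \<bar>u k x\<bar>) \<in> borel_measurable mu" for k using i[of k] by auto
  have "(\<integral>\<^sup>+x. (\<Sum>m. ennreal \<bar>u m x\<bar>) \<partial>mu) = (\<Sum>m. \<integral>\<^sup>+x. ennreal \<bar>u m x\<bar> \<partial>mu)"
    by (rule nn_integral_suminf[OF m])
  also have "\<dots> = (\<Sum>m. ennreal (\<integral>x. \<bar>u m x\<bar> \<partial>mu))"
    using i by (intro suminf_cong nn_integral_eq_integral) auto
  also have "\<dots> \<le> (\<Sum>m. ennreal (B * (1/4) ^ m))"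
    using b by (intro suminf_le ennreal_leI) auto
  also have "\<dots> = ennreal (\<Sum>m. B * (1/4) ^ m)"
    using B by (intro suminf_ennreal2 summable_mult summable_geometric) auto
  finally have "(\<integral>\<^sup>+x. (\<Sum>m. ennreal \<bar>u m x\<bar>) \<partial>mu) \<noteq> \<infinity>"
    by (auto simp: top_unique)
  then have "AE x in mu. (\<Sum>m. ennreal \<bar>u m x\<bar>) \<noteq> \<infinity>"
    using m by (intro nn_integral_noteq_infinite borel_measurable_suminf) auto
  then show ?thesis
    by (rule AE_mp) (auto intro!: AE_I2 summable_suminf_not_top)
qed

lemma convergent_of_summable_diff:
  fixes a :: "nat \<Rightarrow> real"
  assumes "summable (\<lambda>m. \<bar>a m - a (Suc m)\<bar>)" shows "convergent a"
proof -
  have "summable (\<lambda>m. a m - a (Suc m))" using assms by (rule summable_rabs_cancel)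
  then have "convergent (\<lambda>n. \<Sum>m<n. a m - a (Suc m))" by (simp add: summable_iff_convergent)
  then have "convergent (\<lambda>n. a 0 - a n)" by (simp add: sum_lessThan_telescope')
  then have "convergent (\<lambda>n. a 0 - (a 0 - a n))" by (rule convergent_diff[OF convergent_const])
  moreover have "(\<lambda>n. a 0 - (a 0 - a n)) = a" by auto
  ultimately show ?thesis by (simp only:)
qed

section \<open>Correctors and reverse martingale differences\<close>

context obs
begin

text \<open>The corrector is corr, with numerator the density of S_n pushed forward by n steps; mdiff is a reverse martingale difference, and mvar its second moment.\<close>
definition corr_num :: "(nat \<Rightarrow> real) \<Rightarrow> (real \<Rightarrow> real) \<Rightarrow> nat \<Rightarrow> real \<Rightarrow> real" where
  "corr_num g f n = tr_ops g n (\<lambda>x. f x * bsum g f {..<n} x)"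

definition corr :: "(nat \<Rightarrow> real) \<Rightarrow> (real \<Rightarrow> real) \<Rightarrow> nat \<Rightarrow> real \<Rightarrow> real" where
  "corr g f n x = corr_num g f n x / tr_ops g n f x"

definition mdiff :: "(nat \<Rightarrow> real) \<Rightarrow> (real \<Rightarrow> real) \<Rightarrow> nat \<Rightarrow> real \<Rightarrow> real" where
  "mdiff g f n x = cphi g f n x + corr g f n x - corr g f (Suc n) (LSV (g n) x)"

definition mvar :: "(nat \<Rightarrow> real) \<Rightarrow> (real \<Rightarrow> real) \<Rightarrow> nat \<Rightarrow> real" where
  "mvar g f n = (\<integral>x. tr_ops g n f x * (mdiff g f n x)\<^sup>2 \<partial>mu)"

text \<open>Division by zero yields zero, so strict positivity is what guarantees that
  \<open>corr\<close> times the pushed density is \<open>corr_num\<close>.\<close>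

definition posd :: "(real \<Rightarrow> real) \<Rightarrow> bool" where
  "posd f \<longleftrightarrow> (\<forall>x. 0 < x \<longrightarrow> x \<le> 1 \<longrightarrow> 0 < f x)"

lemma integrable_bsum: "adm g \<Longrightarrow> dens f \<Longrightarrow> integrable mu (\<lambda>x. f x * bsum g f A x)"
  using integrable_bsum_pow(2)[of g f A 1] by simp

lemma integrable_corr_num: "adm g \<Longrightarrow> dens f \<Longrightarrow> integrable mu (corr_num g f n)"
  unfolding corr_num_def by (intro integrable_tr_ops integrable_bsum)

lemma corr_num_bound:
  assumes g: "adm g" and f: "dens f" and y: "0 < y" "y \<le> 1"
  shows "\<bar>corr_num g f n y\<bar> \<le> 2 * L * n * tr_ops g n f y"
proof -
  have "\<bar>corr_num g f n y\<bar> \<le> tr_ops g n (\<lambda>x. \<bar>f x * bsum g f {..<n} x\<bar>) y"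
    unfolding corr_num_def by (rule tr_ops_abs[OF g y])
  also have "\<dots> \<le> tr_ops g n (\<lambda>x. 2 * L * n * f x) y"
  proof (rule tr_ops_mono[OF g _ y])
    fix x :: real assume x: "0 < x" "x \<le> 1"
    show "\<bar>f x * bsum g f {..<n} x\<bar> \<le> 2 * L * n * f x"
      using mult_left_mono[OF bsum_bound[OF g f x, of "{..<n}"] dens_nonneg[OF f x]] dens_nonneg[OF f x]
      by (simp add: abs_mult mult_ac)
  qed
  also have "\<dots> = 2 * L * n * tr_ops g n f y" by (simp add: tr_ops_cmult)
  finally show ?thesis .
qed

text \<open>\<open>corr\<close> is the conditional expectation of the sum given the point at time n,
  a weighted average over preimages, so it inherits the crude bound 2 L n. The bound serves
  integrability.\<close>

lemma corr_bound:
  assumes g: "adm g" and f: "dens f" "posd f" and y: "0 < y" "y \<le> 1"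
  shows "\<bar>corr g f n y\<bar> \<le> 2 * L * n"
proof -
  have "0 < tr_ops g n f y" using tr_ops_pos[OF g _ y, of f n] f(2) by (auto simp: posd_def)
  then show ?thesis
    using corr_num_bound[OF g f(1) y, of n] by (simp add: corr_def abs_divide pos_divide_le_eq)
qed

lemma corr_mult: "adm g \<Longrightarrow> posd f \<Longrightarrow> 0 < y \<Longrightarrow> y \<le> 1 \<Longrightarrow> tr_ops g n f y * corr g f n y = corr_num g f n y"
  using tr_ops_pos[of g f y n] by (auto simp: corr_def posd_def)

lemma corr_measurable: "adm g \<Longrightarrow> dens f \<Longrightarrow> corr g f n \<in> borel_measurable mu"
  unfolding corr_def[abs_def] using integrable_corr_num[of g f n] dens_integrable[OF dens_tr_ops[of g f n]]
  by (intro borel_measurable_divide) auto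

text \<open>The new term of the sum is a function of the point at time n, so it comes out of
  \<open>tr_ops g n\<close> as a factor before the next operator acts.\<close>

lemma corr_num_Suc:
  assumes g: "adm g" and y: "0 < y" "y \<le> 1"
  shows "corr_num g f (Suc n) y = tr_op (g n) (\<lambda>x. corr_num g f n x + tr_ops g n f x * cphi g f n x) y"
  unfolding corr_num_def tr_ops.simps
proof (rule tr_op_cong[OF admD(1)[OF g] _ y])
  fix x :: real assume x: "0 < x" "x \<le> 1"
  have "(\<lambda>x. f x * bsum g f {..<Suc n} x) = (\<lambda>x. f x * bsum g f {..<n} x + f x * cphi g f n (orb g n x))"
    by (simp add: bsum_def cobs_def distrib_left fun_eq_iff)
  then show "tr_ops g n (\<lambda>x. f x * bsum g f {..<Suc n} x) x = tr_ops g n (\<lambda>x. f x * bsum g f {..<n} x) x + tr_ops g n f x * cphi g f n x"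
    using tr_ops_mult_comp[OF g x, of n f "cphi g f n"] by (simp add: tr_ops_add)
qed

text \<open>In the expanded square, the cross term with the next corrector and the square of the
  next corrector both reduce by duality to the integral of \<open>corr_num\<close> times
  \<open>corr\<close> at time n + 1, with coefficients -2 and 1. This is Pythagoras for the
  projection onto functions of the next point.\<close>

lemma mvar_eq:
  assumes g: "adm g" and f: "dens f" "posd f"
  shows "mvar g f n = (\<integral>x. tr_ops g n f x * (cphi g f n x)\<^sup>2 \<partial>mu) + 2 * (\<integral>x. corr_num g f n x * cphi g f n x \<partial>mu)
    + (\<integral>x. corr_num g f n x * corr g f n x \<partial>mu) - (\<integral>x. corr_num g f (Suc n) x * corr g f (Suc n) x \<partial>mu)"
proof -
  let ?F = "tr_ops g n f" and ?x = "cphi g f n" and ?h = "corr g f n" and ?k = "corr g f (Suc n)" and ?T = "LSV (g n)"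
  note gn = admD[OF g, of n]
  note mx = cphi_measurable[of g f n] and mh = corr_measurable[OF g f(1)]
  note bh = corr_bound[OF g f] and bx = cphi_bound[OF g f(1)]
  have iF: "integrable mu ?F" by (rule dens_integrable[OF dens_tr_ops[OF g f(1)]])
  note iG = integrable_corr_num[OF g f(1)]
  have mk: "(\<lambda>x. ?k (?T x)) \<in> borel_measurable mu"
    by (rule measurable_compose[OF LSV_measurable[OF gn(1)] mh])
  have bk: "\<bar>?k (?T x)\<bar> \<le> 2 * L * (Suc n)" if "0 < x" "x \<le> 1" for x
    using bh[of "?T x" "Suc n"] LSV_range[OF gn(1) that] by auto
  let ?A = "\<lambda>x. corr_num g f n x + ?F x * ?x x"
  have iFx: "integrable mu (\<lambda>x. ?F x * ?x x)" by (rule integrable_mult_bounded[OF iF mx bx])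
  have iA: "integrable mu ?A" using iG iFx by auto
  have iAk: "integrable mu (\<lambda>x. ?A x * ?k (?T x))" by (rule integrable_mult_bounded[OF iA mk bk])
  have IAk: "(\<integral>x. ?A x * ?k (?T x) \<partial>mu) = (\<integral>x. corr_num g f (Suc n) x * ?k x \<partial>mu)"
  proof -
    have "(\<integral>x. ?A x * ?k (?T x) \<partial>mu) = (\<integral>x. tr_op (g n) ?A x * ?k x \<partial>mu)"
      by (rule tr_op_duality[OF gn iA mh bh])
    also have "\<dots> = (\<integral>x. corr_num g f (Suc n) x * ?k x \<partial>mu)"
      by (rule Bochner_Integration.integral_cong) (use corr_num_Suc[OF g] in auto)
    finally show ?thesis .
  qed
  have bkk: "\<bar>(?k x)\<^sup>2\<bar> \<le> (2 * L * (Suc n))\<^sup>2" if "0 < x" "x \<le> 1" for x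
    unfolding power_abs using bh[OF that, of "Suc n"] by (intro power_mono) auto
  have bkk': "\<bar>(?k (?T x))\<^sup>2\<bar> \<le> (2 * L * (Suc n))\<^sup>2" if "0 < x" "x \<le> 1" for x
    unfolding power_abs using bk[OF that] by (intro power_mono) auto
  have iKK: "integrable mu (\<lambda>x. ?F x * (?k (?T x))\<^sup>2)"
    by (rule integrable_mult_bounded[OF iF _ bkk']) (use mk in simp)
  have IKK: "(\<integral>x. ?F x * (?k (?T x))\<^sup>2 \<partial>mu) = (\<integral>x. corr_num g f (Suc n) x * ?k x \<partial>mu)"
  proof -
    have "(\<integral>x. ?F x * (?k (?T x))\<^sup>2 \<partial>mu) = (\<integral>x. tr_op (g n) ?F x * (?k x)\<^sup>2 \<partial>mu)"
      by (rule tr_op_duality[OF gn iF _ bkk]) (use mh in simp)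
    also have "\<dots> = (\<integral>x. corr_num g f (Suc n) x * ?k x \<partial>mu)"
      by (rule Bochner_Integration.integral_cong)
         (use corr_mult[OF g f(2), of _ "Suc n"] in \<open>auto simp: power2_eq_square mult.assoc[symmetric]\<close>)
    finally show ?thesis .
  qed
  have ixx: "integrable mu (\<lambda>x. ?F x * (?x x)\<^sup>2)"
  proof (rule integrable_mult_bounded[OF iF])
    show "(\<lambda>x. (?x x)\<^sup>2) \<in> borel_measurable mu" using mx by simp
    show "\<bar>(?x x)\<^sup>2\<bar> \<le> (2 * L)\<^sup>2" if "0 < x" "x \<le> 1" for x
      unfolding power_abs using bx[OF that, of n] by (intro power_mono) auto
  qed
  have iGx: "integrable mu (\<lambda>x. corr_num g f n x * ?x x)" by (rule integrable_mult_bounded[OF iG mx bx])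
  have iGh: "integrable mu (\<lambda>x. corr_num g f n x * ?h x)" by (rule integrable_mult_bounded[OF iG mh bh])
  have "mvar g f n = (\<integral>x. (?F x * (?x x)\<^sup>2 + 2 * (corr_num g f n x * ?x x) + corr_num g f n x * ?h x)
     - 2 * (?A x * ?k (?T x)) + ?F x * (?k (?T x))\<^sup>2 \<partial>mu)"
    unfolding mvar_def
  proof (rule Bochner_Integration.integral_cong)
    fix x assume "x \<in> space mu"
    then have x: "0 < x" "x \<le> 1" by auto
    have G: "corr_num g f n x = ?F x * ?h x" using corr_mult[OF g f(2) x, of n] by simp
    show "?F x * (mdiff g f n x)\<^sup>2 = (?F x * (?x x)\<^sup>2 + 2 * (corr_num g f n x * ?x x) + corr_num g f n x * ?h x)
     - 2 * (?A x * ?k (?T x)) + ?F x * (?k (?T x))\<^sup>2"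
      unfolding mdiff_def G by (simp add: power2_eq_square algebra_simps)
  qed simp
  also have "\<dots> = ((\<integral>x. ?F x * (?x x)\<^sup>2 \<partial>mu) + 2 * (\<integral>x. corr_num g f n x * ?x x \<partial>mu) + (\<integral>x. corr_num g f n x * ?h x \<partial>mu))
     - 2 * (\<integral>x. ?A x * ?k (?T x) \<partial>mu) + (\<integral>x. ?F x * (?k (?T x))\<^sup>2 \<partial>mu)"
    using ixx iGx iGh iAk iKK by simp
  finally show ?thesis unfolding IAk IKK by simp
qed

lemma bvar_Suc:
  assumes g: "adm g" and f: "dens f"
  shows "bvar g f {..<Suc n} = bvar g f {..<n} + 2 * (\<integral>x. corr_num g f n x * cphi g f n x \<partial>mu) + (\<integral>x. tr_ops g n f x * (cphi g f n x)\<^sup>2 \<partial>mu)"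
proof -
  let ?S = "bsum g f {..<n}" and ?x = "cphi g f n"
  have e: "f x * (bsum g f {..<Suc n} x)\<^sup>2 = f x * (?S x)\<^sup>2 + 2 * ((f x * ?S x) * ?x (orb g n x)) + f x * (?x (orb g n x))\<^sup>2" for x
    by (simp add: bsum_def cobs_def power2_eq_square algebra_simps)
  note bx = cphi_bound[OF g f, of _ n]
  have mxx: "(\<lambda>x. (?x x)\<^sup>2) \<in> borel_measurable mu" by simp
  have bxx: "\<bar>(?x x)\<^sup>2\<bar> \<le> (2 * L)\<^sup>2" if "0 < x" "x \<le> 1" for x
    unfolding power_abs using bx[OF that] by (intro power_mono) auto
  have mT: "(\<lambda>x. h (orb g n x)) \<in> borel_measurable mu" if "h \<in> borel_measurable mu" for h :: "real \<Rightarrow> real"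
    by (rule measurable_compose[OF orb_measurable[OF g] that])
  have i2: "integrable mu (\<lambda>x. (f x * ?S x) * ?x (orb g n x))"
    by (rule integrable_mult_bounded[OF integrable_bsum[OF g f] mT[OF cphi_measurable], where B = "2 * L"])
       (use bx orb_range[OF g] in auto)
  have i3: "integrable mu (\<lambda>x. f x * (?x (orb g n x))\<^sup>2)"
    by (rule integrable_mult_bounded[OF dens_integrable[OF f] mT[OF mxx], where B = "(2 * L)\<^sup>2"])
       (use bxx orb_range[OF g] in auto)
  have "(\<integral>x. (f x * ?S x) * ?x (orb g n x) \<partial>mu) = (\<integral>x. corr_num g f n x * ?x x \<partial>mu)"
    unfolding corr_num_def by (rule tr_ops_duality[OF g integrable_bsum[OF g f] cphi_measurable bx])
  moreover have "(\<integral>x. f x * (?x (orb g n x))\<^sup>2 \<partial>mu) = (\<integral>x. tr_ops g n f x * (?x x)\<^sup>2 \<partial>mu)"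
    by (rule tr_ops_duality[OF g dens_integrable[OF f] mxx bxx])
  ultimately show ?thesis
    unfolding bvar_def e using integrable_bsum_pow(2)[OF g f, of "{..<n}" 2] i2 i3 by simp
qed

lemma mvar_nonneg: "adm g \<Longrightarrow> dens f \<Longrightarrow> 0 \<le> mvar g f n"
  unfolding mvar_def by (intro integral_nonneg_AE AE_mu) (simp add: dens_nonneg[OF dens_tr_ops])

text \<open>Combining \<open>bvar_Suc\<close> and \<open>mvar_eq\<close> telescopes: the variance is
  exactly the sum of the second moments plus the squared norm of the last corrector, which is
  dropped.\<close>

lemma bvar_ge_sum_mvar:
  assumes g: "adm g" and f: "dens f" "posd f"
  shows "(\<Sum>j<n. mvar g f j) \<le> bvar g f {..<n}"
proof -
  have "bvar g f {..<n} = (\<Sum>j<n. mvar g f j) + (\<integral>x. corr_num g f n x * corr g f n x \<partial>mu)"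
  proof (induction n)
    case 0
    show ?case by (simp add: bvar_def bsum_def corr_num_def)
  next
    case (Suc n)
    show ?case unfolding sum.lessThan_Suc bvar_Suc[OF g f(1)] Suc mvar_eq[OF g f] by simp
  qed
  moreover have "0 \<le> (\<integral>x. corr_num g f n x * corr g f n x \<partial>mu)"
  proof (intro integral_nonneg_AE AE_mu)
    fix x :: real assume x: "0 < x" "x \<le> 1"
    have "corr_num g f n x * corr g f n x = tr_ops g n f x * (corr g f n x)\<^sup>2"
      using corr_mult[OF g f(2) x, of n] by (simp add: power2_eq_square mult.assoc[symmetric])
    then show "0 \<le> corr_num g f n x * corr g f n x" using dens_nonneg[OF dens_tr_ops[OF g f(1)] x] by simp
  qed
  ultimately show ?thesis by simp
qed

text \<open>Terms are indexed by their age r, because in two systems with equal recent parameters it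
  is the contributions of equal age that can be compared.\<close>

lemma corr_num_sum:
  assumes g: "adm g" and f: "dens f" and y: "0 < y" "y \<le> 1"
  shows "corr_num g f j y = (\<Sum>r=1..j. tr_ops (shift_seq g (j - r)) r (\<lambda>x. tr_ops g (j - r) f x * cphi g f (j - r) x) y)"
proof -
  have "corr_num g f j y = (\<Sum>i<j. tr_ops g j (\<lambda>x. f x * cobs g f i x) y)"
    unfolding corr_num_def bsum_def by (simp add: sum_distrib_left tr_ops_sum)
  also have "\<dots> = (\<Sum>i<j. tr_ops (shift_seq g i) (j - i) (\<lambda>x. tr_ops g i f x * cphi g f i x) y)"
  proof (rule sum.cong[OF refl])
    fix i assume "i \<in> {..<j}"
    then have "tr_ops g j (\<lambda>x. f x * cobs g f i x) = tr_ops (shift_seq g i) (j - i) (tr_ops g i (\<lambda>x. f x * cobs g f i x))"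
      using tr_ops_shift[of g i "j - i"] by simp
    moreover have "tr_ops (shift_seq g i) (j - i) (tr_ops g i (\<lambda>x. f x * cobs g f i x)) y = tr_ops (shift_seq g i) (j - i) (\<lambda>x. tr_ops g i f x * cphi g f i x) y"
    proof (rule tr_ops_cong[OF adm_shift[OF g] _ y])
      fix x :: real assume x: "0 < x" "x \<le> 1"
      show "tr_ops g i (\<lambda>x. f x * cobs g f i x) x = tr_ops g i f x * cphi g f i x"
        unfolding cobs_def by (rule tr_ops_mult_comp[OF g x])
    qed
    ultimately show "tr_ops g j (\<lambda>x. f x * cobs g f i x) y = tr_ops (shift_seq g i) (j - i) (\<lambda>x. tr_ops g i f x * cphi g f i x) y"
      by (simp only:)
  qed
  also have "\<dots> = (\<Sum>r=1..j. tr_ops (shift_seq g (j - r)) (j - (j - r)) (\<lambda>x. tr_ops g (j - r) f x * cphi g f (j - r) x) y)"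
    by (rule sum.reindex_bij_witness[of _ "\<lambda>r. j - r" "\<lambda>i. j - i"]) auto
  also have "\<dots> = (\<Sum>r=1..j. tr_ops (shift_seq g (j - r)) r (\<lambda>x. tr_ops g (j - r) f x * cphi g f (j - r) x) y)"
    by (intro sum.cong) auto
  finally show ?thesis .
qed

text \<open>The parameters at indices j - K to j - 1 equal a. Index j itself is excluded, since the
  density and the corrector at time j depend only on earlier maps.\<close>

definition run :: "(nat \<Rightarrow> real) \<Rightarrow> nat \<Rightarrow> real \<Rightarrow> nat \<Rightarrow> bool" where
  "run g j a K \<longleftrightarrow> K \<le> j \<and> (\<forall>s<K. g (j - K + s) = a)"

lemma run_sub: "run g j a K \<Longrightarrow> r \<le> K \<Longrightarrow> run g (j - r) a (K - r)"
  unfolding run_def by (auto simp: diff_diff_left)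

lemma run_weaken: "run g j a K \<Longrightarrow> r \<le> K \<Longrightarrow> run g j a r"
proof -
  assume a: "run g j a K" "r \<le> K"
  have "g (j - r + s) = a" if "s < r" for s
  proof -
    have "j - r + s = j - K + (K - r + s)" using a by (auto simp: run_def)
    moreover have "K - r + s < K" using that a by simp
    ultimately show ?thesis using a by (auto simp: run_def)
  qed
  then show ?thesis using a by (auto simp: run_def)
qed

lemma tr_ops_run: "run g j a K \<Longrightarrow> tr_ops (shift_seq g (j - K)) K f = tr_ops (\<lambda>_. a) K f"
  by (rule tr_ops_seq_cong) (auto simp: run_def add.commute)

lemma run_tr_ops:
  assumes "run g j a K"
  shows "tr_ops g j f = tr_ops (\<lambda>_. a) K (tr_ops g (j - K) f)"
proof -
  have "j = (j - K) + K" using assms by (simp add: run_def)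
  then have "tr_ops g j f = tr_ops g ((j - K) + K) f" by (simp only:)
  also have "\<dots> = tr_ops (shift_seq g (j - K)) K (tr_ops g (j - K) f)" by (rule tr_ops_shift)
  also have "\<dots> = tr_ops (\<lambda>_. a) K (tr_ops g (j - K) f)" by (rule tr_ops_run[OF assms])
  finally show ?thesis .
qed

text \<open>Over the run both systems apply the same K operators to two densities of the class with
  equal mass, so loss of memory applies whatever came before.\<close>

lemma dens_cmp:
  assumes "adm g" "dens f" "run g j a K" "adm g'" "dens f'" "run g' j' a K" "adm (\<lambda>_. a)"
  shows "(\<integral>x. \<bar>tr_ops g j f x - tr_ops g' j' f' x\<bar> \<partial>mu) \<le> decay K"
  using loss_of_memory_decr_fn[OF assms(7) dens_decr_fn[OF dens_tr_ops[OF assms(1,2), of "j - K"]] dens_decr_fn[OF dens_tr_ops[OF assms(4,5), of "j' - K"]], of K]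
    dens_integral[OF dens_tr_ops[OF assms(1,2)]] dens_integral[OF dens_tr_ops[OF assms(4,5)]]
  by (simp add: tr_ops_diff run_tr_ops[OF assms(3), of f] run_tr_ops[OF assms(6), of f'])

lemma phi_mean_cmp:
  assumes "adm g" "dens f" "adm g'" "dens f'"
  shows "\<bar>phi_mean g f j - phi_mean g' f' j'\<bar> \<le> L * (\<integral>x. \<bar>tr_ops g j f x - tr_ops g' j' f' x\<bar> \<partial>mu)"
proof -
  have i: "integrable mu (tr_ops g j f)" "integrable mu (tr_ops g' j' f')"
    by (auto intro: dens_integrable dens_tr_ops assms)
  have "phi_mean g f j - phi_mean g' f' j' = (\<integral>x. (tr_ops g j f x - tr_ops g' j' f' x) * \<phi> x \<partial>mu)"
    unfolding phi_mean_def left_diff_distrib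
    by (rule Bochner_Integration.integral_diff[symmetric]) (intro integrable_mult_bounded[OF _ phi_measurable phi_bound] i; assumption)+
  then show ?thesis
    using abs_integral_mult_le[OF Bochner_Integration.integrable_diff[OF i] phi_measurable phi_bound] by simp
qed

text \<open>The first summand is for the K/2 most recent terms of the corrector, each differing by
  at most 3 L \<open>decay (K div 2)\<close>. The second is for the older terms, at most 8 L
  \<open>decay_tail (K div 2)\<close> in each system. The first tends to 0 because decay of order
  n^(-2) beats the factor n.\<close>

definition eG :: "nat \<Rightarrow> real" where
  "eG K = 3 * L * (K div 2) * decay (K div 2) + 16 * L * decay_tail (K div 2)"

lemma eG_tendsto: "eG \<longlonglongrightarrow> 0"
proof -
  have d: "filterlim (\<lambda>K::nat. K div 2) at_top sequentially"
    by (rule filterlim_at_top_div_const_nat) simp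
  have "(\<lambda>K. real K * decay K) \<longlonglongrightarrow> 0" unfolding decay_def by real_asymp
  then have "(\<lambda>K. real (K div 2) * decay (K div 2)) \<longlonglongrightarrow> 0" by (rule filterlim_compose[OF _ d])
  moreover have "(\<lambda>K. decay_tail (K div 2)) \<longlonglongrightarrow> 0" by (rule filterlim_compose[OF decay_tail_tendsto d])
  ultimately have "(\<lambda>K. 3 * L * (real (K div 2) * decay (K div 2)) + 16 * L * decay_tail (K div 2)) \<longlonglongrightarrow> 3 * L * 0 + 16 * L * 0"
    by (intro tendsto_intros)
  then show ?thesis by (simp add: eG_def[abs_def] mult.assoc)
qed

lemma corr_num_cmp:
  assumes g: "adm g" and f: "dens f" and r: "run g j a K" and g': "adm g'" and f': "dens f'" and r': "run g' j' a K"
    and a: "adm (\<lambda>_. a)"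
  shows "(\<integral>x. \<bar>corr_num g f j x - corr_num g' f' j' x\<bar> \<partial>mu) \<le> eG K"
proof -
  define h where "h = K div 2"
  define U where "U = (\<lambda>g f j r. tr_ops (shift_seq g (j - r)) r (\<lambda>x. tr_ops g (j - r) f x * cphi g f (j - r) x) :: real \<Rightarrow> real)"
  have iU: "integrable mu (U g f j r)" if "adm g" "dens f" for g f j r
    unfolding U_def by (intro integrable_tr_ops adm_shift that decr_diff_integrable[OF cphi_decr_diff[OF that]])
  have nU: "(\<integral>x. \<bar>U g f j r x\<bar> \<partial>mu) \<le> 8 * L * decay r" if "adm g" "dens f" for g f j r
    unfolding U_def by (rule loss_of_memory[OF adm_shift[OF that(1)] cphi_decr_diff[OF that] cphi_mean[OF that]])
  have hK: "h \<le> K" "K \<le> j" "K \<le> j'" using r r' by (auto simp: h_def run_def)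
  have split: "corr_num g f j x = (\<Sum>r=1..h. U g f j r x) + (\<Sum>r=Suc h..j. U g f j r x)"
    if "adm g" "dens f" "h \<le> j" "0 < x" "x \<le> 1" for g f j x
  proof -
    have "{1..j} = {1..h} \<union> {Suc h..j}" using that(3) by auto
    then have "(\<Sum>r=1..j. U g f j r x) = (\<Sum>r\<in>{1..h} \<union> {Suc h..j}. U g f j r x)" by (simp only:)
    also have "\<dots> = (\<Sum>r=1..h. U g f j r x) + (\<Sum>r=Suc h..j. U g f j r x)"
      by (rule sum.union_disjoint) auto
    finally show ?thesis unfolding corr_num_sum[OF that(1,2,4,5)] U_def .
  qed
  have tailb: "(\<Sum>r=Suc h..j. \<integral>x. \<bar>U g f j r x\<bar> \<partial>mu) \<le> 8 * L * decay_tail h" if "adm g" "dens f" for g f j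
  proof -
    have "(\<Sum>r=Suc h..j. \<integral>x. \<bar>U g f j r x\<bar> \<partial>mu) \<le> (\<Sum>r=Suc h..j. 8 * L * decay (r - 0))"
      using nU[OF that] by (intro sum_mono) auto
    also have "\<dots> \<le> 8 * L * decay_tail h"
      unfolding sum_distrib_left[symmetric] using L_pos by (intro mult_left_mono sum_decay_tail) auto
    finally show ?thesis .
  qed
  \<comment> \<open>For age r \<le> K/2 a run of length K - r \<ge> K/2 still precedes time j - r,
    so the densities there are close; the r remaining steps use the same operators and contract
    L1.\<close>
  have head: "(\<integral>x. \<bar>U g f j r x - U g' f' j' r x\<bar> \<partial>mu) \<le> 3 * L * decay h" if rr: "r \<in> {1..h}" for r
  proof -
    have rK: "r \<le> K" using rr hK by auto
    let ?F = "tr_ops g (j - r) f" and ?F' = "tr_ops g' (j' - r) f'"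
    let ?u = "\<lambda>x. ?F x * cphi g f (j - r) x" and ?u' = "\<lambda>x. ?F' x * cphi g' f' (j' - r) x"
    have iu: "integrable mu ?u" "integrable mu ?u'" by (auto intro: decr_diff_integrable cphi_decr_diff g f g' f')
    have iF: "integrable mu ?F" "integrable mu ?F'" by (auto intro: dens_integrable dens_tr_ops g f g' f')
    define \<delta> where "\<delta> = (\<integral>x. \<bar>?F x - ?F' x\<bar> \<partial>mu)"
    have "\<delta> \<le> decay (K - r)"
      unfolding \<delta>_def by (rule dens_cmp[OF g f run_sub[OF r rK] g' f' run_sub[OF r' rK] a])
    also have "\<dots> \<le> decay h" using rr by (intro decay_antimono) (auto simp: h_def)
    finally have de: "\<delta> \<le> decay h" .
    have "U g f j r x - U g' f' j' r x = tr_ops (\<lambda>_. a) r (\<lambda>x. ?u x - ?u' x) x" for x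
      unfolding U_def tr_ops_diff using tr_ops_run[OF run_weaken[OF r rK]] tr_ops_run[OF run_weaken[OF r' rK]] by simp
    then have "(\<integral>x. \<bar>U g f j r x - U g' f' j' r x\<bar> \<partial>mu) = (\<integral>x. \<bar>tr_ops (\<lambda>_. a) r (\<lambda>x. ?u x - ?u' x) x\<bar> \<partial>mu)" by simp
    also have "\<dots> \<le> (\<integral>x. \<bar>?u x - ?u' x\<bar> \<partial>mu)" using iu by (intro tr_ops_L1 a) auto
    also have "\<dots> \<le> (\<integral>x. 2 * L * \<bar>?F x - ?F' x\<bar> + L * \<delta> * ?F' x \<partial>mu)"
    proof (rule integral_mono)
      show "integrable mu (\<lambda>x. \<bar>?u x - ?u' x\<bar>)" using iu by auto
      show "integrable mu (\<lambda>x. 2 * L * \<bar>?F x - ?F' x\<bar> + L * \<delta> * ?F' x)" using iF by auto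
      fix x assume "x \<in> space mu"
      then have x: "0 < x" "x \<le> 1" by auto
      have F': "0 \<le> ?F' x" by (rule dens_nonneg[OF dens_tr_ops[OF g' f'] x])
      \<comment> \<open>The densities and the centring constants both differ; after integration they
        contribute 2 L \<delta> and L \<delta>.\<close>
      have eq: "?u x - ?u' x = (?F x - ?F' x) * cphi g f (j - r) x + ?F' x * (phi_mean g' f' (j' - r) - phi_mean g f (j - r))"
        by (simp add: cphi_def algebra_simps)
      have "\<bar>?u x - ?u' x\<bar> \<le> \<bar>?F x - ?F' x\<bar> * \<bar>cphi g f (j - r) x\<bar> + ?F' x * \<bar>phi_mean g' f' (j' - r) - phi_mean g f (j - r)\<bar>"
        unfolding eq using F' by (intro order_trans[OF abs_triangle_ineq]) (simp add: abs_mult)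
      also have "\<dots> \<le> \<bar>?F x - ?F' x\<bar> * (2 * L) + ?F' x * (L * \<delta>)"
      proof (intro add_mono mult_left_mono F' abs_ge_zero)
        show "\<bar>cphi g f (j - r) x\<bar> \<le> 2 * L" by (rule cphi_bound[OF g f x])
        show "\<bar>phi_mean g' f' (j' - r) - phi_mean g f (j - r)\<bar> \<le> L * \<delta>"
          unfolding \<delta>_def abs_minus_commute[of "phi_mean g' f' (j' - r)"] by (rule phi_mean_cmp[OF g f g' f'])
      qed
      finally show "\<bar>?u x - ?u' x\<bar> \<le> 2 * L * \<bar>?F x - ?F' x\<bar> + L * \<delta> * ?F' x" by (simp add: mult_ac)
    qed
    also have "\<dots> = 3 * L * \<delta>"
      using iF dens_integral[OF dens_tr_ops[OF g' f']] by (simp add: \<delta>_def)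
    also have "\<dots> \<le> 3 * L * decay h" using de L_pos by (intro mult_left_mono) auto
    finally show ?thesis .
  qed
  have "(\<integral>x. \<bar>corr_num g f j x - corr_num g' f' j' x\<bar> \<partial>mu) \<le>
     (\<integral>x. (\<Sum>r=1..h. \<bar>U g f j r x - U g' f' j' r x\<bar>) + ((\<Sum>r=Suc h..j. \<bar>U g f j r x\<bar>) + (\<Sum>r=Suc h..j'. \<bar>U g' f' j' r x\<bar>)) \<partial>mu)"
  proof (rule integral_mono)
    show "integrable mu (\<lambda>x. \<bar>corr_num g f j x - corr_num g' f' j' x\<bar>)" using integrable_corr_num g f g' f' by auto
    show "integrable mu (\<lambda>x. (\<Sum>r=1..h. \<bar>U g f j r x - U g' f' j' r x\<bar>) + ((\<Sum>r=Suc h..j. \<bar>U g f j r x\<bar>) + (\<Sum>r=Suc h..j'. \<bar>U g' f' j' r x\<bar>)))"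
      using iU g f g' f' by (intro Bochner_Integration.integrable_add Bochner_Integration.integrable_sum integrable_abs Bochner_Integration.integrable_diff) auto
    fix x assume "x \<in> space mu"
    then have x: "0 < x" "x \<le> 1" by auto
    have "corr_num g f j x - corr_num g' f' j' x = (\<Sum>r=1..h. U g f j r x - U g' f' j' r x) + ((\<Sum>r=Suc h..j. U g f j r x) - (\<Sum>r=Suc h..j'. U g' f' j' r x))"
      using split[OF g f _ x, of j] split[OF g' f' _ x, of j'] hK by (simp add: sum_subtractf)
    then show "\<bar>corr_num g f j x - corr_num g' f' j' x\<bar> \<le> (\<Sum>r=1..h. \<bar>U g f j r x - U g' f' j' r x\<bar>) + ((\<Sum>r=Suc h..j. \<bar>U g f j r x\<bar>) + (\<Sum>r=Suc h..j'. \<bar>U g' f' j' r x\<bar>))"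
      using sum_abs[of "\<lambda>r. U g f j r x - U g' f' j' r x" "{1..h}"] sum_abs[of "\<lambda>r. U g f j r x" "{Suc h..j}"]
        sum_abs[of "\<lambda>r. U g' f' j' r x" "{Suc h..j'}"] by linarith
  qed
  also have "\<dots> = (\<Sum>r=1..h. \<integral>x. \<bar>U g f j r x - U g' f' j' r x\<bar> \<partial>mu)
      + ((\<Sum>r=Suc h..j. \<integral>x. \<bar>U g f j r x\<bar> \<partial>mu) + (\<Sum>r=Suc h..j'. \<integral>x. \<bar>U g' f' j' r x\<bar> \<partial>mu))"
    using iU[OF g f] iU[OF g' f'] by simp
  also have "\<dots> \<le> (\<Sum>r=1..h. 3 * L * decay h) + (8 * L * decay_tail h + 8 * L * decay_tail h)"
    by (intro add_mono sum_mono head tailb g f g' f')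
  also have "\<dots> = eG K" by (simp add: eG_def h_def)
  finally show ?thesis .
qed

text \<open>Otherwise there are systems with ever longer runs of a and second moments tending to 0 geometrically. Their densities and correctors then converge almost everywhere, and the limit of the vanishing martingale differences is the coboundary equation.\<close>
lemma mvar_pos:
  assumes a: "0 < a" "a \<le> 1/9"
    and nc: "\<not> (\<exists>u c. u \<in> borel_measurable mu \<and> (AE x in mu. \<phi> x = c + u (LSV a x) - u x))"
  shows "\<exists>K c. 0 < c \<and> (\<forall>g f j. adm g \<longrightarrow> dens f \<longrightarrow> posd f \<longrightarrow> run g j a K \<longrightarrow> g j = a \<longrightarrow> c \<le> mvar g f j)"
proof (rule ccontr)
  assume "\<not> ?thesis"
  then have neg: "\<exists>g f j. adm g \<and> dens f \<and> posd f \<and> run g j a K \<and> g j = a \<and> mvar g f j < c" if "0 < c" for K c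
    using that by (meson not_le)
  have aa: "adm (\<lambda>_. a)" using a by (simp add: adm_def)
  have "(\<lambda>K. decay K + eG K) \<longlonglongrightarrow> 0 + 0"
    by (intro tendsto_add eG_tendsto summable_LIMSEQ_zero decay_summable)
  then have ev: "\<exists>N. \<forall>K\<ge>N. decay K + eG K < (1/4) ^ m" for m :: nat
    using order_tendstoD(2)[of "\<lambda>K. decay K + eG K" "0 + 0" sequentially "(1/4) ^ m"] by (simp add: eventually_sequentially)
  then obtain N where N: "\<And>m K. N m \<le> K \<Longrightarrow> decay K + eG K < (1/4) ^ m" by metis
  \<comment> \<open>The 32 makes the lower bound \<open>dens_low\<close> available at time
    \<open>j m\<close>; summing the N i makes the lengths nondecreasing, so that consecutive systems
    share a run of length \<open>Km m\<close>.\<close>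
  define Km where "Km = (\<lambda>m. 32 + (\<Sum>i\<le>m. N i))"
  have KmN: "N m \<le> Km m" for m unfolding Km_def using member_le_sum[of m "{..m}" N] by simp
  have KmS: "Km m \<le> Km (Suc m)" "32 \<le> Km m" for m by (auto simp: Km_def)
  have eps: "decay (Km m) \<le> (1/4) ^ m" "eG (Km m) \<le> (1/4) ^ m" for m
  proof -
    have "0 \<le> eG (Km m)" unfolding eG_def using L_pos decay_pos decay_tail_nonneg by (intro add_nonneg_nonneg mult_nonneg_nonneg) (auto simp: less_imp_le)
    then show "decay (Km m) \<le> (1/4) ^ m" "eG (Km m) \<le> (1/4) ^ m"
      using N[OF KmN, of m] decay_pos[of "Km m"] by auto
  qed
  have "\<forall>m. \<exists>g f j. adm g \<and> dens f \<and> posd f \<and> run g j a (Km m) \<and> g j = a \<and> mvar g f j < (1/4) ^ m"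
    using neg by simp
  then obtain g f j where gfj: "\<And>m. adm (g m)" "\<And>m. dens (f m)" "\<And>m. posd (f m)" "\<And>m. run (g m) (j m) a (Km m)"
      "\<And>m. g m (j m) = a" "\<And>m. mvar (g m) (f m) (j m) < (1/4) ^ m"
    by metis
  \<comment> \<open>The parameter at \<open>j m\<close> is also a, so a run of length
    \<open>Km m\<close> ends at the next time too. Hence densities and correctors at both times have
    the same limits.\<close>
  have run_Suc: "run (g m) (Suc (j m)) a (Km m)" for m
    unfolding run_def
  proof (intro conjI allI impI)
    show "Km m \<le> Suc (j m)" using gfj(4)[of m] by (simp add: run_def)
    fix s assume s: "s < Km m"
    have K: "Km m \<le> j m" using gfj(4)[of m] by (simp add: run_def)
    show "g m (Suc (j m) - Km m + s) = a"
    proof (cases "Suc s < Km m")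
      case True
      then show ?thesis using gfj(4)[of m] K by (auto simp: run_def Suc_diff_le dest: spec[of _ "Suc s"])
    next
      case False
      then have "Suc (j m) - Km m + s = j m" using s K by simp
      then show ?thesis using gfj(5) by simp
    qed
  qed
  have run_next: "run (g (Suc m)) (j (Suc m)) a (Km m)" for m
    by (rule run_weaken[OF gfj(4) KmS(1)])
  define F F' A A' where "F = (\<lambda>m. tr_ops (g m) (j m) (f m))" and "F' = (\<lambda>m. tr_ops (g m) (Suc (j m)) (f m))"
    and "A = (\<lambda>m. corr_num (g m) (f m) (j m))" and "A' = (\<lambda>m. corr_num (g m) (f m) (Suc (j m)))"
  define c where "c = (\<lambda>m. phi_mean (g m) (f m) (j m))"
  define \<psi> where "\<psi> = (\<lambda>m. mdiff (g m) (f m) (j m))"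
  have dF: "dens (F m)" "dens (F' m)" for m unfolding F_def F'_def by (rule dens_tr_ops[OF gfj(1,2)])+
  have iA: "integrable mu (A m)" "integrable mu (A' m)" for m unfolding A_def A'_def by (rule integrable_corr_num[OF gfj(1,2)])+
  have iF: "integrable mu (F m)" "integrable mu (F' m)" for m by (rule dens_integrable[OF dF(1)] dens_integrable[OF dF(2)])+
  have Fc: "dens_low \<le> F m x" "dens_low \<le> F' m x" if "0 < x" "x \<le> 1" for m x
  proof -
    have "32 \<le> j m" using KmS(2)[of m] gfj(4)[of m] by (simp add: run_def)
    then show "dens_low \<le> F m x" "dens_low \<le> F' m x"
      unfolding F_def F'_def by (auto intro!: tr_ops_ge_dens_low gfj dens_decr_fn dens_integral that simp del: tr_ops.simps)
  qed
  have FF: "(\<integral>x. \<bar>F m x - F (Suc m) x\<bar> \<partial>mu) \<le> (1/4) ^ m" for m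
    unfolding F_def by (rule order_trans[OF dens_cmp[OF gfj(1,2,4) gfj(1,2) run_next aa] eps(1)])
  have FF': "(\<integral>x. \<bar>F m x - F' m x\<bar> \<partial>mu) \<le> (1/4) ^ m" for m
    unfolding F_def F'_def by (rule order_trans[OF dens_cmp[OF gfj(1,2,4) gfj(1,2) run_Suc aa] eps(1)])
  have AA: "(\<integral>x. \<bar>A m x - A (Suc m) x\<bar> \<partial>mu) \<le> (1/4) ^ m" for m
    unfolding A_def by (rule order_trans[OF corr_num_cmp[OF gfj(1,2,4) gfj(1,2) run_next aa] eps(2)])
  have AA': "(\<integral>x. \<bar>A m x - A' m x\<bar> \<partial>mu) \<le> (1/4) ^ m" for m
    unfolding A_def A'_def by (rule order_trans[OF corr_num_cmp[OF gfj(1,2,4) gfj(1,2) run_Suc aa] eps(2)])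
  have cc: "\<bar>c m - c (Suc m)\<bar> \<le> L * (1/4) ^ m" for m
  proof -
    have "\<bar>c m - c (Suc m)\<bar> \<le> L * (\<integral>x. \<bar>F m x - F (Suc m) x\<bar> \<partial>mu)"
      unfolding c_def F_def by (rule phi_mean_cmp[OF gfj(1,2) gfj(1,2)])
    also have "\<dots> \<le> L * (1/4) ^ m" using FF L_pos by (intro mult_left_mono) auto
    finally show ?thesis .
  qed
  have "summable (\<lambda>m. \<bar>c m - c (Suc m)\<bar>)"
  proof (rule summable_comparison_test'[of "\<lambda>m. L * (1/4) ^ m" 0])
    show "summable (\<lambda>m. L * (1/4) ^ m :: real)" by (intro summable_mult summable_geometric) simp
  qed (use cc in auto)
  then have "convergent c" by (rule convergent_of_summable_diff)
  then obtain cl where cl: "c \<longlonglongrightarrow> cl" by (auto simp: convergent_def)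
  have mpsi: "\<psi> m \<in> borel_measurable mu" for m
    unfolding \<psi>_def mdiff_def[abs_def] using gfj(1,2)[of m] corr_measurable admD(1)[OF gfj(1)]
    by (intro borel_measurable_diff borel_measurable_add cphi_measurable corr_measurable
        measurable_compose[OF LSV_measurable corr_measurable]) auto
  have bpsi: "\<bar>\<psi> m x\<bar> \<le> 2 * L + 2 * L * j m + 2 * L * (Suc (j m))" if x: "0 < x" "x \<le> 1" for m x
  proof -
    have "\<bar>\<psi> m x\<bar> \<le> \<bar>cphi (g m) (f m) (j m) x\<bar> + \<bar>corr (g m) (f m) (j m) x\<bar> + \<bar>corr (g m) (f m) (Suc (j m)) (LSV (g m (j m)) x)\<bar>"
      unfolding \<psi>_def mdiff_def by linarith
    also have "\<dots> \<le> 2 * L + 2 * L * j m + 2 * L * (Suc (j m))"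
      using LSV_range[OF admD(1)[OF gfj(1)] x]
      by (intro add_mono cphi_bound corr_bound gfj x) auto
    finally show ?thesis .
  qed
  have ipsi2: "integrable mu (\<lambda>x. (\<psi> m x)\<^sup>2)" "integrable mu (\<lambda>x. F m x * (\<psi> m x)\<^sup>2)" for m
  proof -
    have m2: "(\<lambda>x. (\<psi> m x)\<^sup>2) \<in> borel_measurable mu" using mpsi by simp
    have b2: "\<bar>(\<psi> m x)\<^sup>2\<bar> \<le> (2 * L + 2 * L * j m + 2 * L * (Suc (j m)))\<^sup>2" if "0 < x" "x \<le> 1" for x
      unfolding power_abs using bpsi[OF that, of m] by (intro power_mono) auto
    show "integrable mu (\<lambda>x. F m x * (\<psi> m x)\<^sup>2)" by (rule integrable_mult_bounded[OF iF(1) m2 b2])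
    have "integrable mu (\<lambda>x. 1 * (\<psi> m x)\<^sup>2)" by (rule integrable_mult_bounded[OF _ m2 b2]) simp
    then show "integrable mu (\<lambda>x. (\<psi> m x)\<^sup>2)" by simp
  qed
  \<comment> \<open>The lower bound \<open>dens_low\<close> turns the weighted second moment into
    one for Lebesgue measure.\<close>
  have psi2: "(\<integral>x. \<bar>(\<psi> m x)\<^sup>2\<bar> \<partial>mu) \<le> 1 / dens_low * (1/4) ^ m" for m
  proof -
    have "dens_low * (\<integral>x. (\<psi> m x)\<^sup>2 \<partial>mu) = (\<integral>x. dens_low * (\<psi> m x)\<^sup>2 \<partial>mu)" by simp
    also have "\<dots> \<le> (\<integral>x. F m x * (\<psi> m x)\<^sup>2 \<partial>mu)"
      using ipsi2 Fc by (intro integral_mono mult_right_mono) auto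
    also have "\<dots> = mvar (g m) (f m) (j m)" by (simp add: mvar_def F_def \<psi>_def)
    also have "\<dots> \<le> (1/4) ^ m" using gfj(6)[of m] by simp
    finally show ?thesis using dens_low_pos by (simp add: field_simps)
  qed
  have ae1: "AE x in mu. summable (\<lambda>m. \<bar>F m x - F (Suc m) x\<bar>)"
    by (rule AE_summable_fast[where B = 1]) (use iF FF in auto)
  have ae2: "AE x in mu. summable (\<lambda>m. \<bar>F m x - F' m x\<bar>)"
    by (rule AE_summable_fast[where B = 1]) (use iF FF' in auto)
  have ae3: "AE x in mu. summable (\<lambda>m. \<bar>A m x - A (Suc m) x\<bar>)"
    by (rule AE_summable_fast[where B = 1]) (use iA AA in auto)
  have ae4: "AE x in mu. summable (\<lambda>m. \<bar>A m x - A' m x\<bar>)"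
    by (rule AE_summable_fast[where B = 1]) (use iA AA' in auto)
  have ae5: "AE x in mu. summable (\<lambda>m. \<bar>(\<psi> m x)\<^sup>2\<bar>)"
    by (rule AE_summable_fast[OF ipsi2(1) psi2])
  define u where "u = (\<lambda>x. lim (\<lambda>m. A m x / F m x))"
  have mu_u: "u \<in> borel_measurable mu"
    unfolding u_def
  proof (rule borel_measurable_lim_metric)
    show "(\<lambda>x. A m x / F m x) \<in> borel_measurable mu" for m using iA(1)[of m] iF(1)[of m] by auto
  qed
  have lims: "AE x in mu. 0 < x \<and> x \<le> 1 \<and> (\<lambda>m. A m x / F m x) \<longlonglongrightarrow> u x \<and> (\<lambda>m. A' m x / F' m x) \<longlonglongrightarrow> u x"
    using ae1 ae2 ae3 ae4 AE_space
  proof eventually_elim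
    case (elim x)
    then have x: "0 < x" "x \<le> 1" by auto
    obtain \<rho> where rho: "(\<lambda>m. F m x) \<longlonglongrightarrow> \<rho>" using convergent_of_summable_diff[OF elim(1)] by (auto simp: convergent_def)
    obtain \<alpha> where al: "(\<lambda>m. A m x) \<longlonglongrightarrow> \<alpha>" using convergent_of_summable_diff[OF elim(3)] by (auto simp: convergent_def)
    have "dens_low \<le> \<rho>" by (rule LIMSEQ_le_const[OF rho]) (use Fc x in auto)
    then have r0: "\<rho> \<noteq> 0" using dens_low_pos by auto
    have "(\<lambda>m. F m x - F' m x) \<longlonglongrightarrow> 0" using summable_LIMSEQ_zero[OF elim(2)] by (rule tendsto_rabs_zero_cancel)
    from tendsto_diff[OF rho this] have rho': "(\<lambda>m. F' m x) \<longlonglongrightarrow> \<rho>" by simp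
    have "(\<lambda>m. A m x - A' m x) \<longlonglongrightarrow> 0" using summable_LIMSEQ_zero[OF elim(4)] by (rule tendsto_rabs_zero_cancel)
    from tendsto_diff[OF al this] have al': "(\<lambda>m. A' m x) \<longlonglongrightarrow> \<alpha>" by simp
    have 1: "(\<lambda>m. A m x / F m x) \<longlonglongrightarrow> \<alpha> / \<rho>" by (rule tendsto_divide[OF al rho r0])
    have 2: "(\<lambda>m. A' m x / F' m x) \<longlonglongrightarrow> \<alpha> / \<rho>" by (rule tendsto_divide[OF al' rho' r0])
    have "u x = \<alpha> / \<rho>" unfolding u_def by (rule limI[OF 1])
    then show ?case using 1 2 x by simp
  qed
  \<comment> \<open>\<open>mdiff\<close> evaluates the next corrector at the image point, so the
    limits are needed at \<open>LSV a x\<close> as well; \<open>AE_LSV\<close> provides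
    them.\<close>
  have "AE x in mu. \<phi> x = cl + u (LSV a x) - u x"
    using lims AE_LSV[OF a lims] ae5
  proof eventually_elim
    case (elim x)
    have "(\<lambda>m. (\<psi> m x)\<^sup>2) \<longlonglongrightarrow> 0" using summable_LIMSEQ_zero[OF elim(3)] by simp
    from tendsto_real_sqrt[OF this] have "(\<lambda>m. \<bar>\<psi> m x\<bar>) \<longlonglongrightarrow> 0" by simp
    then have p0: "(\<lambda>m. \<psi> m x) \<longlonglongrightarrow> 0" by (rule tendsto_rabs_zero_cancel)
    have "(\<lambda>m. \<phi> x - c m + A m x / F m x - A' m (LSV a x) / F' m (LSV a x)) \<longlonglongrightarrow> \<phi> x - cl + u x - u (LSV a x)"
      using elim(1,2) by (intro tendsto_intros cl) auto
    moreover have "(\<lambda>m. \<phi> x - c m + A m x / F m x - A' m (LSV a x) / F' m (LSV a x)) = (\<lambda>m. \<psi> m x)"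
      unfolding \<psi>_def mdiff_def cphi_def corr_def c_def A_def F_def A'_def F'_def gfj(5) by simp
    ultimately have "(\<lambda>m. \<psi> m x) \<longlonglongrightarrow> \<phi> x - cl + u x - u (LSV a x)" by (simp only:)
    from LIMSEQ_unique[OF this p0] show ?case by simp
  qed
  then show False using nc mu_u by blast
qed

end

section \<open>Random sequences of maps\<close>

text \<open>Disjoint blocks of length k give independent events of probability r = p i ^ k, so the
  frequency drops to r / 2 only with probability at most exp(-r^2 Q / 2), which is summable. The
  offset b allows skipping initial symbols.\<close>

lemma nu_block_frequency:
  fixes l :: nat and p :: "nat \<Rightarrow> real"
  assumes ppos: "\<forall>i\<in>{1..l}. p i > 0" and psum: "(\<Sum>i=1..l. p i) = 1" and i: "i \<in> {1..l}"
  shows "AE \<omega> in nu l p. \<forall>\<^sub>F Q in sequentially.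
     p i ^ k * Q / 2 \<le> real (card {q\<in>{..<Q}. \<forall>s<k. \<omega> (b + q * k + s) = i})"
proof -
  define M where "M = point_measure {1..l} (\<lambda>i. ennreal (p i))"
  have sM: "sets M = Pow {1..l}" "space M = {1..l}" by (auto simp: M_def sets_point_measure space_point_measure)
  have eM: "emeasure M {i} = ennreal (p i)" unfolding M_def using i by (subst emeasure_point_measure_finite) auto
  have "emeasure M (space M) = (\<Sum>i\<in>{1..l}. ennreal (p i))"
    unfolding sM unfolding M_def by (rule emeasure_point_measure_finite) auto
  also have "\<dots> = ennreal 1" using ppos psum by (subst sum_ennreal) (auto intro: less_imp_le)
  finally have pM: "prob_space M" by (intro prob_spaceI) simp
  interpret M: prob_space M by (rule pM)
  interpret product_prob_space "\<lambda>_::nat. M" UNIV by unfold_locales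
  define N where "N = PiM (UNIV :: nat set) (\<lambda>_. M)"
  have nu: "nu l p = N" by (simp add: nu_def N_def M_def)
  interpret N: prob_space N unfolding N_def by (rule P.prob_space_axioms)
  have spN: "space N = (UNIV \<rightarrow>\<^sub>E {1..l})" by (simp add: N_def space_PiM sM)
  define B where "B = (\<lambda>q. {b + q * k ..< b + q * k + k})"
  define Y where "Y = (\<lambda>q (\<omega>::nat \<Rightarrow> nat). (\<Prod>s<k. indicator {i} (\<omega> (b + q * k + s))) :: real)"
  have Y01: "Y q \<omega> = (if \<forall>s<k. \<omega> (b + q * k + s) = i then 1 else 0)" for q \<omega>
    by (auto simp: Y_def indicator_def)
  have mi: "(indicator {i} :: nat \<Rightarrow> real) \<in> borel_measurable M"
    using i by (intro borel_measurable_indicator) (simp add: sM)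
  have mY: "Y q \<in> borel_measurable (PiM J (\<lambda>_. M))" if "B q \<subseteq> J" for q J
    unfolding Y_def
  proof (rule borel_measurable_prod)
    fix s assume "s \<in> {..<k}"
    then have "b + q * k + s \<in> J" using that by (auto simp: B_def)
    then have "(\<lambda>\<omega>. \<omega> (b + q * k + s)) \<in> measurable (PiM J (\<lambda>_. M)) M"
      by (rule measurable_component_singleton)
    from measurable_compose[OF this mi]
    show "(\<lambda>\<omega>. indicator {i} (\<omega> (b + q * k + s)) :: real) \<in> borel_measurable (PiM J (\<lambda>_. M))" .
  qed
  have mYN: "Y q \<in> borel_measurable N" for q unfolding N_def by (rule mY) simp
  have eY: "N.expectation (Y q) = p i ^ k" for q
  proof -
    let ?A = "{\<omega> \<in> space N. \<forall>t\<in>B q. \<omega> t \<in> {i}}"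
    have "N.expectation (Y q) = N.expectation (indicator ?A)"
    proof (rule Bochner_Integration.integral_cong)
      fix \<omega> assume w: "\<omega> \<in> space N"
      have "(\<forall>t\<in>B q. \<omega> t \<in> {i}) \<longleftrightarrow> (\<forall>s<k. \<omega> (b + q * k + s) = i)"
      proof (intro iffI allI impI ballI)
        fix t assume a: "\<forall>s<k. \<omega> (b + q * k + s) = i" and t: "t \<in> B q"
        have "t = b + q * k + (t - (b + q * k))" "t - (b + q * k) < k" using t by (auto simp: B_def)
        then show "\<omega> t \<in> {i}" using a by (metis singletonI)
      qed (auto simp: B_def)
      then show "Y q \<omega> = indicator ?A \<omega>" using w by (auto simp: Y01)
    qed simp
    also have "\<dots> = measure N ?A" by (simp add: Int_absorb2)
    also have "emeasure N ?A = (\<Prod>t\<in>B q. emeasure M {i})"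
      unfolding N_def by (rule emeasure_PiM_Collect) (use i in \<open>auto simp: B_def sM\<close>)
    then have "measure N ?A = p i ^ k"
      using ppos i by (simp add: measure_def eM B_def prod_constant ennreal_power less_imp_le)
    finally show ?thesis .
  qed
  \<comment> \<open>\<open>Y q\<close> depends only on the coordinates in \<open>B q\<close>, and
    independence of the coordinates passes to their restrictions to disjoint index sets.\<close>
  have ind: "N.indep_vars (\<lambda>_. borel) Y I" for I
  proof -
    have 0: "N.indep_vars (\<lambda>_. M) (\<lambda>t \<omega>. \<omega> t) UNIV"
    proof (subst N.indep_vars_iff_distr_eq_PiM)
      show "N.random_variable M (\<lambda>\<omega>. \<omega> t)" for t unfolding N_def by simp
      show "distr N (PiM UNIV (\<lambda>_. M)) (\<lambda>x. \<lambda>t\<in>UNIV. x t) = (\<Pi>\<^sub>M t\<in>UNIV. distr N M (\<lambda>\<omega>. \<omega> t))"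
        unfolding N_def by (simp add: PiM_component distr_id2 restrict_UNIV)
    qed simp
    have "N.indep_vars (\<lambda>q. PiM (B q) (\<lambda>_. M)) (\<lambda>q \<omega>. restrict (\<lambda>t. \<omega> t) (B q)) I"
    proof (rule N.indep_vars_restrict[OF 0])
      show "disjoint_family_on B I"
        unfolding disjoint_family_on_def
      proof (intro ballI impI)
        fix q r :: nat assume "q \<noteq> r"
        then have "q + 1 \<le> r \<or> r + 1 \<le> q" by linarith
        then have "(q + 1) * k \<le> r * k \<or> (r + 1) * k \<le> q * k" using mult_le_mono1 by blast
        then show "B q \<inter> B r = {}" by (auto simp: B_def)
      qed
    qed simp
    from N.indep_vars_compose2[OF this, of Y "\<lambda>_. borel"]
    have "N.indep_vars (\<lambda>_. borel) (\<lambda>q \<omega>. Y q (restrict (\<lambda>t. \<omega> t) (B q))) I"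
      using mY by auto
    moreover have "Y q (restrict (\<lambda>t. \<omega> t) (B q)) = Y q \<omega>" for q \<omega>
      by (auto simp: Y_def B_def intro!: prod.cong)
    ultimately show ?thesis by simp
  qed
  define r where "r = p i ^ k"
  have r: "0 < r" using ppos i by (simp add: r_def)
  define E where "E = (\<lambda>Q. {\<omega> \<in> space N. (\<Sum>q<Q. Y q \<omega>) \<le> r * Q / 2})"
  have pE: "measure N (E Q) \<le> exp (- (r\<^sup>2 / 2)) ^ Q" for Q
  \<comment> \<open>The Hoeffding exponent divides by the sum of squared ranges, which is Q; for Q =
    0 the bound is 1.\<close>
  proof (cases "Q = 0")
    case False
    interpret H: Hoeffding_ineq N "{..<Q}" Y "\<lambda>_. 0" "\<lambda>_. 1" "\<Sum>q<Q. N.expectation (Y q)"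
    proof (unfold_locales)
      show "N.indep_vars (\<lambda>_. borel) Y {..<Q}" by (rule ind)
      show "AE x in N. Y q x \<in> {0..1}" for q by (simp add: Y01)
    qed auto
    have "measure N {\<omega> \<in> space N. (\<Sum>q<Q. Y q \<omega>) \<le> (\<Sum>q<Q. N.expectation (Y q)) - r * Q / 2} \<le>
      exp (- 2 * (r * Q / 2)\<^sup>2 / (\<Sum>q<Q. (1 - 0)\<^sup>2))"
      using r False by (intro H.Hoeffding_ineq_le) auto
    also have "(\<Sum>q<Q. N.expectation (Y q)) - r * Q / 2 = r * Q / 2" by (simp add: eY r_def)
    also have "- 2 * (r * Q / 2)\<^sup>2 / (\<Sum>q<Q. (1 - 0)\<^sup>2) = Q * (- (r\<^sup>2 / 2))"
      using False by (simp add: power2_eq_square field_simps)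
    also have "exp (Q * (- (r\<^sup>2 / 2))) = exp (- (r\<^sup>2 / 2)) ^ Q" by (rule exp_of_nat_mult)
    finally show ?thesis unfolding E_def .
  qed simp
  have "AE \<omega> in N. \<forall>\<^sub>F Q in sequentially. \<omega> \<in> space N - E Q"
  proof (rule borel_cantelli_AE1)
    show "E Q \<in> sets N" for Q unfolding E_def using mYN by measurable
    show "emeasure N (E Q) < \<infinity>" for Q by (simp add: less_top[symmetric])
    show "summable (\<lambda>Q. measure N (E Q))"
    proof (rule summable_comparison_test'[of "\<lambda>Q. exp (- (r\<^sup>2 / 2)) ^ Q" 0])
      show "summable (\<lambda>Q. exp (- (r\<^sup>2 / 2)) ^ Q)" using r by (intro summable_geometric) simp
    qed (use pE in auto)
  qed
  then show ?thesis
    unfolding nu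
  proof (rule AE_mp, intro AE_I2 impI)
    fix \<omega> assume w: "\<omega> \<in> space N" and ev: "\<forall>\<^sub>F Q in sequentially. \<omega> \<in> space N - E Q"
    show "\<forall>\<^sub>F Q in sequentially. p i ^ k * Q / 2 \<le> real (card {q\<in>{..<Q}. \<forall>s<k. \<omega> (b + q * k + s) = i})"
      using ev
    proof eventually_elim
      case (elim Q)
      have "(\<Sum>q<Q. Y q \<omega>) = real (card {q\<in>{..<Q}. \<forall>s<k. \<omega> (b + q * k + s) = i})"
        by (simp add: Y01 sum.If_cases Int_def)
      then show ?case using elim w by (auto simp: E_def r_def)
    qed
  qed
qed

text \<open>A block of Suc K symbols a consists of a run of length K and the next map.\<close>
lemma (in obs) bvar_linear:
  assumes g: "adm g" and f: "dens f" "posd f" and c: "0 < c" and r: "0 < r"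
    and K: "\<And>j. run g j a K \<Longrightarrow> g j = a \<Longrightarrow> c \<le> mvar g f j"
    and ev: "\<forall>\<^sub>F Q in sequentially. r * real Q \<le> real (card {q\<in>{..<Q}. \<forall>s<Suc K. g (q * Suc K + s) = a})"
  shows "\<exists>N. \<forall>n\<ge>N. c * r / (2 * Suc K) * real n \<le> bvar g f {..<n}"
proof -
  obtain Q0 where Q0: "\<And>Q. Q0 \<le> Q \<Longrightarrow> r * real Q \<le> real (card {q\<in>{..<Q}. \<forall>s<Suc K. g (q * Suc K + s) = a})"
    using ev by (auto simp: eventually_sequentially)
  have "c * r / (2 * Suc K) * real n \<le> bvar g f {..<n}" if n: "Suc (Suc Q0) * Suc K \<le> n" for n
  proof -
    define Q where "Q = n div Suc K"
    have Q: "Suc (Suc Q0) \<le> Q" unfolding Q_def using n by (metis div_le_mono nonzero_mult_div_cancel_right nat.distinct(2))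
    define W where "W = {q\<in>{..<Q}. \<forall>s<Suc K. g (q * Suc K + s) = a}"
    \<comment> \<open>The factor 2 absorbs the incomplete last block: n \<le> (Q + 1) (K + 1) \<le>
      2 Q (K + 1).\<close>
    have nQ: "real n \<le> 2 * Suc K * real Q"
    proof -
      have "n = Q * Suc K + n mod Suc K" unfolding Q_def by (rule div_mult_mod_eq[symmetric])
      moreover have "n mod Suc K < Suc K" by simp
      ultimately have "n \<le> Q * Suc K + Suc K" by linarith
      also have "\<dots> \<le> 2 * Suc K * Q" using Q by (cases Q) auto
      finally have "real n \<le> real (2 * Suc K * Q)" unfolding of_nat_le_iff .
      then show ?thesis by (simp only: of_nat_mult of_nat_numeral)
    qed
    have "c * r / (2 * Suc K) * real n \<le> c * r / (2 * Suc K) * (2 * Suc K * real Q)"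
      using nQ c r by (intro mult_left_mono) auto
    also have "\<dots> = c * (r * real Q)" by (simp del: of_nat_Suc)
    also have "\<dots> \<le> c * real (card W)" using Q0[of Q] Q c by (intro mult_left_mono) (auto simp: W_def)
    also have "\<dots> = (\<Sum>q\<in>W. c)" by simp
    also have "\<dots> \<le> (\<Sum>q\<in>W. mvar g f (q * Suc K + K))"
    proof (rule sum_mono)
      fix q assume "q \<in> W"
      then have w: "\<And>s. s < Suc K \<Longrightarrow> g (q * Suc K + s) = a" by (auto simp: W_def)
      show "c \<le> mvar g f (q * Suc K + K)"
        by (rule K) (use w in \<open>auto simp: run_def\<close>)
    qed
    also have "\<dots> = (\<Sum>j\<in>(\<lambda>q. q * Suc K + K) ` W. mvar g f j)"
    proof (subst sum.reindex)
      show "inj_on (\<lambda>q. q * Suc K + K) W" by (rule inj_onI) (simp del: mult_Suc_right)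
    qed simp
    also have "\<dots> \<le> (\<Sum>j<n. mvar g f j)"
    proof (rule sum_mono2)
      show "(\<lambda>q. q * Suc K + K) ` W \<subseteq> {..<n}"
      proof (rule image_subsetI)
        fix q assume "q \<in> W"
        then have "Suc q * Suc K \<le> Q * Suc K" by (intro mult_le_mono1) (auto simp: W_def)
        also have "\<dots> \<le> n" unfolding Q_def by (rule div_times_less_eq_dividend)
        finally show "q * Suc K + K \<in> {..<n}" by simp
      qed
    qed (use mvar_nonneg[OF g f(1)] in auto)
    also have "\<dots> \<le> bvar g f {..<n}" by (rule bvar_ge_sum_mvar[OF g f])
    finally show ?thesis .
  qed
  then show ?thesis by blast
qed

section \<open>Passage from Lebesgue measure on [0,1] to \<open>mu\<close>\<close>

lemma Tcomp_orb: "Tcomp \<alpha> \<omega> n x = orb (\<lambda>j. \<alpha> (\<omega> j)) n x"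
  by (induction n) auto

text \<open>The measures differ by the null point 0 and by completion. The uncontrolled value h 0 is
  carried along on the singleton until it is discarded almost everywhere.\<close>

lemma integral_m01:
  fixes h :: "real \<Rightarrow> real"
  assumes h: "h \<in> borel_measurable mu"
  shows "integral\<^sup>L m01 h = integral\<^sup>L mu h"
proof -
  let ?h = "\<lambda>x. h x * indicator {0<..1} x"
  have b: "?h \<in> borel_measurable borel" by (rule indicator_mu_measurable[OF h])
  have e: "indicator {0..1} x *\<^sub>R h x = ?h x + indicator {0} x * h 0" for x by (auto simp: indicator_def)
  have "integral\<^sup>L m01 h = (\<integral>x. indicator {0..1} x *\<^sub>R h x \<partial>lebesgue)"
    by (rule integral_restrict_space) simp
  also have "\<dots> = (\<integral>x. indicator {0..1} x *\<^sub>R h x \<partial>lborel)"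
    unfolding e using b by (intro integral_completion) simp
  also have "\<dots> = (\<integral>x. indicator {0<..1} x *\<^sub>R h x \<partial>lborel)"
  proof (rule integral_cong_AE)
    show "AE x in lborel. indicator {0..1} x *\<^sub>R h x = indicator {0<..1} x *\<^sub>R h x"
      using AE_lborel_singleton[of "0::real"] by eventually_elim (auto simp: indicator_def)
    show "(\<lambda>x. indicator {0..1} x *\<^sub>R h x) \<in> borel_measurable lborel"
      unfolding e using b by simp
    show "(\<lambda>x. indicator {0<..1} x *\<^sub>R h x) \<in> borel_measurable lborel"
      using b by (simp add: mult.commute)
  qed
  also have "\<dots> = integral\<^sup>L mu h" unfolding mu_def by (rule integral_restrict_space[symmetric]) simp
  finally show ?thesis .
qed

lemma measure_m01:
  assumes "(indicator A :: real \<Rightarrow> real) \<in> borel_measurable mu" "A \<subseteq> {0..1}"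
  shows "measure m01 A = (\<integral>x. indicator A x \<partial>mu)"
  using integral_m01[OF assms(1)] assms(2) by (simp add: Int_absorb2)

lemma C1_obs:
  assumes "C1_on_01 \<phi>" shows "\<exists>L. obs \<phi> L"
proof -
  obtain f' where f': "continuous_on {0..1} f'" "\<And>x. x \<in> {0..1} \<Longrightarrow> (\<phi> has_real_derivative f' x) (at x within {0..1})"
    using assms by (auto simp: C1_on_01_def)
  have "bounded (f' ` {0..1})" using f'(1) by (intro compact_imp_bounded compact_continuous_image) auto
  then obtain B where "\<forall>y\<in>f' ` {0..1}. norm y \<le> B" using bounded_iff by blast
  then have B: "\<And>x. x \<in> {0..1} \<Longrightarrow> norm (f' x) \<le> B" by blast
  have B0: "0 \<le> B" using B[of 0] by (auto intro: order_trans[OF norm_ge_zero])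
  have lip: "\<bar>\<phi> x - \<phi> y\<bar> \<le> B * \<bar>x - y\<bar>" if "x \<in> {0..1}" "y \<in> {0..1}" for x y
    using field_differentiable_bound[of "{0..1}" \<phi> f' B x y] f'(2) B that by auto
  \<comment> \<open>The value at 1 converts the Lipschitz bound into a sup bound, and the summand 1
    makes the constant positive.\<close>
  have "obs \<phi> (B + \<bar>\<phi> 1\<bar> + 1)"
  proof
    fix x :: real assume x: "0 < x" "x \<le> 1"
    have "\<bar>\<phi> x - \<phi> 1\<bar> \<le> B * 1" using x B0 by (intro order_trans[OF lip] mult_left_mono) auto
    then show "\<bar>\<phi> x\<bar> \<le> B + \<bar>\<phi> 1\<bar> + 1" by linarith
  next
    fix x y :: real assume x: "0 < x" "x \<le> y" "y \<le> 1"
    have "\<bar>\<phi> x - \<phi> y\<bar> \<le> B * (y - x)" using lip[of x y] x by (simp add: abs_minus_commute)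
    also have "\<dots> \<le> (B + \<bar>\<phi> 1\<bar> + 1) * (y - x)" using x by (intro mult_right_mono) auto
    finally show "\<bar>\<phi> x - \<phi> y\<bar> \<le> (B + \<bar>\<phi> 1\<bar> + 1) * (y - x)" .
  qed (use B0 in linarith)
  then show ?thesis by blast
qed

text \<open>A solution for \<open>mu\<close> is extended by 0. Since the map preserves (0,1], the
  equation survives almost everywhere, and the extension is Borel, hence Lebesgue
  measurable.\<close>

lemma noncob_mu:
  fixes \<phi> :: "real \<Rightarrow> real"
  assumes a: "0 < a" and nc: "\<not> (\<exists>u c. u \<in> borel_measurable m01 \<and> (AE x in m01. \<phi> x = c + u (LSV a x) - u x))"
  shows "\<not> (\<exists>u c. u \<in> borel_measurable mu \<and> (AE x in mu. \<phi> x = c + u (LSV a x) - u x))"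
proof
  assume "\<exists>u c. u \<in> borel_measurable mu \<and> (AE x in mu. \<phi> x = c + u (LSV a x) - u x)"
  then obtain u c where u: "u \<in> borel_measurable mu" "AE x in mu. \<phi> x = c + u (LSV a x) - u x" by blast
  define v where "v = (\<lambda>x. u x * indicator {0<..1} x)"
  have vb: "v \<in> borel_measurable borel" unfolding v_def by (rule indicator_mu_measurable[OF u(1)])
  have vm: "v \<in> borel_measurable m01"
    using vb by (intro measurable_restrict_space1 measurable_completion) simp
  have "AE x in lborel. x \<in> {0<..1} \<longrightarrow> \<phi> x = c + u (LSV a x) - u x"
    using u(2) unfolding mu_def by (subst (asm) AE_restrict_space_iff) auto
  then have "AE x in lborel. x \<in> {0..1} \<longrightarrow> \<phi> x = c + v (LSV a x) - v x"
    using AE_lborel_singleton[of "0::real"]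
  proof eventually_elim
    case (elim x)
    then show ?case using LSV_range[OF a, of x] by (auto simp: v_def)
  qed
  then have "AE x in m01. \<phi> x = c + v (LSV a x) - v x"
    by (subst AE_restrict_space_iff) (auto simp: AE_completion_iff)
  then show False using nc vm by blast
qed

context obs
begin

text \<open>The sum starts at j = 1, whereas \<open>bsum\<close> starts at time 0. The first map is
  absorbed into the start: it carries Lebesgue measure to the density
  \<open>tr_op (g 0) (\<lambda>_. 1)\<close>, and the remaining parameters are shifted by
  one.\<close>

lemma Sn_bsum:
  assumes w: "adm g" and g: "g = (\<lambda>j. \<alpha> (\<omega> j))" and x: "0 < x" "x \<le> 1"
  shows "Sn \<alpha> \<phi> n \<omega> x = bsum (shift_seq g 1) (tr_op (g 0) (\<lambda>_. 1)) {..<n} (LSV (g 0) x)"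
proof -
  let ?g = "shift_seq g 1" and ?f = "tr_op (g 0) (\<lambda>_. 1)"
  note g0 = admD[OF w, of 0] and g' = adm_shift[OF w, of 1]
  have c: "integral\<^sup>L m01 (\<lambda>y. \<phi> (Tcomp \<alpha> \<omega> (Suc i) y)) = phi_mean ?g ?f i" for i
  proof -
    have m: "(\<lambda>y. \<phi> (orb ?g i y)) \<in> borel_measurable mu"
      by (rule measurable_compose[OF orb_measurable[OF g'] phi_measurable])
    have b: "\<bar>\<phi> (orb ?g i y)\<bar> \<le> L" if "0 < y" "y \<le> 1" for y
      using orb_range[OF g' that, of i] by (auto intro: phi_bound)
    have m': "(\<lambda>y. \<phi> (orb ?g i (LSV (g 0) y))) \<in> borel_measurable mu"
      by (rule measurable_compose[OF LSV_measurable[OF g0(1)] m])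
    have "integral\<^sup>L m01 (\<lambda>y. \<phi> (Tcomp \<alpha> \<omega> (Suc i) y)) = (\<integral>y. \<phi> (orb ?g i (LSV (g 0) y)) \<partial>mu)"
      unfolding Tcomp_orb g[symmetric] orb_Suc_front by (rule integral_m01[OF m'])
    also have "\<dots> = (\<integral>y. 1 * \<phi> (orb ?g i (LSV (g 0) y)) \<partial>mu)" by simp
    also have "\<dots> = (\<integral>y. ?f y * \<phi> (orb ?g i y) \<partial>mu)"
      by (rule tr_op_duality[OF g0 _ m b]) simp
    also have "\<dots> = (\<integral>y. tr_ops ?g i ?f y * \<phi> y \<partial>mu)"
      by (rule tr_ops_duality[OF g' _ phi_measurable phi_bound]) (use g0 in \<open>auto intro!: integrable_tr_op\<close>)
    finally show ?thesis by (simp add: phi_mean_def)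
  qed
  have "Sn \<alpha> \<phi> n \<omega> x = (\<Sum>i<n. \<phi> (Tcomp \<alpha> \<omega> (Suc i) x) - integral\<^sup>L m01 (\<lambda>y. \<phi> (Tcomp \<alpha> \<omega> (Suc i) y)))"
    unfolding Sn_def by (rule sum.reindex_bij_witness[of _ Suc "\<lambda>j. j - 1"]) auto
  also have "\<dots> = bsum ?g ?f {..<n} (LSV (g 0) x)"
    unfolding bsum_def c unfolding Tcomp_orb g[symmetric] orb_Suc_front cobs_def cphi_def ..
  finally show ?thesis .
qed

lemma sigma2_bvar:
  assumes w: "adm g" and g: "g = (\<lambda>j. \<alpha> (\<omega> j))"
  shows "sigma2 \<alpha> \<phi> n \<omega> = bvar (shift_seq g 1) (tr_op (g 0) (\<lambda>_. 1)) {..<n}"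
proof -
  let ?g = "shift_seq g 1" and ?f = "tr_op (g 0) (\<lambda>_. 1)"
  let ?S = "bsum ?g ?f {..<n}"
  note g0 = admD[OF w, of 0] and g' = adm_shift[OF w, of 1]
  have f: "dens ?f" by (rule dens_tr_op[OF g0 dens_one])
  have m: "(\<lambda>x. (?S x)\<^sup>2) \<in> borel_measurable mu" using bsum_measurable[OF g'] by simp
  have b: "\<bar>(?S x)\<^sup>2\<bar> \<le> (2 * L * card {..<n})\<^sup>2" if "0 < x" "x \<le> 1" for x
    unfolding power_abs using bsum_bound[OF g' f that, of "{..<n}"] by (intro power_mono) auto
  have mT: "(\<lambda>x. (?S (LSV (g 0) x))\<^sup>2) \<in> borel_measurable mu"
    by (rule measurable_compose[OF LSV_measurable[OF g0(1)] m])
  have mS: "(\<lambda>x. (Sn \<alpha> \<phi> n \<omega> x)\<^sup>2) \<in> borel_measurable mu"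
    by (rule measurable_cong[THEN iffD1, OF _ mT]) (simp add: Sn_bsum[where \<alpha> = \<alpha> and \<omega> = \<omega>, OF w g])
  have "sigma2 \<alpha> \<phi> n \<omega> = (\<integral>x. (Sn \<alpha> \<phi> n \<omega> x)\<^sup>2 \<partial>mu)"
    unfolding sigma2_def by (rule integral_m01[OF mS])
  also have "\<dots> = (\<integral>x. 1 * (?S (LSV (g 0) x))\<^sup>2 \<partial>mu)"
    by (rule Bochner_Integration.integral_cong) (auto simp: Sn_bsum[where \<alpha> = \<alpha> and \<omega> = \<omega>, OF w g])
  also have "\<dots> = (\<integral>x. ?f x * (?S x)\<^sup>2 \<partial>mu)"
    by (rule tr_op_duality[OF g0 _ m b]) simp
  finally show ?thesis by (simp add: bvar_def)
qed

lemma measure_Sn_law: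
  assumes w: "adm g" and g: "g = (\<lambda>j. \<alpha> (\<omega> j))"
  shows "measure m01 {x\<in>{0..1}. Sn \<alpha> \<phi> n \<omega> x / sqrt (sigma2 \<alpha> \<phi> n \<omega>) \<le> t}
    = cdf (law (shift_seq g 1) (tr_op (g 0) (\<lambda>_. 1)) n) t"
proof -
  let ?g = "shift_seq g 1" and ?f = "tr_op (g 0) (\<lambda>_. 1)"
  note g0 = admD[OF w, of 0] and g' = adm_shift[OF w, of 1]
  have f: "dens ?f" by (rule dens_tr_op[OF g0 dens_one])
  define Z where "Z = (\<lambda>x. bsum ?g ?f {..<n} x / sqrt (bvar ?g ?f {..<n}))"
  have mZ: "Z \<in> borel_measurable mu" unfolding Z_def using bsum_measurable[OF g'] by simp
  define A where "A = {x\<in>{0..1}. Sn \<alpha> \<phi> n \<omega> x / sqrt (sigma2 \<alpha> \<phi> n \<omega>) \<le> t}"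
  have A: "indicator A x = (indicator {..t} (Z (LSV (g 0) x)) :: real)" if "0 < x" "x \<le> 1" for x
    using that unfolding A_def by (simp add: indicator_def Z_def Sn_bsum[where \<alpha> = \<alpha> and \<omega> = \<omega>, OF w g that] sigma2_bvar[where \<alpha> = \<alpha> and \<omega> = \<omega>, OF w g])
  have m: "(\<lambda>x. indicator {..t} (Z x) :: real) \<in> borel_measurable mu" using mZ by measurable
  have mA: "(indicator A :: real \<Rightarrow> real) \<in> borel_measurable mu"
    by (rule measurable_cong[THEN iffD1, OF _ measurable_compose[OF LSV_measurable[OF g0(1)] m]]) (simp add: A)
  have "measure m01 A = (\<integral>x. indicator A x \<partial>mu)" by (rule measure_m01[OF mA]) (auto simp: A_def)
  also have "\<dots> = (\<integral>x. 1 * indicator {..t} (Z (LSV (g 0) x)) \<partial>mu)"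
    by (rule Bochner_Integration.integral_cong) (auto simp: A)
  also have "\<dots> = (\<integral>x. ?f x * indicator {..t} (Z x) \<partial>mu)"
    by (rule tr_op_duality[OF g0 _ m, where B = 1]) (auto simp: indicator_def)
  also have "\<dots> = (\<integral>x. ?f x *\<^sub>R indicator {..t} (Z x) \<partial>mu)" by simp
  also have "\<dots> = (\<integral>x. indicator {..t} (Z x) \<partial>density mu (\<lambda>x. ennreal (?f x)))"
    using dens_nonneg[OF f] dens_integrable[OF f] m by (intro integral_density[symmetric] AE_mu) auto
  also have "\<dots> = (\<integral>x. indicator {..t} x \<partial>law ?g ?f n)"
    unfolding law_def Z_def by (rule integral_distr[symmetric, OF law_measurable[OF g']]) simp
  also have "\<dots> = cdf (law ?g ?f n) t" by (simp add: cdf_def law_def)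
  finally show ?thesis unfolding A_def .
qed

end

theorem mainTheorem15:
  fixes l :: nat and \<alpha> p :: "nat \<Rightarrow> real" and \<phi> :: "real \<Rightarrow> real"
  assumes alpha: "\<forall>i\<in>{1..l}. 0 < \<alpha> i \<and> \<alpha> i < 1/9"
    and ppos: "\<forall>i\<in>{1..l}. p i > 0"
    and psum: "(\<Sum>i=1..l. p i) = 1"
    and C1: "C1_on_01 \<phi>"
    and noncob: "\<exists>i\<in>{1..l}. \<not> (\<exists>u c. u \<in> borel_measurable m01 \<and>
                    (AE x in m01. \<phi> x = c + u (LSV (\<alpha> i) x) - u x))"
  shows "\<exists>C>0. AE \<omega> in nu l p.
           (\<exists>N. \<forall>n\<ge>N. sigma2 \<alpha> \<phi> n \<omega> \<ge> C * real n) \<and>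
           (\<forall>t. (\<lambda>n. measure m01 {x\<in>{0..1}. Sn \<alpha> \<phi> n \<omega> x / sqrt (sigma2 \<alpha> \<phi> n \<omega>) \<le> t})
                  \<longlonglongrightarrow> std_normal_cdf t)"
proof -
  obtain L where "obs \<phi> L" using C1_obs[OF C1] by blast
  then interpret obs \<phi> L .
  obtain i where i: "i \<in> {1..l}"
    and nc: "\<not> (\<exists>u c. u \<in> borel_measurable m01 \<and> (AE x in m01. \<phi> x = c + u (LSV (\<alpha> i) x) - u x))"
    using noncob by blast
  have ai: "0 < \<alpha> i" "\<alpha> i \<le> 1/9" using alpha i by (auto intro: less_imp_le)
  obtain K c where c: "0 < c" and K: "\<And>g f j. adm g \<Longrightarrow> dens f \<Longrightarrow> posd f \<Longrightarrow> run g j (\<alpha> i) K \<Longrightarrow> g j = \<alpha> i \<Longrightarrow> c \<le> mvar g f j"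
    using mvar_pos[OF ai noncob_mu[OF ai(1) nc]] by blast
  define r where "r = p i ^ Suc K / 2"
  have r: "0 < r" using ppos i by (simp add: r_def)
  \<comment> \<open>Fixed before \<omega>: it depends only on K, c and p i.\<close>
  define C where "C = c * r / (2 * Suc K)"
  have C: "0 < C" using c r by (simp add: C_def)
  have sp: "space (nu l p) = (UNIV \<rightarrow>\<^sub>E {1..l})"
    by (simp add: nu_def space_PiM space_point_measure)
  have "AE \<omega> in nu l p.
           (\<exists>N. \<forall>n\<ge>N. sigma2 \<alpha> \<phi> n \<omega> \<ge> C * real n) \<and>
           (\<forall>t. (\<lambda>n. measure m01 {x\<in>{0..1}. Sn \<alpha> \<phi> n \<omega> x / sqrt (sigma2 \<alpha> \<phi> n \<omega>) \<le> t})
                  \<longlonglongrightarrow> std_normal_cdf t)"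
    \<comment> \<open>The offset 1 skips the first symbol, which acts only through the starting
      density \<open>?f\<close> below.\<close>
    using nu_block_frequency[OF ppos psum i, of "Suc K" 1] AE_space
  proof eventually_elim
    case (elim \<omega>)
    define g where "g = (\<lambda>j. \<alpha> (\<omega> j))"
    have w: "\<omega> j \<in> {1..l}" for j using elim(2) sp by auto
    have g: "adm g" using alpha w by (auto simp: adm_def g_def intro: less_imp_le)
    let ?g = "shift_seq g 1" and ?f = "tr_op (g 0) (\<lambda>_. 1)"
    have g': "adm ?g" by (rule adm_shift[OF g])
    have f: "dens ?f" by (rule dens_tr_op[OF admD[OF g] dens_one])
    have f': "posd ?f" using tr_ops_pos[OF g, of "\<lambda>_. 1" _ 1] by (simp add: posd_def)
    have ev: "\<forall>\<^sub>F Q in sequentially. r * real Q \<le> real (card {q\<in>{..<Q}. \<forall>s<Suc K. ?g (q * Suc K + s) = \<alpha> i})"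
      using elim(1)
    proof eventually_elim
      case (elim Q)
      \<comment> \<open>In general only an inequality, since different symbols may carry the same
        parameter.\<close>
      have "card {q\<in>{..<Q}. \<forall>s<Suc K. \<omega> (1 + q * Suc K + s) = i} \<le> card {q\<in>{..<Q}. \<forall>s<Suc K. ?g (q * Suc K + s) = \<alpha> i}"
      proof (rule card_mono)
        have e: "1 + q * Suc K + s = q * Suc K + s + 1" for q s by simp
        show "{q\<in>{..<Q}. \<forall>s<Suc K. \<omega> (1 + q * Suc K + s) = i} \<subseteq> {q\<in>{..<Q}. \<forall>s<Suc K. ?g (q * Suc K + s) = \<alpha> i}"
          unfolding g_def e by auto
      qed simp
      then have "real (card {q\<in>{..<Q}. \<forall>s<Suc K. \<omega> (1 + q * Suc K + s) = i}) \<le> real (card {q\<in>{..<Q}. \<forall>s<Suc K. ?g (q * Suc K + s) = \<alpha> i})"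
        unfolding of_nat_le_iff .
      then show ?case using elim by (simp add: r_def)
    qed
    obtain N where N: "\<And>n. N \<le> n \<Longrightarrow> C * real n \<le> bvar ?g ?f {..<n}"
      using bvar_linear[OF g' f f' c r K[OF g' f f'] ev] unfolding C_def by blast
    show ?case
    proof (intro conjI allI)
      show "\<exists>N. \<forall>n\<ge>N. sigma2 \<alpha> \<phi> n \<omega> \<ge> C * real n"
        using N unfolding sigma2_bvar[where \<alpha> = \<alpha> and \<omega> = \<omega>, OF g g_def] by blast
      show "(\<lambda>n. measure m01 {x\<in>{0..1}. Sn \<alpha> \<phi> n \<omega> x / sqrt (sigma2 \<alpha> \<phi> n \<omega>) \<le> t}) \<longlonglongrightarrow> std_normal_cdf t" for t
        unfolding measure_Sn_law[where \<alpha> = \<alpha> and \<omega> = \<omega>, OF g g_def] cdf_std_normal[symmetric]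
        by (rule clt_law[OF g' f C N])
    qed
  qed
  then show ?thesis using C by blast
qed

end
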